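(* The forward operator $$F:\mathcal K\to L^2(\Omega'_\pi;\mathbb R),\qquad F(f)=\Big|\mathcal D_{\mathrm{Fr}}\big(P\,e^{ik\widetilde O(f)}\big)\Big|^2,$$ is well-defined and continuous (with respect to the $L^2(\Omega;\mathbb C)$-norm on $\mathcal K$ and the $L^2(\Omega'_\pi)$-norm on the target). Moreover, its extension $$\hat F:L^2(\Omega;\mathbb C)\to L^2(\Omega'_\pi;\mathbb R),\qquad \hat F(f)=\Big|\mathcal D_{\mathrm{Fr}}\big(P\,\hat e^{\,ik\widetilde O(f)}\big)\Big|^2,$$ is Fréchet differentiable at every $f\in\mathcal K$, with derivative $$F'(f)[h]=2\,\Re\!\left(\overline{\mathcal D_{\mathrm{Fr}}\big(P e^{ik\widetilde O(f)}\big)}\;\mathcal D_{\mathrm{Fr}}\big(ik\,P e^{ik\widetilde O(f)}\cdot\widetilde O(h)\big)\right),\qquad h\in L^2(\Omega;\mathbb C).$$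
   Context: Setting. $\Omega\subset\mathbb R^3$ is a bounded domain with coordinates $(x,y,z)$ (object domain), $\Omega'\subset\mathbb R^2$ is a bounded domain (detector window), $\Omega'_\pi=\Omega'\times[0,\pi)$. $k>0$ and $\mathrm{Fr}>0$ are fixed constants. The probe $P\in L^\infty(\mathbb R^2;\mathbb C)$ has a uniform positive lower bound in modulus; it is regarded as a function of $(\mathbf x,\theta)$ that does not depend on $\theta$. Complex-valued spaces are regarded as real Banach spaces for the purpose of Fréchet differentiation. Admissible set: $\mathcal K=\{f\in L^2(\Omega;\mathbb C):\Re f\le 0,\ \Im f\ge 0\text{ a.e. in }\Omega\}$. Projection: for $f\in L^2(\Omega;\mathbb C)$, extended by zero to $\mathbb R^3$, and $\theta\in[0,\pi)$, let $f_\theta(x,y,z)=f(x\cos\theta-z\sin\theta,\,y,\,x\sin\theta+z\cos\theta)$ and $$\widetilde O(f)(x,y,\theta)=\int_{\mathbb R}f_\theta(x,y,z)\,dz,\qquad (x,y)\in\Omega',\ \theta\in[0,\pi).$$ Then $\widetilde O: L^2(\Omega;\mathbb C)\to L^2(\Omega'_\pi;\mathbb C)$ is a bounded linear operator. Extended exponential: $S\in C^1(\mathbb R)$ is a fixed monotone function with $S(t)=t$ for $t\ge0$ and $S(t)\ge-\frac1k$ for $t<0$; one sets $\hat e^{\,ikz}:=e^{ik(\Re z+i\,S(\Im z))}$ for $z\in\mathbb C$, so that $\hat e^{\,ikz}=e^{ikz}$ when $\Im z\ge0$ and $|\hat e^{\,ikz}|\le e$ for all $z$. Fresnel propagator: $\mathcal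 D_{\mathrm{Fr}}u=\mathcal F^{-1}[H_d\cdot\mathcal F u]$, with $H_d(\xi)=\exp\!\big(-i\pi\frac{|\xi|^2}{2\,\mathrm{Fr}}\big)$, $\xi\in\mathbb R^2$, where $\mathcal F$ is the two-dimensional Fourier transform, normalized to be unitary on $L^2(\mathbb R^2)$, acting in the variable $\mathbf x=(x,y)$ for each fixed $\theta$. A function on $\Omega'_\pi$ is extended by zero to $\mathbb R^2\times[0,\pi)$ before $\mathcal D_{\mathrm{Fr}}$ is applied, and the result is restricted to $\Omega'_\pi$. *)

theory Defs
  imports "HOL-Analysis.Analysis"
begin

definition bounded_domain :: "'a::metric_space set \<Rightarrow> bool" where
  "bounded_domain S \<longleftrightarrow> open S \<and> connected S \<and> bounded S \<and> S \<noteq> {}"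

subsection \<open>Square-integrable functions\<close>

text \<open>
  Elements of \<open>L\<^sup>2(M)\<close> are handled through representatives; \<open>L2_norm\<close> is meaningful
  on \<open>L2 M\<close> only and vanishes there exactly for functions that are zero almost everywhere.
  Over Lebesgue measure we use Borel representatives, which every class possesses.
\<close>

definition L2 :: "'a measure \<Rightarrow> ('a \<Rightarrow> 'b::real_normed_vector) set" where
  "L2 M = {f \<in> borel_measurable M. integrable M (\<lambda>x. (norm (f x))\<^sup>2)}"

definition L2_norm :: "'a measure \<Rightarrow> ('a \<Rightarrow> 'b::real_normed_vector) \<Rightarrow> real" where
  "L2_norm M f = sqrt (\<integral>x. (norm (f x))\<^sup>2 \<partial>M)"

text \<open>
  \<open>T\<close> induces a map from the classes with a representative in \<open>X\<close> into \<open>L\<^sup>2(N)\<close>.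
\<close>

definition L2_well_defined_on ::
  "'a measure \<Rightarrow> 'c measure \<Rightarrow> ('a \<Rightarrow> 'b::real_normed_vector) set
    \<Rightarrow> (('a \<Rightarrow> 'b) \<Rightarrow> 'c \<Rightarrow> 'd::real_normed_vector) \<Rightarrow> bool" where
  "L2_well_defined_on M N X T \<longleftrightarrow>
     (\<forall>f\<in>X. T f \<in> L2 N) \<and>
     (\<forall>f\<in>X. \<forall>g\<in>X. (AE x in M. f x = g x) \<longrightarrow> (AE y in N. T f y = T g y))"

definition L2_continuous_on ::
  "'a measure \<Rightarrow> 'c measure \<Rightarrow> ('a \<Rightarrow> 'b::real_normed_vector) set
    \<Rightarrow> (('a \<Rightarrow> 'b) \<Rightarrow> 'c \<Rightarrow> 'd::real_normed_vector) \<Rightarrow> bool" where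
  "L2_continuous_on M N X T \<longleftrightarrow>
     (\<forall>f\<in>X. \<forall>\<epsilon>>0. \<exists>\<delta>>0. \<forall>g\<in>X.
        L2_norm M (\<lambda>x. g x - f x) < \<delta> \<longrightarrow> L2_norm N (\<lambda>y. T g y - T f y) < \<epsilon>)"

definition L2_bounded_linear ::
  "'a measure \<Rightarrow> 'c measure
    \<Rightarrow> (('a \<Rightarrow> 'b::real_normed_vector) \<Rightarrow> 'c \<Rightarrow> 'd::real_normed_vector) \<Rightarrow> bool" where
  "L2_bounded_linear M N D \<longleftrightarrow>
     L2_well_defined_on M N (L2 M) D \<and>
     (\<forall>g\<in>L2 M. \<forall>h\<in>L2 M. AE y in N. D (\<lambda>x. g x + h x) y = D g y + D h y) \<and>
     (\<forall>r::real. \<forall>h\<in>L2 M. AE y in N. D (\<lambda>x. r *\<^sub>R h x) y = r *\<^sub>R D h y) \<and>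
     (\<exists>C. \<forall>h\<in>L2 M. L2_norm N (D h) \<le> C * L2_norm M h)"

text \<open>
  \<open>D\<close> is the Frechet derivative at \<open>f\<close> of \<open>T\<close> between the real Banach
  spaces \<open>L\<^sup>2(M)\<close> and \<open>L\<^sup>2(N)\<close>, for \<open>f \<in> L2 M\<close> and \<open>T\<close> well-defined on \<open>L2 M\<close>.
\<close>

definition has_L2_frechet_derivative ::
  "'a measure \<Rightarrow> 'c measure
    \<Rightarrow> (('a \<Rightarrow> 'b::real_normed_vector) \<Rightarrow> 'c \<Rightarrow> 'd::real_normed_vector)
    \<Rightarrow> (('a \<Rightarrow> 'b) \<Rightarrow> 'c \<Rightarrow> 'd) \<Rightarrow> ('a \<Rightarrow> 'b) \<Rightarrow> bool" where
  "has_L2_frechet_derivative M N T D f \<longleftrightarrow>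
     L2_bounded_linear M N D \<and>
     (\<forall>\<epsilon>>0. \<exists>\<delta>>0. \<forall>h\<in>L2 M. L2_norm M h < \<delta> \<longrightarrow>
        L2_norm N (\<lambda>y. T (\<lambda>x. f x + h x) y - T f y - D h y) \<le> \<epsilon> * L2_norm M h)"

subsection \<open>Fourier transform and Fresnel propagator\<close>

text \<open>
  The unitary Fourier transform on \<open>L\<^sup>2(\<real>\<^sup>2)\<close>, with kernel
  \<open>(2\<pi>)\<^sup>-\<^sup>1 exp(-i x \<bullet> \<xi>)\<close>: \<open>U\<close> represents the transform of \<open>u\<close> iff
  it is the \<open>L\<^sup>2\<close>-limit of the transforms of \<open>u\<close> truncated to the squares \<open>[-R,R]\<^sup>2\<close>.
  The limit is expressed with the nonnegative integral, so that it cannot hold for lack of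
  integrability.
\<close>

definition truncated_fourier :: "real \<Rightarrow> (real \<times> real \<Rightarrow> complex) \<Rightarrow> real \<times> real \<Rightarrow> complex" where
  "truncated_fourier R u \<xi> =
     1 / (2 * of_real pi) * (LINT x:cbox (-R, -R) (R, R)|lborel. exp (- \<i> * of_real (x \<bullet> \<xi>)) * u x)"

definition is_fourier_L2 :: "(real \<times> real \<Rightarrow> complex) \<Rightarrow> (real \<times> real \<Rightarrow> complex) \<Rightarrow> bool" where
  "is_fourier_L2 u U \<longleftrightarrow> u \<in> L2 lborel \<and> U \<in> L2 lborel \<and>
     ((\<lambda>R. \<integral>\<^sup>+\<xi>. ennreal ((norm (truncated_fourier R u \<xi> - U \<xi>))\<^sup>2) \<partial>lborel) \<longlongrightarrow> 0) at_top"

definition fresnel_multiplier :: "real \<Rightarrow> real \<times> real \<Rightarrow> complex" where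
  "fresnel_multiplier Fr \<xi> = exp (- \<i> * of_real (pi * (norm \<xi>)\<^sup>2 / (2 * Fr)))"

text \<open>
  \<open>v\<close> represents the inverse transform of the multiplier times the transform of \<open>u\<close>.
\<close>

definition is_fresnel_L2 ::
  "real \<Rightarrow> (real \<times> real \<Rightarrow> complex) \<Rightarrow> (real \<times> real \<Rightarrow> complex) \<Rightarrow> bool" where
  "is_fresnel_L2 Fr u v \<longleftrightarrow>
     (\<exists>U. is_fourier_L2 u U \<and> is_fourier_L2 v (\<lambda>\<xi>. fresnel_multiplier Fr \<xi> * U \<xi>))"

text \<open>
  Propagation of \<open>u\<close>, given on \<open>\<Omega>' \<times> [0,\<pi>)\<close> and extended by zero, in the first
  variable for each \<open>\<theta>\<close>. Choosing representatives for the slices one at a time could destroy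
  measurability in \<open>\<theta>\<close>, so a jointly measurable representative is chosen; for
  \<open>u \<in> L\<^sup>2(\<Omega>' \<times> [0,\<pi>))\<close> it exists and is unique up to null sets.
\<close>

definition fresnel ::
  "real \<Rightarrow> (real \<times> real) set \<Rightarrow> ((real \<times> real) \<times> real \<Rightarrow> complex)
    \<Rightarrow> (real \<times> real) \<times> real \<Rightarrow> complex" where
  "fresnel Fr \<Omega>' u = (SOME v. v \<in> borel_measurable borel \<and>
     (AE \<theta> in lborel. \<theta> \<in> {0..<pi} \<longrightarrow>
        is_fresnel_L2 Fr (\<lambda>x. if x \<in> \<Omega>' then u (x, \<theta>) else 0) (\<lambda>x. v (x, \<theta>))))"

subsection \<open>Forward operator\<close>

definition object_measure :: "(real \<times> real \<times> real) set \<Rightarrow> (real \<times> real \<times> real) measure" where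
  "object_measure \<Omega> = restrict_space lborel \<Omega>"

definition detector_measure :: "(real \<times> real) set \<Rightarrow> ((real \<times> real) \<times> real) measure" where
  "detector_measure \<Omega>' = restrict_space lborel (\<Omega>' \<times> {0..<pi})"

definition admissible :: "(real \<times> real \<times> real) set \<Rightarrow> (real \<times> real \<times> real \<Rightarrow> complex) set" where
  "admissible \<Omega> =
     {f \<in> L2 (object_measure \<Omega>). AE p in object_measure \<Omega>. Re (f p) \<le> 0 \<and> Im (f p) \<ge> 0}"

fun rotated ::
  "(real \<times> real \<times> real \<Rightarrow> complex) \<Rightarrow> real \<Rightarrow> real \<times> real \<times> real \<Rightarrow> complex" where
  "rotated f \<theta> (x, y, z) = f (x * cos \<theta> - z * sin \<theta>, y, x * sin \<theta> + z * cos \<theta>)"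

fun projection ::
  "(real \<times> real \<times> real) set \<Rightarrow> (real \<times> real \<times> real \<Rightarrow> complex)
    \<Rightarrow> (real \<times> real) \<times> real \<Rightarrow> complex" where
  "projection \<Omega> f ((x, y), \<theta>) =
     (\<integral>z. rotated (\<lambda>p. if p \<in> \<Omega> then f p else 0) \<theta> (x, y, z) \<partial>lborel)"

definition extended_exp :: "real \<Rightarrow> (real \<Rightarrow> real) \<Rightarrow> complex \<Rightarrow> complex" where
  "extended_exp k S z = exp (\<i> * of_real k * (of_real (Re z) + \<i> * of_real (S (Im z))))"

definition exit_wave ::
  "real \<Rightarrow> (real \<times> real \<Rightarrow> complex) \<Rightarrow> (real \<times> real \<times> real) set
    \<Rightarrow> (real \<times> real \<times> real \<Rightarrow> complex) \<Rightarrow> (real \<times> real) \<times> real \<Rightarrow> complex" where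
  "exit_wave k P \<Omega> f q = P (fst q) * exp (\<i> * of_real k * projection \<Omega> f q)"

definition extended_exit_wave ::
  "real \<Rightarrow> (real \<Rightarrow> real) \<Rightarrow> (real \<times> real \<Rightarrow> complex) \<Rightarrow> (real \<times> real \<times> real) set
    \<Rightarrow> (real \<times> real \<times> real \<Rightarrow> complex) \<Rightarrow> (real \<times> real) \<times> real \<Rightarrow> complex" where
  "extended_exit_wave k S P \<Omega> f q = P (fst q) * extended_exp k S (projection \<Omega> f q)"

definition forward_op ::
  "real \<Rightarrow> real \<Rightarrow> (real \<times> real \<Rightarrow> complex) \<Rightarrow> (real \<times> real \<times> real) set \<Rightarrow> (real \<times> real) set
    \<Rightarrow> (real \<times> real \<times> real \<Rightarrow> complex) \<Rightarrow> (real \<times> real) \<times> real \<Rightarrow> real" where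
  "forward_op k Fr P \<Omega> \<Omega>' f q = (norm (fresnel Fr \<Omega>' (exit_wave k P \<Omega> f) q))\<^sup>2"

definition extended_forward_op ::
  "real \<Rightarrow> real \<Rightarrow> (real \<Rightarrow> real) \<Rightarrow> (real \<times> real \<Rightarrow> complex)
    \<Rightarrow> (real \<times> real \<times> real) set \<Rightarrow> (real \<times> real) set
    \<Rightarrow> (real \<times> real \<times> real \<Rightarrow> complex) \<Rightarrow> (real \<times> real) \<times> real \<Rightarrow> real" where
  "extended_forward_op k Fr S P \<Omega> \<Omega>' f q =
     (norm (fresnel Fr \<Omega>' (extended_exit_wave k S P \<Omega> f) q))\<^sup>2"

definition forward_derivative ::
  "real \<Rightarrow> real \<Rightarrow> (real \<times> real \<Rightarrow> complex) \<Rightarrow> (real \<times> real \<times> real) set \<Rightarrow> (real \<times> real) set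
    \<Rightarrow> (real \<times> real \<times> real \<Rightarrow> complex) \<Rightarrow> (real \<times> real \<times> real \<Rightarrow> complex)
    \<Rightarrow> (real \<times> real) \<times> real \<Rightarrow> real" where
  "forward_derivative k Fr P \<Omega> \<Omega>' f h q =
     2 * Re (cnj (fresnel Fr \<Omega>' (exit_wave k P \<Omega> f) q) *
             fresnel Fr \<Omega>' (\<lambda>q. \<i> * of_real k * exit_wave k P \<Omega> f q * projection \<Omega> h q) q)"

end

theory Submission
  imports Defs "HOL-Probability.Characteristic_Functions" "HOL-Real_Asymp.Real_Asymp"
begin

text \<open>
  Three facts make the intensity differentiable.

  Projections are controlled at every single angle: the projection of \<open>h\<close> along the rays of one
  direction is square integrable on the detector plane, with norm at most a constant times the norm
  of \<open>h\<close>, and the constant does not depend on the angle (\<open>projection_bound\<close>).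

  The extended exponential has a first order expansion at every point \<open>g\<close> with
  \<open>Im g \<ge> 0\<close>, for increments \<open>\<eta>\<close> of any size and uniformly in \<open>g\<close>. Its remainder is at most
  \<open>\<epsilon> |\<eta>| + K |\<eta>|\<^sup>2\<close> (\<open>extended_exp_remainder\<close>). Projections of admissible objects have
  nonnegative imaginary part. For square-integrable \<open>\<eta>\<close> the quadratic term is only integrable,
  so this expansion alone gives no derivative with values in \<open>L\<^sup>2\<close>.

  The propagator repairs this. It is the convolution with the Fresnel kernel, which has constant
  modulus, and hence maps \<open>L\<^sup>1\<close> of the bounded window to bounded functions. The propagated field
  is therefore differentiable with values in the bounded functions (\<open>propagated_remainder_small\<close>),
  and the intensity, a quadratic expression in the field, is differentiable in the supremum norm,
  which on the window is stronger than the norm of \<open>L\<^sup>2\<close> (\<open>T_frechet\<close>).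

  The longest part of the proof identifies the propagator, which is defined by limits of Fourier
  transforms in \<open>L\<^sup>2\<close>, with this convolution (\<open>is_fresnel_L2_characterization\<close>). Everything starts
  from the transform of a complex Gaussian (\<open>gaussian_fourier\<close>). A Gaussian factor makes Fubini's
  theorem applicable to the Parseval integral; letting its real part tend to zero yields Bessel's
  inequality (\<open>fourier_L2\<close>) and the fact that convolution and multiplier agree in the weak sense
  (\<open>fresnel_duality\<close>). The convolution is itself a rescaled Fourier transform between two
  quadratic phases. This symmetry improves Bessel's inequality to the equality of norms that is
  required for strong convergence (\<open>fresnel_conv_isometry\<close>). Uniqueness follows from the
  convergence of Gaussian means (\<open>AE_zero_if_fourier_zero\<close>).
\<close>

section \<open>Fourier integrals of complex Gaussians\<close>

text \<open>
  By the mean value inequality the difference quotients are dominated by the bound on the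
  derivative, so dominated convergence applies along every sequence of parameters.
\<close>

lemma has_vector_derivative_integral_param:
  fixes f f' :: "real \<Rightarrow> 'a \<Rightarrow> 'b::euclidean_space"
  assumes int: "\<And>s. integrable M (f s)"
    and deriv: "\<And>s t. ((\<lambda>s. f s t) has_vector_derivative f' s t) (at s)"
    and bound: "\<And>s t. norm (f' s t) \<le> w t"
    and w: "integrable M w"
    and meas: "\<And>s. f' s \<in> borel_measurable M"
  shows "((\<lambda>s. \<integral>t. f s t \<partial>M) has_vector_derivative (\<integral>t. f' s t \<partial>M)) (at s)"
proof -
  have int': "integrable M (f' s)"
    by (rule Bochner_Integration.integrable_bound[OF w meas]) (use bound in \<open>auto intro!: AE_I2 intro: order_trans[OF _ abs_ge_self]\<close>)
  have lip: "norm (f y t - f z t) \<le> w t * norm (y - z)" for y z t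
  proof (rule differentiable_bound[of UNIV "\<lambda>s. f s t" "\<lambda>s h. h *\<^sub>R f' s t"])
    show "onorm (\<lambda>h. h *\<^sub>R f' x t) \<le> w t" for x
      by (rule order_trans[OF onorm_scaleR_left_lemma[OF bounded_linear_ident]])
         (use bound[of x t] in \<open>simp add: onorm_id\<close>)
  qed (use deriv in \<open>auto simp: has_vector_derivative_def\<close>)
  have "((\<lambda>y. norm (((\<integral>t. f y t \<partial>M) - (\<integral>t. f s t \<partial>M)) - (y - s) *\<^sub>R (\<integral>t. f' s t \<partial>M)) / norm (y - s)) \<longlongrightarrow> 0) (at s)"
    unfolding tendsto_at_iff_sequentially comp_def
  proof (intro allI impI)
    fix X :: "nat \<Rightarrow> real" assume X: "\<forall>i. X i \<in> UNIV - {s}" "X \<longlonglongrightarrow> s"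
    define q where "q i t = (1 / norm (X i - s)) *\<^sub>R (f (X i) t - f s t - (X i - s) *\<^sub>R f' s t)" for i t
    have "(\<lambda>i. \<integral>t. q i t \<partial>M) \<longlonglongrightarrow> (\<integral>t. 0 \<partial>M)"
    proof (rule integral_dominated_convergence[where w="\<lambda>t. 2 * w t"])
      show "AE t in M. (\<lambda>i. q i t) \<longlonglongrightarrow> 0"
      proof (rule AE_I2)
        fix t
        have "((\<lambda>y. norm ((f y t - f s t) - (y - s) *\<^sub>R f' s t) / norm (y - s)) \<longlongrightarrow> 0) (at s)"
          using deriv[of t s] unfolding has_vector_derivative_def has_derivative_iff_norm by simp
        then have "(\<lambda>i. norm ((f (X i) t - f s t) - (X i - s) *\<^sub>R f' s t) / norm (X i - s)) \<longlonglongrightarrow> 0"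
          using X unfolding tendsto_at_iff_sequentially comp_def by auto
        then show "(\<lambda>i. q i t) \<longlonglongrightarrow> 0"
          by (subst tendsto_norm_zero_iff[symmetric]) (simp add: q_def)
      qed
      show "AE t in M. norm (q i t) \<le> 2 * w t" for i
      proof (rule AE_I2)
        fix t
        have "norm (f (X i) t - f s t - (X i - s) *\<^sub>R f' s t) \<le> w t * norm (X i - s) + norm (X i - s) * norm (f' s t)"
          by (rule order_trans[OF norm_triangle_ineq4]) (use lip[of "X i" t s] in auto)
        also have "\<dots> \<le> w t * norm (X i - s) + norm (X i - s) * w t"
          by (intro add_left_mono mult_left_mono bound) auto
        finally show "norm (q i t) \<le> 2 * w t"
          using X(1)[rule_format, of i] by (simp add: q_def divide_simps mult_ac)
      qed
      show "q i \<in> borel_measurable M" for i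
        unfolding q_def using int int' by (intro borel_measurable_scaleR borel_measurable_diff borel_measurable_const borel_measurable_integrable)
    qed (use w in auto)
    moreover have "(\<integral>t. q i t \<partial>M) = (1 / norm (X i - s)) *\<^sub>R (((\<integral>t. f (X i) t \<partial>M) - (\<integral>t. f s t \<partial>M)) - (X i - s) *\<^sub>R (\<integral>t. f' s t \<partial>M))" for i
      unfolding q_def using int int' by simp
    ultimately have "(\<lambda>i. norm ((1 / norm (X i - s)) *\<^sub>R (((\<integral>t. f (X i) t \<partial>M) - (\<integral>t. f s t \<partial>M)) - (X i - s) *\<^sub>R (\<integral>t. f' s t \<partial>M)))) \<longlonglongrightarrow> 0"
      by (intro tendsto_norm_zero) simp
    then show "(\<lambda>i. norm (((\<integral>t. f (X i) t \<partial>M) - (\<integral>t. f s t \<partial>M)) - (X i - s) *\<^sub>R (\<integral>t. f' s t \<partial>M)) / norm (X i - s)) \<longlonglongrightarrow> 0"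
      by simp
  qed
  then show ?thesis
    unfolding has_vector_derivative_def has_derivative_iff_norm
    by (simp add: bounded_linear_scaleR_left)
qed

lemma integral_derivative_eq_0:
  fixes f F :: "real \<Rightarrow> 'a::euclidean_space"
  assumes "\<And>x. (F has_vector_derivative f x) (at x)" "continuous_on UNIV f" "integrable lborel f"
    and "(F \<longlongrightarrow> 0) at_top" "(F \<longlongrightarrow> 0) at_bot"
  shows "(\<integral>x. f x \<partial>lborel) = 0"
proof -
  have "(LBINT x=-\<infinity>..\<infinity>. f x) = 0 - 0"
  proof (rule interval_integral_FTC_integrable[where F=F])
    show "((F \<circ> real_of_ereal) \<longlongrightarrow> 0) (at_right (- \<infinity>))" "((F \<circ> real_of_ereal) \<longlongrightarrow> 0) (at_left \<infinity>)"
      using assms(4,5) by (auto simp: ereal_tendsto_simps)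
  qed (use assms in \<open>auto simp: set_integrable_def continuous_on_eq_continuous_at\<close>)
  then show ?thesis
    by (simp add: interval_lebesgue_integral_def set_lebesgue_integral_def)
qed

lemma integrable_gauss_moment:
  fixes \<epsilon> :: real assumes "\<epsilon> > 0"
  shows "integrable lborel (\<lambda>t. \<bar>t\<bar> ^ k * exp (- \<epsilon> * t\<^sup>2))"
proof -
  define \<sigma> where "\<sigma> = 1 / sqrt (2 * \<epsilon>)"
  have \<sigma>: "\<sigma> > 0" "\<sigma>\<^sup>2 = 1 / (2 * \<epsilon>)" using assms by (auto simp: \<sigma>_def power_divide)
  have "integrable lborel (\<lambda>t. sqrt (2 * pi * \<sigma>\<^sup>2) * (normal_density 0 \<sigma> t * \<bar>t - 0\<bar> ^ k))"
    by (intro integrable_mult_right integrable_normal_moment_abs \<sigma>)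
  also have "(\<lambda>t. sqrt (2 * pi * \<sigma>\<^sup>2) * (normal_density 0 \<sigma> t * \<bar>t - 0\<bar> ^ k)) = (\<lambda>t. \<bar>t\<bar> ^ k * exp (- \<epsilon> * t\<^sup>2))"
    using \<sigma> assms by (auto simp: normal_density_def fun_eq_iff field_simps)
  finally show ?thesis .
qed

text \<open>
  For a real parameter this is the characteristic function of the standard normal distribution,
  rescaled.
\<close>

lemma gauss_fourier_real:
  fixes \<epsilon> x :: real assumes "\<epsilon> > 0"
  shows "(\<integral>t. exp (\<i> * of_real (x * t) - of_real \<epsilon> * of_real (t\<^sup>2)) \<partial>lborel)
    = of_real (sqrt (pi / \<epsilon>) * exp (- x\<^sup>2 / (4 * \<epsilon>)))"
proof -
  define c where "c = 1 / sqrt (2 * \<epsilon>)"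
  have c: "c > 0" "c\<^sup>2 = 1 / (2 * \<epsilon>)" using assms by (auto simp: c_def power_divide)
  have "(\<integral>t. exp (\<i> * of_real (x * t) - of_real \<epsilon> * of_real (t\<^sup>2)) \<partial>lborel) =
     \<bar>c\<bar> *\<^sub>R (\<integral>t. exp (\<i> * of_real (x * (0 + c * t)) - of_real \<epsilon> * of_real ((0 + c * t)\<^sup>2)) \<partial>lborel)"
    using c by (intro lborel_integral_real_affine) auto
  also have "(\<integral>t. exp (\<i> * of_real (x * (0 + c * t)) - of_real \<epsilon> * of_real ((0 + c * t)\<^sup>2)) \<partial>lborel)
     = (\<integral>t. sqrt (2 * pi) *\<^sub>R (std_normal_density t *\<^sub>R iexp (x * c * t)) \<partial>lborel)"
  proof (intro Bochner_Integration.integral_cong refl)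
    fix t
    have *: "of_real \<epsilon> * of_real ((0 + c * t)\<^sup>2) = (of_real (t\<^sup>2 / 2) :: complex)"
      unfolding of_real_mult[symmetric] using c assms by (simp add: power_mult_distrib)
    show "exp (\<i> * of_real (x * (0 + c * t)) - of_real \<epsilon> * of_real ((0 + c * t)\<^sup>2))
       = sqrt (2 * pi) *\<^sub>R (std_normal_density t *\<^sub>R iexp (x * c * t))"
      unfolding * diff_conv_add_uminus exp_add of_real_minus[symmetric] exp_of_real
      by (simp add: std_normal_density_def scaleR_conv_of_real mult_ac del: of_real_minus)
  qed
  also have "\<dots> = sqrt (2 * pi) *\<^sub>R (\<integral>t. std_normal_density t *\<^sub>R iexp (x * c * t) \<partial>lborel)"
    by (rule integral_scaleR_right)
  also have "(\<integral>t. std_normal_density t *\<^sub>R iexp (x * c * t) \<partial>lborel) = char std_normal_distribution (x * c)"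
    unfolding char_def by (subst integral_density) auto
  also have "\<dots> = of_real (exp (- x\<^sup>2 / (4 * \<epsilon>)))"
    unfolding char_std_normal_distribution using c assms by (simp add: power_mult_distrib field_simps)
  also have "\<bar>c\<bar> *\<^sub>R sqrt (2 * pi) *\<^sub>R complex_of_real (exp (- x\<^sup>2 / (4 * \<epsilon>))) = of_real (sqrt (pi / \<epsilon>) * exp (- x\<^sup>2 / (4 * \<epsilon>)))"
  proof -
    have "\<bar>c\<bar> * sqrt (2 * pi) = sqrt (pi / \<epsilon>)"
      using assms by (simp add: c_def real_sqrt_mult real_sqrt_divide)
    then show ?thesis unfolding scaleR_scaleR by (simp only: scaleR_conv_of_real of_real_mult)
  qed
  finally show ?thesis .
qed

text \<open>
  The integrand of the one-dimensional Fourier integral of the complex Gaussian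
  \<open>exp (- \<beta> t\<^sup>2)\<close> at frequency \<open>x\<close>.
\<close>

definition gauss_wave :: "real \<Rightarrow> real \<Rightarrow> complex \<Rightarrow> complex" where
  "gauss_wave x t \<beta> = exp (\<i> * of_real (x * t) - \<beta> * of_real (t\<^sup>2))"

lemma norm_gauss_wave: "norm (gauss_wave x t \<beta>) = exp (- Re \<beta> * t\<^sup>2)"
  by (simp add: gauss_wave_def)

lemma gauss_wave_measurable [measurable]: "(\<lambda>t. gauss_wave x t \<beta>) \<in> borel_measurable borel"
  unfolding gauss_wave_def by measurable

lemma integrable_gauss_wave_moment:
  assumes "Re \<beta> > 0"
  shows "integrable lborel (\<lambda>t. of_real t ^ k * gauss_wave x t \<beta>)"
  by (rule Bochner_Integration.integrable_bound[OF integrable_gauss_moment[OF assms, of k]])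
     (auto simp: norm_mult norm_power norm_gauss_wave)

lemma gauss_decay:
  fixes \<epsilon> :: real assumes "\<epsilon> > 0"
  shows "((\<lambda>t. (A + B * \<bar>t\<bar>) * exp (- \<epsilon> * t\<^sup>2)) \<longlongrightarrow> 0) at_top" "((\<lambda>t. (A + B * \<bar>t\<bar>) * exp (- \<epsilon> * t\<^sup>2)) \<longlongrightarrow> 0) at_bot"
  using assms by real_asymp+

text \<open>
  Integration by parts. The factor \<open>\<i> x + 2 \<beta> t\<close> is chosen so that the derivative of its
  product with the Gaussian wave contains no first power of \<open>t\<close>; what remains is a relation
  between the second moment and the integral itself.
\<close>

lemma gauss_wave_second_moment:
  assumes \<beta>: "Re \<beta> > 0"
  shows "(\<integral>t. of_real (t\<^sup>2) * gauss_wave x t \<beta> \<partial>lborel)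
     = (2 * \<beta> - of_real (x\<^sup>2)) / (4 * \<beta>\<^sup>2) * (\<integral>t. gauss_wave x t \<beta> \<partial>lborel)"
proof -
  let ?E = "\<lambda>t. gauss_wave x t \<beta>"
  have \<beta>0: "\<beta> \<noteq> 0" using \<beta> by auto
  have i0: "integrable lborel ?E" using integrable_gauss_wave_moment[OF \<beta>, of 0 x] by simp
  have i2: "integrable lborel (\<lambda>t. of_real (t\<^sup>2) * ?E t)" using integrable_gauss_wave_moment[OF \<beta>, of 2 x] by simp
  have "(\<integral>t. (2 * \<beta> - of_real (x\<^sup>2)) * ?E t - 4 * \<beta>\<^sup>2 * (of_real (t\<^sup>2) * ?E t) \<partial>lborel) = 0"
  proof (rule integral_derivative_eq_0[where F="\<lambda>t. (\<i> * of_real x + 2 * \<beta> * of_real t) * ?E t"])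
    show "((\<lambda>t. (\<i> * of_real x + 2 * \<beta> * of_real t) * ?E t) has_vector_derivative
        (2 * \<beta> - of_real (x\<^sup>2)) * ?E t - 4 * \<beta>\<^sup>2 * (of_real (t\<^sup>2) * ?E t)) (at t)" for t
      unfolding gauss_wave_def of_real_mult of_real_power
      by (rule has_vector_derivative_real_field)
         ((rule derivative_eq_intros refl)+, simp add: algebra_simps power2_eq_square)
    show "continuous_on UNIV (\<lambda>t. (2 * \<beta> - of_real (x\<^sup>2)) * ?E t - 4 * \<beta>\<^sup>2 * (of_real (t\<^sup>2) * ?E t))"
      unfolding gauss_wave_def by (intro continuous_intros)
    show "integrable lborel (\<lambda>t. (2 * \<beta> - of_real (x\<^sup>2)) * ?E t - 4 * \<beta>\<^sup>2 * (of_real (t\<^sup>2) * ?E t))"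
      using i0 i2 by (intro Bochner_Integration.integrable_diff integrable_mult_right)
    have *: "norm ((\<i> * of_real x + 2 * \<beta> * of_real t) * ?E t) \<le> (\<bar>x\<bar> + 2 * norm \<beta> * \<bar>t\<bar>) * exp (- Re \<beta> * t\<^sup>2)" for t
      unfolding norm_mult norm_gauss_wave
      by (intro mult_right_mono order_trans[OF norm_triangle_ineq]) (auto simp: norm_mult)
    show "((\<lambda>t. (\<i> * of_real x + 2 * \<beta> * of_real t) * ?E t) \<longlongrightarrow> 0) at_top"
      by (rule Lim_null_comparison[OF _ gauss_decay(1)[OF \<beta>, of "\<bar>x\<bar>" "2 * norm \<beta>"]]) (use * in auto)
    show "((\<lambda>t. (\<i> * of_real x + 2 * \<beta> * of_real t) * ?E t) \<longlongrightarrow> 0) at_bot"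
      by (rule Lim_null_comparison[OF _ gauss_decay(2)[OF \<beta>, of "\<bar>x\<bar>" "2 * norm \<beta>"]]) (use * in auto)
  qed
  then have "(2 * \<beta> - of_real (x\<^sup>2)) * (\<integral>t. ?E t \<partial>lborel) = 4 * \<beta>\<^sup>2 * (\<integral>t. of_real (t\<^sup>2) * ?E t \<partial>lborel)"
    using i0 i2 by (simp add: Bochner_Integration.integral_diff)
  then show ?thesis using \<beta>0 by (simp add: field_simps)
qed

text \<open>
  Let \<open>\<beta>\<close> move along a vertical line. Differentiating under the integral brings down
  \<open>- \<i> t\<^sup>2\<close>, and the second moment is a multiple of the integral, so each factor on the left
  solves a linear differential equation of first order. The product divided by the right-hand
  side therefore has derivative zero, and on the real axis it is known. Two factors are treated at
  once, as they occur in the plane, because a single one involves the square root of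
  \<open>\<pi> / \<beta>\<close> and hence the choice of a branch.
\<close>

lemma gauss_wave_product:
  fixes x1 x2 \<epsilon> b :: real
  assumes \<epsilon>: "\<epsilon> > 0"
  defines "\<beta> \<equiv> Complex \<epsilon> b"
  shows "(\<integral>t. gauss_wave x1 t \<beta> \<partial>lborel) * (\<integral>t. gauss_wave x2 t \<beta> \<partial>lborel)
     = of_real pi / \<beta> * exp (- of_real (x1\<^sup>2 + x2\<^sup>2) / (4 * \<beta>))"
proof -
  define B where "B s = Complex \<epsilon> s" for s
  have B: "B s = of_real \<epsilon> + \<i> * of_real s" for s by (simp add: B_def complex_eq_iff)
  have ReB: "Re (B s) = \<epsilon>" "B s \<noteq> 0" for s using \<epsilon> by (auto simp: B_def complex_eq_iff)
  define I where "I x s = (\<integral>t. gauss_wave x t (B s) \<partial>lborel)" for x s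
  have dI: "(I x has_vector_derivative - \<i> * ((2 * B s - of_real (x\<^sup>2)) / (4 * (B s)\<^sup>2) * I x s)) (at s)" for x s
  proof -
    have "((\<lambda>s. \<integral>t. gauss_wave x t (B s) \<partial>lborel) has_vector_derivative
        (\<integral>t. - \<i> * (of_real (t\<^sup>2) * gauss_wave x t (B s)) \<partial>lborel)) (at s)"
    proof (rule has_vector_derivative_integral_param[where w="\<lambda>t. \<bar>t\<bar> ^ 2 * exp (- \<epsilon> * t\<^sup>2)"])
      show "integrable lborel (\<lambda>t. gauss_wave x t (B s))" for s
        using integrable_gauss_wave_moment[of "B s" 0 x] ReB \<epsilon> by simp
      show "((\<lambda>s. gauss_wave x t (B s)) has_vector_derivative - \<i> * (of_real (t\<^sup>2) * gauss_wave x t (B s))) (at s)" for s t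
        unfolding gauss_wave_def B of_real_mult of_real_power
        by (rule has_vector_derivative_real_field)
           ((rule derivative_eq_intros refl)+, simp add: algebra_simps power2_eq_square)
      show "norm (- \<i> * (of_real (t\<^sup>2) * gauss_wave x t (B s))) \<le> \<bar>t\<bar>\<^sup>2 * exp (- \<epsilon> * t\<^sup>2)" for s t
        by (simp add: norm_mult norm_power norm_gauss_wave ReB)
    qed (use integrable_gauss_moment[OF \<epsilon>, of 2] in auto)
    moreover have "(\<integral>t. - \<i> * (of_real (t\<^sup>2) * gauss_wave x t (B s)) \<partial>lborel)
        = - \<i> * (\<integral>t. of_real (t\<^sup>2) * gauss_wave x t (B s) \<partial>lborel)"
      by (rule integral_mult_right_zero)
    ultimately show ?thesis
      unfolding I_def using gauss_wave_second_moment[of "B s" x] ReB(1) \<epsilon> by simp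
  qed
  define r where "r = x1\<^sup>2 + x2\<^sup>2"
  \<comment> \<open>\<open>\<pi>\<close> times the quotient of the two sides at \<open>B s\<close>\<close>
  define \<Psi> where "\<Psi> s = I x1 s * I x2 s * (B s * exp (of_real r / (4 * B s)))" for s
  have "(\<Psi> has_vector_derivative 0) (at s)" for s
  proof -
    have "((\<lambda>s. B s * exp (of_real r / (4 * B s))) has_vector_derivative
        \<i> * exp (of_real r / (4 * B s)) + B s * (exp (of_real r / (4 * B s)) * (- \<i> * of_real r / (4 * (B s)\<^sup>2)))) (at s)"
      unfolding B
    proof (rule has_vector_derivative_real_field)
      let ?b = "of_real \<epsilon> + \<i> * of_real s :: complex"
      have nz: "?b \<noteq> 0" "4 * ?b \<noteq> 0"
        using ReB(2)[of s] unfolding B mult_eq_0_iff by (blast, simp)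
      have d0: "((\<lambda>z. of_real \<epsilon> + \<i> * z) has_field_derivative \<i>) (at (of_real s :: complex))"
        by (rule derivative_eq_intros refl)+ simp
      have d1: "((\<lambda>z. 4 * (of_real \<epsilon> + \<i> * z)) has_field_derivative 4 * \<i>) (at (of_real s :: complex))"
        by (rule DERIV_cmult[OF d0])
      have "- \<i> * of_real r / (4 * ?b\<^sup>2) = (0 * (4 * ?b) - of_real r * (4 * \<i>)) / (4 * ?b * (4 * ?b))"
        using nz(1) by (simp add: power2_eq_square del: distrib_left_numeral)
      then show "((\<lambda>z. (of_real \<epsilon> + \<i> * z) * exp (of_real r / (4 * (of_real \<epsilon> + \<i> * z)))) has_field_derivative
        \<i> * exp (of_real r / (4 * ?b)) + ?b * (exp (of_real r / (4 * ?b)) * (- \<i> * of_real r / (4 * ?b\<^sup>2)))) (at (of_real s))"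
        using DERIV_mult[OF d0 DERIV_fun_exp[OF DERIV_divide[OF DERIV_const d1 nz(2), of "of_real r"]]]
        by (simp only: mult.commute)
    qed
    from has_vector_derivative_mult[OF has_vector_derivative_mult[OF dI[of x1 s] dI[of x2 s]] this]
    have "(\<Psi> has_vector_derivative
      I x1 s * I x2 s * (\<i> * exp (of_real r / (4 * B s)) + B s * (exp (of_real r / (4 * B s)) * (- \<i> * of_real r / (4 * (B s)\<^sup>2)))) +
      (I x1 s * (- \<i> * ((2 * B s - of_real (x2\<^sup>2)) / (4 * (B s)\<^sup>2) * I x2 s)) +
       - \<i> * ((2 * B s - of_real (x1\<^sup>2)) / (4 * (B s)\<^sup>2) * I x1 s) * I x2 s) * (B s * exp (of_real r / (4 * B s)))) (at s)"
      (is "(_ has_vector_derivative ?D) _")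
      unfolding \<Psi>_def .
    moreover have "?D = 0"
    proof -
      define q1 where "q1 = (2 * B s - of_real (x1\<^sup>2)) / (4 * (B s)\<^sup>2)"
      define q2 where "q2 = (2 * B s - of_real (x2\<^sup>2)) / (4 * (B s)\<^sup>2)"
      define q where "q = of_real r / (4 * (B s)\<^sup>2)"
      have "q + q1 + q2 = 4 * B s / (4 * (B s)\<^sup>2)"
        unfolding q1_def q2_def q_def add_divide_distrib[symmetric] by (simp add: r_def)
      then have "B s * (q + q1 + q2) = 1" using ReB(2)[of s] by (simp add: power2_eq_square)
      moreover have "?D = \<i> * (I x1 s * I x2 s * exp (of_real r / (4 * B s))) * (1 - B s * (q + q1 + q2))"
        unfolding q1_def[symmetric] q2_def[symmetric] times_divide_eq_right[symmetric, of _ "of_real r"]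
        mult_minus_left divide_minus_left q_def[symmetric] by (simp add: algebra_simps)
      ultimately show ?thesis by simp
    qed
    ultimately show ?thesis by simp
  qed
  then have "\<Psi> b = \<Psi> 0"
    by (intro has_derivative_zero_unique[of UNIV \<Psi>]) (auto simp: has_vector_derivative_def)
  also have "\<Psi> 0 = of_real pi"
  proof -
    have B0: "B 0 = of_real \<epsilon>" by (simp add: B_def complex_eq_iff)
    have "I x 0 = of_real (sqrt (pi / \<epsilon>) * exp (- x\<^sup>2 / (4 * \<epsilon>)))" for x
      unfolding I_def B0 gauss_wave_def using gauss_fourier_real[OF \<epsilon>, of x] by simp
    then have "\<Psi> 0 = of_real ((sqrt (pi / \<epsilon>) * exp (- x1\<^sup>2 / (4 * \<epsilon>))) * (sqrt (pi / \<epsilon>) * exp (- x2\<^sup>2 / (4 * \<epsilon>))) * (\<epsilon> * exp (r / (4 * \<epsilon>))))"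
      unfolding \<Psi>_def B0 by (simp flip: exp_of_real)
    also have "(sqrt (pi / \<epsilon>) * exp (- x1\<^sup>2 / (4 * \<epsilon>))) * (sqrt (pi / \<epsilon>) * exp (- x2\<^sup>2 / (4 * \<epsilon>))) * (\<epsilon> * exp (r / (4 * \<epsilon>)))
      = (sqrt (pi / \<epsilon>))\<^sup>2 * \<epsilon> * exp (- x1\<^sup>2 / (4 * \<epsilon>) + - x2\<^sup>2 / (4 * \<epsilon>) + r / (4 * \<epsilon>))"
      unfolding exp_add power2_eq_square[of "sqrt (pi / \<epsilon>)"] by (simp only: mult_ac)
    also have "\<dots> = pi" using \<epsilon> by (simp add: r_def field_simps)
    finally show ?thesis .
  qed
  finally have "I x1 b * I x2 b * (\<beta> * exp (of_real r / (4 * \<beta>))) = of_real pi"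
    by (simp add: \<Psi>_def \<beta>_def B_def)
  moreover have "\<beta> \<noteq> 0" using ReB(2)[of b] by (simp add: \<beta>_def B_def)
  ultimately have "I x1 b * I x2 b = of_real pi / \<beta> * exp (- of_real r / (4 * \<beta>))"
    by (simp add: field_simps exp_minus)
  then show ?thesis by (simp add: I_def r_def \<beta>_def B_def)
qed

definition gaussian :: "complex \<Rightarrow> real \<times> real \<Rightarrow> complex" where
  "gaussian \<beta> \<xi> = exp (- \<beta> * of_real ((norm \<xi>)\<^sup>2))"

lemma gaussian_measurable [measurable]: "gaussian \<beta> \<in> borel_measurable borel"
  unfolding gaussian_def by measurable

lemma norm_gaussian: "norm (gaussian \<beta> \<xi>) = exp (- Re \<beta> * (norm \<xi>)\<^sup>2)"
  by (simp add: gaussian_def)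

lemma norm_prod_sq: "(norm (\<xi> :: real \<times> real))\<^sup>2 = (fst \<xi>)\<^sup>2 + (snd \<xi>)\<^sup>2"
  by (simp add: norm_prod_def prod.case_eq_if)

lemma gaussian_wave_split:
  "exp (\<i> * of_real (x \<bullet> \<xi>)) * gaussian \<beta> \<xi> = gauss_wave (fst x) (fst \<xi>) \<beta> * gauss_wave (snd x) (snd \<xi>) \<beta>"
  unfolding gaussian_def gauss_wave_def norm_prod_sq inner_prod_def exp_add[symmetric] exp_diff[symmetric]
  by (intro arg_cong[where f=exp]) (simp add: algebra_simps)

lemma integrable_lborel_prod_mult:
  fixes f :: "'a::euclidean_space \<Rightarrow> complex" and g :: "'b::euclidean_space \<Rightarrow> complex"
  assumes "integrable lborel f" "integrable lborel g"
  shows "integrable lborel (\<lambda>z. f (fst z) * g (snd z))"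
    and "(\<integral>z. f (fst z) * g (snd z) \<partial>lborel) = (\<integral>t. f t \<partial>lborel) * (\<integral>t. g t \<partial>lborel)"
proof -
  have [measurable]: "f \<in> borel_measurable borel" "g \<in> borel_measurable borel" using assms by auto
  have i: "integrable (lborel \<Otimes>\<^sub>M lborel) (\<lambda>z. f (fst z) * g (snd z))"
  proof (rule lborel_pair.Fubini_integrable)
    show "integrable lborel (\<lambda>x. LINT y|lborel. norm (f (fst (x, y)) * g (snd (x, y))))"
      using assms by (simp add: norm_mult)
  qed (use assms in auto)
  then show "integrable lborel (\<lambda>z. f (fst z) * g (snd z))" by (simp add: lborel_prod)
  have "(\<integral>z. f (fst z) * g (snd z) \<partial>(lborel \<Otimes>\<^sub>M lborel)) = (\<integral>x. (\<integral>y. f x * g y \<partial>lborel) \<partial>lborel)"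
    using lborel_pair.integral_fst'[OF i] by simp
  then show "(\<integral>z. f (fst z) * g (snd z) \<partial>lborel) = (\<integral>t. f t \<partial>lborel) * (\<integral>t. g t \<partial>lborel)"
    by (simp add: lborel_prod)
qed

lemma integrable_gaussian:
  assumes "Re \<beta> > 0" shows "integrable lborel (gaussian \<beta>)"
proof -
  have "integrable lborel (\<lambda>t. gauss_wave 0 t \<beta>)"
    using integrable_gauss_wave_moment[OF assms, of 0 0] by simp
  from integrable_lborel_prod_mult(1)[OF this this] show ?thesis
    using gaussian_wave_split[of 0 _ \<beta>] by (simp cong: Bochner_Integration.integrable_cong)
qed

lemma gaussian_fourier:
  assumes "\<epsilon> > 0" and "\<beta> = Complex \<epsilon> b"
  shows "(\<integral>\<xi>. exp (\<i> * of_real (x \<bullet> \<xi>)) * gaussian \<beta> \<xi> \<partial>lborel)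
     = of_real pi / \<beta> * exp (- of_real ((norm x)\<^sup>2) / (4 * \<beta>))"
proof -
  have "integrable lborel (\<lambda>t. gauss_wave y t \<beta>)" for y
    using integrable_gauss_wave_moment[of \<beta> 0 y] assms by simp
  from integrable_lborel_prod_mult(2)[OF this this] show ?thesis
    unfolding gaussian_wave_split norm_prod_sq assms(2)
    by (simp add: gauss_wave_product[OF assms(1)])
qed

section \<open>Affine substitution\<close>

lemma nn_integral_lborel_affine:
  fixes f :: "'a::euclidean_space \<Rightarrow> ennreal"
  assumes [measurable]: "f \<in> borel_measurable borel" and c: "c \<noteq> 0"
  shows "(\<integral>\<^sup>+x. f x \<partial>lborel) = ennreal (\<bar>c\<bar> ^ DIM('a)) * (\<integral>\<^sup>+x. f (t + c *\<^sub>R x) \<partial>lborel)"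
  by (subst lborel_affine[OF c, of t])
     (simp add: nn_integral_density nn_integral_distr nn_integral_cmult)

lemma integrable_lborel_affine:
  fixes f :: "'a::euclidean_space \<Rightarrow> 'b::{banach, second_countable_topology}"
  assumes f: "integrable lborel f" and c: "c \<noteq> 0"
  shows "integrable lborel (\<lambda>x. f (t + c *\<^sub>R x))"
proof -
  have [measurable]: "f \<in> borel_measurable borel" using f by auto
  have "ennreal (\<bar>c\<bar> ^ DIM('a)) * (\<integral>\<^sup>+x. norm (f (t + c *\<^sub>R x)) \<partial>lborel) < \<infinity>"
    using f nn_integral_lborel_affine[of "\<lambda>x. ennreal (norm (f x))" c t] c unfolding integrable_iff_bounded by simp
  then show ?thesis
    unfolding integrable_iff_bounded using c by (auto simp: ennreal_mult_less_top)
qed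

lemma integral_lborel_affine:
  fixes f :: "'a::euclidean_space \<Rightarrow> 'b::{banach, second_countable_topology}"
  assumes f: "integrable lborel f" and c: "c \<noteq> 0"
  shows "(\<integral>x. f x \<partial>lborel) = \<bar>c\<bar> ^ DIM('a) *\<^sub>R (\<integral>x. f (t + c *\<^sub>R x) \<partial>lborel)"
proof -
  have [measurable]: "f \<in> borel_measurable borel" using f by auto
  show ?thesis
    using integrable_lborel_affine[OF f c, of t]
    by (subst lborel_affine[OF c, of t]) (simp add: integral_density integral_distr)
qed

section \<open>Square-integrable functions\<close>

lemma L2_measurable: "f \<in> L2 M \<Longrightarrow> f \<in> borel_measurable M"
  by (simp add: L2_def)

lemma L2_iff_nn:
  "f \<in> L2 M \<longleftrightarrow> f \<in> borel_measurable M \<and> (\<integral>\<^sup>+x. ennreal ((norm (f x))\<^sup>2) \<partial>M) < \<infinity>"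
  by (auto simp: L2_def integrable_iff_bounded)

lemma L2_norm_sq: "(L2_norm M f)\<^sup>2 = (\<integral>x. (norm (f x))\<^sup>2 \<partial>M)"
  by (simp add: L2_norm_def integral_nonneg_AE)

lemma L2_norm_nonneg [simp]: "0 \<le> L2_norm M f"
  by (simp add: L2_norm_def integral_nonneg_AE)

lemma nn_integral_L2: "f \<in> L2 M \<Longrightarrow> (\<integral>\<^sup>+x. ennreal ((norm (f x))\<^sup>2) \<partial>M) = ennreal ((L2_norm M f)\<^sup>2)"
  unfolding L2_norm_sq by (rule nn_integral_eq_integral) (auto simp: L2_def)

lemma L2_norm_le_nn:
  assumes "f \<in> borel_measurable M" "(\<integral>\<^sup>+x. ennreal ((norm (f x))\<^sup>2) \<partial>M) \<le> ennreal (c\<^sup>2)" "0 \<le> c"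
  shows "f \<in> L2 M" "L2_norm M f \<le> c"
proof -
  show f: "f \<in> L2 M" using assms(1,2) by (auto simp: L2_iff_nn le_less_trans)
  then have "(L2_norm M f)\<^sup>2 \<le> c\<^sup>2" using assms(2) by (simp add: nn_integral_L2)
  then show "L2_norm M f \<le> c" using assms(3) by (rule power2_le_imp_le)
qed

lemma L2_norm_cong_AE:
  assumes "f \<in> borel_measurable M" "g \<in> borel_measurable M" "AE x in M. f x = g x"
  shows "L2_norm M f = L2_norm M g"
  unfolding L2_norm_def using assms by (intro arg_cong[where f=sqrt] integral_cong_AE) auto

lemma L2_add:
  fixes f g :: "'a \<Rightarrow> 'b::{second_countable_topology, real_normed_vector}"
  assumes "f \<in> L2 M" "g \<in> L2 M" shows "(\<lambda>x. f x + g x) \<in> L2 M"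
proof -
  have [measurable]: "f \<in> borel_measurable M" "g \<in> borel_measurable M" using assms by (auto simp: L2_def)
  have "integrable M (\<lambda>x. 2 * (norm (f x))\<^sup>2 + 2 * (norm (g x))\<^sup>2)" using assms by (auto simp: L2_def)
  then have "integrable M (\<lambda>x. (norm (f x + g x))\<^sup>2)"
  proof (rule Bochner_Integration.integrable_bound)
    have "(norm (f x + g x))\<^sup>2 \<le> 2 * (norm (f x))\<^sup>2 + 2 * (norm (g x))\<^sup>2" for x
    proof -
      have "(norm (f x + g x))\<^sup>2 \<le> (norm (f x) + norm (g x))\<^sup>2" by (intro power_mono norm_triangle_ineq) auto
      also have "\<dots> \<le> 2 * (norm (f x))\<^sup>2 + 2 * (norm (g x))\<^sup>2"
        using sum_squares_bound[of "norm (f x)" "norm (g x)"] by (simp add: power2_sum)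
      finally show ?thesis .
    qed
    then show "AE x in M. norm ((norm (f x + g x))\<^sup>2) \<le> norm (2 * (norm (f x))\<^sup>2 + 2 * (norm (g x))\<^sup>2)" by auto
  qed measurable
  then show ?thesis by (simp add: L2_def)
qed

lemma L2_scaleR:
  assumes "f \<in> L2 M" shows "(\<lambda>x. c *\<^sub>R f x) \<in> L2 M"
  using assms by (auto simp: L2_def power_mult_distrib)

lemma L2_diff:
  fixes f g :: "'a \<Rightarrow> 'b::{second_countable_topology, real_normed_vector}"
  assumes "f \<in> L2 M" "g \<in> L2 M" shows "(\<lambda>x. f x - g x) \<in> L2 M"
  using L2_add[OF assms(1) L2_scaleR[OF assms(2), of "-1"]] by simp

lemma L2_bounded_mult:
  fixes f g :: "'a \<Rightarrow> complex"
  assumes f: "f \<in> L2 M" and [measurable]: "g \<in> borel_measurable M" and g: "AE x in M. norm (g x) \<le> C"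
  shows "(\<lambda>x. g x * f x) \<in> L2 M"
proof -
  have [measurable]: "f \<in> borel_measurable M" using f by (auto simp: L2_def)
  have "integrable M (\<lambda>x. C\<^sup>2 * (norm (f x))\<^sup>2)" using f by (auto simp: L2_def)
  then have "integrable M (\<lambda>x. (norm (g x * f x))\<^sup>2)"
    by (rule Bochner_Integration.integrable_bound)
       (use g in \<open>auto simp: norm_mult power_mult_distrib intro!: mult_right_mono power_mono\<close>)
  then show ?thesis by (simp add: L2_def)
qed

lemma
  fixes f g :: "'a \<Rightarrow> complex"
  assumes f: "f \<in> L2 M" and g: "g \<in> L2 M"
  shows integrable_L2_mult: "integrable M (\<lambda>x. f x * g x)"
    and Cauchy_Schwarz_L2: "norm (\<integral>x. f x * g x \<partial>M) \<le> L2_norm M f * L2_norm M g"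
proof -
  have [measurable]: "f \<in> borel_measurable M" "g \<in> borel_measurable M" using assms by (auto simp: L2_def)
  have "(\<integral>\<^sup>+x. ennreal (norm (f x)) * ennreal (norm (g x)) \<partial>M)\<^sup>2
      \<le> (\<integral>\<^sup>+x. ennreal (norm (f x)) ^ 2 \<partial>M) * (\<integral>\<^sup>+x. ennreal (norm (g x)) ^ 2 \<partial>M)"
    by (rule Cauchy_Schwarz_nn_integral) measurable
  also have "\<dots> = ennreal ((L2_norm M f)\<^sup>2) * ennreal ((L2_norm M g)\<^sup>2)"
    using nn_integral_L2[OF f] nn_integral_L2[OF g] by (simp add: ennreal_power)
  also have "\<dots> = (ennreal (L2_norm M f * L2_norm M g))\<^sup>2"
    by (simp add: ennreal_mult'[symmetric] ennreal_power power_mult_distrib)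
  finally have cs: "(\<integral>\<^sup>+x. ennreal (norm (f x)) * ennreal (norm (g x)) \<partial>M)\<^sup>2 \<le> (ennreal (L2_norm M f * L2_norm M g))\<^sup>2" .
  have *: "(\<integral>\<^sup>+x. ennreal (norm (f x * g x)) \<partial>M) \<le> ennreal (L2_norm M f * L2_norm M g)"
    if "(\<integral>\<^sup>+x. ennreal (norm (f x)) * ennreal (norm (g x)) \<partial>M)\<^sup>2 \<le> (ennreal (L2_norm M f * L2_norm M g))\<^sup>2"
  proof (cases "\<integral>\<^sup>+x. ennreal (norm (f x)) * ennreal (norm (g x)) \<partial>M")
    case (real r)
    then have "ennreal (r\<^sup>2) \<le> ennreal ((L2_norm M f * L2_norm M g)\<^sup>2)"
      using that by (simp add: ennreal_power)
    then have "r\<^sup>2 \<le> (L2_norm M f * L2_norm M g)\<^sup>2" by (simp add: ennreal_le_iff)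
    then have "r \<le> L2_norm M f * L2_norm M g" by (rule power2_le_imp_le) simp
    moreover have "(\<integral>\<^sup>+x. ennreal (norm (f x * g x)) \<partial>M) = ennreal r"
      using real by (simp add: norm_mult ennreal_mult)
    ultimately show ?thesis by (simp only: ennreal_leI)
  qed (use that in \<open>simp add: ennreal_power top_unique\<close>)
  have le: "(\<integral>\<^sup>+x. ennreal (norm (f x * g x)) \<partial>M) \<le> ennreal (L2_norm M f * L2_norm M g)"
    by (rule *[OF cs])
  then show i: "integrable M (\<lambda>x. f x * g x)"
    unfolding integrable_iff_bounded by (auto intro: le_less_trans)
  have "ennreal (norm (\<integral>x. f x * g x \<partial>M)) \<le> ennreal (L2_norm M f * L2_norm M g)"
    by (rule order_trans[OF integral_norm_bound_ennreal[OF i] le])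
  then show "norm (\<integral>x. f x * g x \<partial>M) \<le> L2_norm M f * L2_norm M g" by simp
qed

text \<open>
  Cauchy-Schwarz against the indicator of \<open>S\<close>. On the bounded detector window it turns every
  bound in \<open>L\<^sup>2\<close> into one in \<open>L\<^sup>1\<close>, which is the norm that the propagator needs.
\<close>

lemma L2_finite_support_integrable:
  fixes f :: "'a \<Rightarrow> complex"
  assumes f: "f \<in> L2 M" and S: "S \<in> sets M" "emeasure M S < \<infinity>" and supp: "\<And>x. x \<notin> S \<Longrightarrow> f x = 0"
  shows "integrable M f" "(\<integral>x. norm (f x) \<partial>M) \<le> sqrt (measure M S) * L2_norm M f"
proof -
  have ind: "(\<lambda>x. indicator S x :: complex) \<in> L2 M"
    using S by (auto simp: L2_def indicator_def power2_eq_square integrable_indicator_iff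
      intro!: Bochner_Integration.integrable_cong[THEN iffD1, OF refl _ integrable_real_indicator[OF S]])
  have ni: "L2_norm M (\<lambda>x. indicator S x :: complex) = sqrt (measure M S)"
  proof -
    have "(\<integral>x. (norm (indicator S x :: complex))\<^sup>2 \<partial>M) = (\<integral>x. indicator S x \<partial>M)"
      by (intro Bochner_Integration.integral_cong) (auto simp: indicator_def)
    then show ?thesis using S sets.sets_into_space[OF S(1)] by (simp add: L2_norm_def Int_absorb2)
  qed
  have eq: "(\<lambda>x. indicator S x * f x) = f" using supp by (auto simp: indicator_def fun_eq_iff)
  show "integrable M f" using integrable_L2_mult[OF ind f] by (simp add: eq)
  have nf: "(\<lambda>x. of_real (norm (f x)) :: complex) \<in> L2 M"
    using f by (auto simp: L2_def)
  have eq': "(\<lambda>x. indicator S x * (of_real (norm (f x)) :: complex)) = (\<lambda>x. of_real (norm (f x)))"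
    using supp by (auto simp: indicator_def fun_eq_iff)
  have "norm (\<integral>x. indicator S x * (of_real (norm (f x)) :: complex) \<partial>M)
     \<le> L2_norm M (\<lambda>x. indicator S x :: complex) * L2_norm M (\<lambda>x. of_real (norm (f x)) :: complex)"
    by (rule Cauchy_Schwarz_L2[OF ind nf])
  then show "(\<integral>x. norm (f x) \<partial>M) \<le> sqrt (measure M S) * L2_norm M f"
    unfolding eq' ni by (simp add: L2_norm_def abs_le_iff)
qed

lemma norm_integral_le_nn_integral:
  fixes f :: "'a \<Rightarrow> 'b::{banach, second_countable_topology}"
  shows "ennreal (norm (\<integral>x. f x \<partial>M)) \<le> (\<integral>\<^sup>+x. ennreal (norm (f x)) \<partial>M)"
proof (cases "integrable M f")
  case True then show ?thesis by (rule integral_norm_bound_ennreal)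
next
  case False then show ?thesis by (simp add: not_integrable_integral_eq)
qed

section \<open>The Fourier transform of integrable functions\<close>

definition fourier :: "(real \<times> real \<Rightarrow> complex) \<Rightarrow> real \<times> real \<Rightarrow> complex" where
  "fourier u \<xi> = 1 / (2 * of_real pi) * (\<integral>x. exp (- \<i> * of_real (x \<bullet> \<xi>)) * u x \<partial>lborel)"

lemma integrable_phase_mult:
  assumes "integrable lborel u"
  shows "integrable lborel (\<lambda>x. exp (\<i> * of_real (s * (x \<bullet> \<xi>))) * u x)"
proof (rule Bochner_Integration.integrable_bound[OF assms])
  have [measurable]: "u \<in> borel_measurable borel" using assms by auto
  show "(\<lambda>x. exp (\<i> * of_real (s * (x \<bullet> \<xi>))) * u x) \<in> borel_measurable lborel" by measurable
qed (auto simp: norm_mult)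

lemma fourier_measurable [measurable]:
  assumes [measurable]: "u \<in> borel_measurable borel"
  shows "fourier u \<in> borel_measurable borel"
  unfolding fourier_def by measurable

lemma norm_fourier_le:
  assumes "integrable lborel u"
  shows "norm (fourier u \<xi>) \<le> (\<integral>x. norm (u x) \<partial>lborel) / (2 * pi)"
proof -
  have "norm (\<integral>x. exp (- \<i> * of_real (x \<bullet> \<xi>)) * u x \<partial>lborel) \<le> (\<integral>x. norm (exp (- \<i> * of_real (x \<bullet> \<xi>)) * u x) \<partial>lborel)"
    by (rule integral_norm_bound)
  also have "\<dots> = (\<integral>x. norm (u x) \<partial>lborel)" by (simp add: norm_mult)
  finally show ?thesis by (simp add: fourier_def norm_mult norm_divide divide_simps mult.commute)
qed

lemma fourier_diff:
  assumes "integrable lborel u" "integrable lborel v"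
  shows "fourier (\<lambda>x. u x - v x) \<xi> = fourier u \<xi> - fourier v \<xi>"
  using integrable_phase_mult[OF assms(1), of "-1" \<xi>] integrable_phase_mult[OF assms(2), of "-1" \<xi>]
  by (simp add: fourier_def right_diff_distrib)

text \<open>
  Fubini's theorem. The sign \<open>s = -1\<close> gives the transform and \<open>s = 1\<close> its adjoint.
\<close>

lemma fourier_multiplication_formula:
  fixes a V :: "real \<times> real \<Rightarrow> complex"
  assumes a: "integrable lborel a" and V: "integrable lborel V"
  shows "(\<integral>\<xi>. (\<integral>x. exp (\<i> * of_real (s * (x \<bullet> \<xi>))) * a x \<partial>lborel) * V \<xi> \<partial>lborel)
    = (\<integral>x. a x * (\<integral>\<xi>. exp (\<i> * of_real (s * (x \<bullet> \<xi>))) * V \<xi> \<partial>lborel) \<partial>lborel)"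
proof -
  have [measurable]: "a \<in> borel_measurable borel" "V \<in> borel_measurable borel" using a V by auto
  let ?f = "\<lambda>x \<xi>. exp (\<i> * of_real (s * (x \<bullet> \<xi>))) * (a x * V \<xi>)"
  have "integrable (lborel \<Otimes>\<^sub>M lborel) (\<lambda>z. a (fst z) * V (snd z))"
    using integrable_lborel_prod_mult(1)[OF a V] by (simp add: lborel_prod)
  then have "integrable (lborel \<Otimes>\<^sub>M lborel) (case_prod ?f)"
    by (rule Bochner_Integration.integrable_bound) (auto simp: norm_mult)
  from lborel_pair.Fubini_integral[OF this]
  have "(\<integral>\<xi>. (\<integral>x. ?f x \<xi> \<partial>lborel) \<partial>lborel) = (\<integral>x. (\<integral>\<xi>. ?f x \<xi> \<partial>lborel) \<partial>lborel)" .
  moreover have "(\<integral>x. ?f x \<xi> \<partial>lborel) = (\<integral>x. exp (\<i> * of_real (s * (x \<bullet> \<xi>))) * a x \<partial>lborel) * V \<xi>" for \<xi>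
    by (subst integral_mult_left_zero[symmetric]) (simp add: mult_ac)
  moreover have "(\<integral>\<xi>. ?f x \<xi> \<partial>lborel) = a x * (\<integral>\<xi>. exp (\<i> * of_real (s * (x \<bullet> \<xi>))) * V \<xi> \<partial>lborel)" for x
    by (subst integral_mult_right_zero[symmetric]) (simp add: mult_ac)
  ultimately show ?thesis by simp
qed

text \<open>
  The Fourier multiplier \<open>gaussian \<beta>\<close> acts as the convolution with this function. It is a heat
  kernel for positive \<open>\<beta>\<close> and the Fresnel kernel, of constant modulus, for imaginary \<open>\<beta>\<close>.
\<close>

definition kernel :: "complex \<Rightarrow> real \<times> real \<Rightarrow> complex" where
  "kernel \<beta> x = 1 / (4 * of_real pi * \<beta>) * exp (- of_real ((norm x)\<^sup>2) / (4 * \<beta>))"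

lemma kernel_measurable [measurable]: "kernel \<beta> \<in> borel_measurable borel"
  unfolding kernel_def by measurable

text \<open>
  The bound does not deteriorate when \<open>\<beta>\<close> approaches the imaginary axis away from zero; it
  dominates the limits taken there.
\<close>

lemma norm_kernel_le:
  assumes "Re \<beta> \<ge> 0"
  shows "norm (kernel \<beta> x) \<le> 1 / (4 * pi * norm \<beta>)"
proof -
  have "- of_real ((norm x)\<^sup>2) / (4 * \<beta>) = of_real (- (norm x)\<^sup>2 / 4) * (1 / \<beta>)" by simp
  then have "Re (- of_real ((norm x)\<^sup>2) / (4 * \<beta>)) = - ((norm x)\<^sup>2 / 4 * Re (1 / \<beta>))"
    by (simp only: times_complex.sel Re_complex_of_real Im_complex_of_real)
  also have "\<dots> \<le> 0" using assms by (simp add: Re_divide)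
  finally have "norm (exp (- of_real ((norm x)\<^sup>2) / (4 * \<beta>))) \<le> 1" by (simp only: norm_exp_eq_Re exp_le_one_iff)
  then have "(1 / (4 * pi * norm \<beta>)) * norm (exp (- of_real ((norm x)\<^sup>2) / (4 * \<beta>))) \<le> (1 / (4 * pi * norm \<beta>)) * 1"
    by (intro mult_left_mono) auto
  then show ?thesis by (simp add: kernel_def norm_mult norm_divide)
qed

text \<open>
  The multiplication formula for a modulated Gaussian, whose transform is the kernel centred at
  \<open>x\<close>.
\<close>

lemma fourier_gaussian_smoothing:
  assumes u: "integrable lborel u" and \<epsilon>: "\<epsilon> > 0" and \<beta>: "\<beta> = Complex \<epsilon> b"
  shows "(\<integral>\<xi>. exp (\<i> * of_real (x \<bullet> \<xi>)) * (gaussian \<beta> \<xi> * fourier u \<xi>) \<partial>lborel)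
     = 2 * of_real pi * (\<integral>y. u y * kernel \<beta> (x - y) \<partial>lborel)"
proof -
  let ?V = "\<lambda>\<xi>. exp (\<i> * of_real (1 * (\<xi> \<bullet> x))) * gaussian \<beta> \<xi>"
  have Re: "Re \<beta> > 0" using \<epsilon> \<beta> by simp
  have V: "integrable lborel ?V" by (rule integrable_phase_mult[OF integrable_gaussian[OF Re]])
  have outer: "(\<integral>\<xi>. (\<integral>y. exp (\<i> * of_real ((-1) * (y \<bullet> \<xi>))) * u y \<partial>lborel) * ?V \<xi> \<partial>lborel)
    = (\<integral>y. u y * (\<integral>\<xi>. exp (\<i> * of_real ((-1) * (y \<bullet> \<xi>))) * ?V \<xi> \<partial>lborel) \<partial>lborel)"
    by (rule fourier_multiplication_formula[OF u V])
  have inner_int: "(\<integral>\<xi>. exp (\<i> * of_real ((-1) * (y \<bullet> \<xi>))) * ?V \<xi> \<partial>lborel) = (2 * of_real pi)\<^sup>2 * kernel \<beta> (x - y)" for y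
  proof -
    have "(\<integral>\<xi>. exp (\<i> * of_real ((-1) * (y \<bullet> \<xi>))) * ?V \<xi> \<partial>lborel)
       = (\<integral>\<xi>. exp (\<i> * of_real ((x - y) \<bullet> \<xi>)) * gaussian \<beta> \<xi> \<partial>lborel)"
      unfolding mult.assoc[symmetric] exp_add[symmetric]
      by (intro Bochner_Integration.integral_cong refl arg_cong2[where f="(*)"] arg_cong[where f=exp])
         (simp add: inner_diff_left inner_commute algebra_simps)
    also have "\<dots> = of_real pi / \<beta> * exp (- of_real ((norm (x - y))\<^sup>2) / (4 * \<beta>))"
      by (rule gaussian_fourier[OF \<epsilon> \<beta>])
    finally show ?thesis by (simp add: kernel_def power2_eq_square)
  qed
  from outer have "(\<integral>\<xi>. (\<integral>y. exp (\<i> * of_real ((-1) * (y \<bullet> \<xi>))) * u y \<partial>lborel) * ?V \<xi> \<partial>lborel)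
     = (\<integral>y. (2 * of_real pi)\<^sup>2 * (u y * kernel \<beta> (x - y)) \<partial>lborel)"
    unfolding inner_int mult.left_commute[of "u _"] by blast
  also have "\<dots> = (2 * of_real pi)\<^sup>2 * (\<integral>y. u y * kernel \<beta> (x - y) \<partial>lborel)"
    by (rule integral_mult_right_zero)
  finally have main: "(\<integral>\<xi>. (\<integral>y. exp (\<i> * of_real ((-1) * (y \<bullet> \<xi>))) * u y \<partial>lborel) * ?V \<xi> \<partial>lborel)
     = (2 * of_real pi)\<^sup>2 * (\<integral>y. u y * kernel \<beta> (x - y) \<partial>lborel)" .
  have F: "(\<integral>y. exp (\<i> * of_real ((-1) * (y \<bullet> \<xi>))) * u y \<partial>lborel) = 2 * of_real pi * fourier u \<xi>" for \<xi>
    by (simp add: fourier_def)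
  have "2 * of_real pi * (\<integral>\<xi>. fourier u \<xi> * ?V \<xi> \<partial>lborel) = 2 * of_real pi * (2 * of_real pi * (\<integral>y. u y * kernel \<beta> (x - y) \<partial>lborel))"
    using main unfolding F mult.assoc integral_mult_right_zero by (simp add: power2_eq_square)
  then have "(\<integral>\<xi>. fourier u \<xi> * ?V \<xi> \<partial>lborel) = 2 * of_real pi * (\<integral>y. u y * kernel \<beta> (x - y) \<partial>lborel)"
    by simp
  then show ?thesis by (simp add: mult_ac inner_commute)
qed

text \<open>
  The Gaussian factor makes the double integral absolutely convergent, so the adjoint of the
  transform may be applied to the smoothed transform of \<open>u\<close>.
\<close>

lemma parseval_regularized:
  assumes w: "integrable lborel w" and u: "integrable lborel u" and \<epsilon>: "\<epsilon> > 0" and \<beta>: "\<beta> = Complex \<epsilon> b"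
  shows "(\<integral>\<xi>. cnj (fourier w \<xi>) * (gaussian \<beta> \<xi> * fourier u \<xi>) \<partial>lborel)
     = (\<integral>x. cnj (w x) * (\<integral>y. u y * kernel \<beta> (x - y) \<partial>lborel) \<partial>lborel)"
proof -
  have [measurable]: "u \<in> borel_measurable borel" using u by auto
  have Re: "Re \<beta> > 0" using \<epsilon> \<beta> by simp
  have w': "integrable lborel (\<lambda>x. cnj (w x))" using w by simp
  have V: "integrable lborel (\<lambda>\<xi>. gaussian \<beta> \<xi> * fourier u \<xi>)"
  proof (rule Bochner_Integration.integrable_bound)
    show "integrable lborel (\<lambda>\<xi>. ((\<integral>x. norm (u x) \<partial>lborel) / (2 * pi)) *\<^sub>R gaussian \<beta> \<xi>)"
      using integrable_gaussian[OF Re] by simp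
    show "AE \<xi> in lborel. norm (gaussian \<beta> \<xi> * fourier u \<xi>) \<le> norm (((\<integral>x. norm (u x) \<partial>lborel) / (2 * pi)) *\<^sub>R gaussian \<beta> \<xi>)"
    proof (rule AE_I2)
      fix \<xi> show "norm (gaussian \<beta> \<xi> * fourier u \<xi>) \<le> norm (((\<integral>x. norm (u x) \<partial>lborel) / (2 * pi)) *\<^sub>R gaussian \<beta> \<xi>)"
        using mult_right_mono[OF norm_fourier_le[OF u, of \<xi>], of "norm (gaussian \<beta> \<xi>)"]
        by (simp add: norm_mult mult.commute integral_nonneg_AE)
    qed
  qed measurable
  have c: "(\<integral>x. exp (\<i> * of_real (1 * (x \<bullet> \<xi>))) * cnj (w x) \<partial>lborel) = 2 * of_real pi * cnj (fourier w \<xi>)" for \<xi>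
  proof -
    have "cnj (\<integral>x. exp (- \<i> * of_real (x \<bullet> \<xi>)) * w x \<partial>lborel) = (\<integral>x. cnj (exp (- \<i> * of_real (x \<bullet> \<xi>)) * w x) \<partial>lborel)"
      by (rule Bochner_Integration.integral_cnj[symmetric])
    also have "\<dots> = (\<integral>x. exp (\<i> * of_real (1 * (x \<bullet> \<xi>))) * cnj (w x) \<partial>lborel)" by (simp add: exp_cnj)
    finally show ?thesis unfolding fourier_def complex_cnj_mult by simp
  qed
  have "(\<integral>\<xi>. (2 * of_real pi * cnj (fourier w \<xi>)) * (gaussian \<beta> \<xi> * fourier u \<xi>) \<partial>lborel)
    = (\<integral>x. cnj (w x) * (\<integral>\<xi>. exp (\<i> * of_real (x \<bullet> \<xi>)) * (gaussian \<beta> \<xi> * fourier u \<xi>) \<partial>lborel) \<partial>lborel)"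
    using fourier_multiplication_formula[OF w' V, of 1] unfolding c by simp
  also have "\<dots> = (\<integral>x. cnj (w x) * (2 * of_real pi * (\<integral>y. u y * kernel \<beta> (x - y) \<partial>lborel)) \<partial>lborel)"
    by (simp only: fourier_gaussian_smoothing[OF u \<epsilon> \<beta>])
  finally have "2 * of_real pi * (\<integral>\<xi>. cnj (fourier w \<xi>) * (gaussian \<beta> \<xi> * fourier u \<xi>) \<partial>lborel)
     = 2 * of_real pi * (\<integral>x. cnj (w x) * (\<integral>y. u y * kernel \<beta> (x - y) \<partial>lborel) \<partial>lborel)"
    unfolding mult.assoc integral_mult_right_zero mult.left_commute[of "cnj (w _)"] .
  then show ?thesis by simp
qed

lemma nn_integral_kernel:
  assumes "\<epsilon> > 0"
  shows "(\<integral>\<^sup>+y. ennreal (norm (kernel (of_real \<epsilon>) (x - y))) \<partial>lborel) = 1"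
proof -
  define \<alpha> where "\<alpha> = 1 / (4 * \<epsilon>)"
  have \<alpha>: "\<alpha> > 0" using assms by (simp add: \<alpha>_def)
  have g: "gaussian (of_real \<alpha>) \<xi> = of_real (norm (gaussian (of_real \<alpha>) \<xi>))" for \<xi>
    unfolding norm_gaussian by (simp add: gaussian_def exp_of_real[symmetric])
  have "of_real (\<integral>\<xi>. norm (gaussian (of_real \<alpha>) \<xi>) \<partial>lborel) = (\<integral>\<xi>. gaussian (of_real \<alpha>) \<xi> \<partial>lborel)"
    by (subst (2) g) (rule integral_complex_of_real[symmetric])
  also have "\<dots> = of_real (pi / \<alpha>)"
    using gaussian_fourier[OF \<alpha>, of "of_real \<alpha>" 0 0] by (simp add: complex_eq_iff)
  finally have I: "(\<integral>\<xi>. norm (gaussian (of_real \<alpha>) \<xi>) \<partial>lborel) = 4 * pi * \<epsilon>"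
    unfolding of_real_eq_iff by (simp add: \<alpha>_def)
  have "(\<integral>\<^sup>+y. ennreal (norm (kernel (of_real \<epsilon>) (x - y))) \<partial>lborel) = (\<integral>\<^sup>+y. ennreal (norm (kernel (of_real \<epsilon>) y)) \<partial>lborel)"
    using nn_integral_lborel_affine[of "\<lambda>y. ennreal (norm (kernel (of_real \<epsilon>) y))" "-1" x] by simp
  also have "\<dots> = (\<integral>\<^sup>+y. ennreal (1 / (4 * pi * \<epsilon>) * norm (gaussian (of_real \<alpha>) y)) \<partial>lborel)"
    using assms by (intro nn_integral_cong arg_cong[where f=ennreal])
      (simp add: kernel_def gaussian_def norm_mult norm_divide \<alpha>_def)
  also have "\<dots> = ennreal (\<integral>y. 1 / (4 * pi * \<epsilon>) * norm (gaussian (of_real \<alpha>) y) \<partial>lborel)"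
    using integrable_gaussian[of "of_real \<alpha>"] \<alpha> assms by (intro nn_integral_eq_integral) auto
  also have "\<dots> = 1" using assms by (simp add: I)
  finally show ?thesis .
qed

lemma nn_integral_kernel_swap:
  assumes "\<epsilon> > 0"
  shows "(\<integral>\<^sup>+x. ennreal (norm (kernel (of_real \<epsilon>) (x - y))) \<partial>lborel) = 1"
proof -
  have "kernel (of_real \<epsilon>) (x - y) = kernel (of_real \<epsilon>) (y - x)" for x
    by (simp add: kernel_def norm_minus_commute)
  then show ?thesis using nn_integral_kernel[OF assms, of y] by simp
qed

text \<open>
  Schur's test: \<open>|u x| |u y|\<close> is at most the mean of the two squares, and the kernel has mass one
  in either variable.
\<close>

lemma gaussian_form_le:
  assumes u: "u \<in> L2 lborel" and \<epsilon>: "\<epsilon> > 0"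
  shows "norm (\<integral>x. cnj (u x) * (\<integral>y. u y * kernel (of_real \<epsilon>) (x - y) \<partial>lborel) \<partial>lborel) \<le> (L2_norm lborel u)\<^sup>2"
proof -
  have [measurable]: "u \<in> borel_measurable borel" using u by (auto simp: L2_def)
  let ?k = "\<lambda>x y. norm (kernel (of_real \<epsilon>) (x - y))"
  have "ennreal (norm (\<integral>x. cnj (u x) * (\<integral>y. u y * kernel (of_real \<epsilon>) (x - y) \<partial>lborel) \<partial>lborel))
     \<le> (\<integral>\<^sup>+x. ennreal (norm (cnj (u x) * (\<integral>y. u y * kernel (of_real \<epsilon>) (x - y) \<partial>lborel))) \<partial>lborel)"
    by (rule norm_integral_le_nn_integral)
  also have "\<dots> \<le> (\<integral>\<^sup>+x. (\<integral>\<^sup>+y. ennreal ((norm (u x))\<^sup>2 / 2) * ennreal (?k x y) + ennreal ((norm (u y))\<^sup>2 / 2) * ennreal (?k x y) \<partial>lborel) \<partial>lborel)"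
  proof (rule nn_integral_mono)
    fix x
    have "ennreal (norm (cnj (u x) * (\<integral>y. u y * kernel (of_real \<epsilon>) (x - y) \<partial>lborel)))
       = ennreal (norm (\<integral>y. cnj (u x) * (u y * kernel (of_real \<epsilon>) (x - y)) \<partial>lborel))"
      by (simp only: integral_mult_right_zero)
    also have "\<dots> \<le> (\<integral>\<^sup>+y. ennreal (norm (cnj (u x) * (u y * kernel (of_real \<epsilon>) (x - y)))) \<partial>lborel)"
      by (rule norm_integral_le_nn_integral)
    also have "\<dots> \<le> (\<integral>\<^sup>+y. ennreal ((norm (u x))\<^sup>2 / 2) * ennreal (?k x y) + ennreal ((norm (u y))\<^sup>2 / 2) * ennreal (?k x y) \<partial>lborel)"
    proof (rule nn_integral_mono)
      fix y
      have "norm (u x) * norm (u y) \<le> (norm (u x))\<^sup>2 / 2 + (norm (u y))\<^sup>2 / 2"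
        using sum_squares_bound[of "norm (u x)" "norm (u y)"] by simp
      then have "norm (u x) * norm (u y) * ?k x y \<le> ((norm (u x))\<^sup>2 / 2 + (norm (u y))\<^sup>2 / 2) * ?k x y"
        by (rule mult_right_mono) simp
      then show "ennreal (norm (cnj (u x) * (u y * kernel (of_real \<epsilon>) (x - y))))
         \<le> ennreal ((norm (u x))\<^sup>2 / 2) * ennreal (?k x y) + ennreal ((norm (u y))\<^sup>2 / 2) * ennreal (?k x y)"
        by (simp add: norm_mult ennreal_mult[symmetric] ennreal_plus[symmetric] algebra_simps del: ennreal_plus)
    qed
    finally show "ennreal (norm (cnj (u x) * (\<integral>y. u y * kernel (of_real \<epsilon>) (x - y) \<partial>lborel))) \<le> \<dots>" .
  qed
  also have "\<dots> = (\<integral>\<^sup>+x. (\<integral>\<^sup>+y. ennreal ((norm (u x))\<^sup>2 / 2) * ennreal (?k x y) \<partial>lborel) \<partial>lborel)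
      + (\<integral>\<^sup>+x. (\<integral>\<^sup>+y. ennreal ((norm (u y))\<^sup>2 / 2) * ennreal (?k x y) \<partial>lborel) \<partial>lborel)"
    by (subst nn_integral_add[symmetric]; (intro nn_integral_cong nn_integral_add)?; measurable)
  also have "(\<integral>\<^sup>+x. (\<integral>\<^sup>+y. ennreal ((norm (u y))\<^sup>2 / 2) * ennreal (?k x y) \<partial>lborel) \<partial>lborel)
      = (\<integral>\<^sup>+y. (\<integral>\<^sup>+x. ennreal ((norm (u y))\<^sup>2 / 2) * ennreal (?k x y) \<partial>lborel) \<partial>lborel)"
    by (rule lborel_pair.Fubini'[symmetric]) measurable
  also have "(\<integral>\<^sup>+y. (\<integral>\<^sup>+x. ennreal ((norm (u y))\<^sup>2 / 2) * ennreal (?k x y) \<partial>lborel) \<partial>lborel) = (\<integral>\<^sup>+y. ennreal ((norm (u y))\<^sup>2 / 2) \<partial>lborel)"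
    by (simp add: nn_integral_cmult nn_integral_kernel_swap[OF \<epsilon>])
  also have "(\<integral>\<^sup>+x. (\<integral>\<^sup>+y. ennreal ((norm (u x))\<^sup>2 / 2) * ennreal (?k x y) \<partial>lborel) \<partial>lborel) = (\<integral>\<^sup>+y. ennreal ((norm (u y))\<^sup>2 / 2) \<partial>lborel)"
    by (simp add: nn_integral_cmult nn_integral_kernel[OF \<epsilon>])
  also have "(\<integral>\<^sup>+y. ennreal ((norm (u y))\<^sup>2 / 2) \<partial>lborel) + (\<integral>\<^sup>+y. ennreal ((norm (u y))\<^sup>2 / 2) \<partial>lborel) = (\<integral>\<^sup>+y. ennreal ((norm (u y))\<^sup>2) \<partial>lborel)"
    by (subst nn_integral_add[symmetric]) (auto simp: ennreal_plus[symmetric] simp del: ennreal_plus)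
  also have "\<dots> = ennreal ((L2_norm lborel u)\<^sup>2)" by (rule nn_integral_L2[OF u])
  finally show ?thesis by simp
qed

text \<open>
  Bessel's inequality. In the presence of a Gaussian factor it is the regularised Parseval identity
  together with Schur's test; the factor is then removed with Fatou's lemma.
\<close>

lemma fourier_L2:
  assumes i: "integrable lborel u" and u: "u \<in> L2 lborel"
  shows "fourier u \<in> L2 lborel" "L2_norm lborel (fourier u) \<le> L2_norm lborel u"
proof -
  have [measurable]: "u \<in> borel_measurable borel" using i by auto
  define \<epsilon> where "\<epsilon> n = 1 / real (Suc n)" for n
  have \<epsilon>: "\<epsilon> n > 0" for n by (simp add: \<epsilon>_def)
  have \<epsilon>0: "\<epsilon> \<longlonglongrightarrow> 0" unfolding \<epsilon>_def by (rule LIMSEQ_Suc[OF lim_1_over_n])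
  let ?g = "\<lambda>n \<xi>. norm (gaussian (of_real (\<epsilon> n)) \<xi>) * (norm (fourier u \<xi>))\<^sup>2"
  have bound: "(\<integral>\<^sup>+\<xi>. ennreal (?g n \<xi>) \<partial>lborel) \<le> ennreal ((L2_norm lborel u)\<^sup>2)" for n
  proof -
    have g: "cnj (fourier u \<xi>) * (gaussian (of_real (\<epsilon> n)) \<xi> * fourier u \<xi>) = of_real (?g n \<xi>)" for \<xi>
    proof -
      have "gaussian (of_real (\<epsilon> n)) \<xi> = of_real (norm (gaussian (of_real (\<epsilon> n)) \<xi>))"
        unfolding norm_gaussian by (simp add: gaussian_def exp_of_real[symmetric])
      then show ?thesis by (metis complex_norm_square mult.assoc mult.commute of_real_mult of_real_power)
    qed
    have "integrable lborel (?g n)"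
    proof (rule Bochner_Integration.integrable_bound)
      show "integrable lborel (\<lambda>\<xi>. ((\<integral>x. norm (u x) \<partial>lborel) / (2 * pi))\<^sup>2 * norm (gaussian (of_real (\<epsilon> n)) \<xi>))"
        using integrable_gaussian[of "of_real (\<epsilon> n)"] \<epsilon>[of n] by simp
      show "AE \<xi> in lborel. norm (?g n \<xi>) \<le> norm (((\<integral>x. norm (u x) \<partial>lborel) / (2 * pi))\<^sup>2 * norm (gaussian (of_real (\<epsilon> n)) \<xi>))"
      proof (rule AE_I2)
        fix \<xi> show "norm (?g n \<xi>) \<le> norm (((\<integral>x. norm (u x) \<partial>lborel) / (2 * pi))\<^sup>2 * norm (gaussian (of_real (\<epsilon> n)) \<xi>))"
          using mult_right_mono[OF power_mono[OF norm_fourier_le[OF i, of \<xi>] norm_ge_zero, of 2], of "norm (gaussian (of_real (\<epsilon> n)) \<xi>)"]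
          by (simp add: mult.commute)
      qed
    qed measurable
    then have "(\<integral>\<^sup>+\<xi>. ennreal (?g n \<xi>) \<partial>lborel) = ennreal (\<integral>\<xi>. ?g n \<xi> \<partial>lborel)"
      by (intro nn_integral_eq_integral) auto
    also have "(\<integral>\<xi>. ?g n \<xi> \<partial>lborel) = norm (\<integral>\<xi>. cnj (fourier u \<xi>) * (gaussian (of_real (\<epsilon> n)) \<xi> * fourier u \<xi>) \<partial>lborel)"
      unfolding g integral_complex_of_real by (simp add: integral_nonneg_AE)
    also have "\<dots> = norm (\<integral>x. cnj (u x) * (\<integral>y. u y * kernel (of_real (\<epsilon> n)) (x - y) \<partial>lborel) \<partial>lborel)"
      by (subst parseval_regularized[OF i i \<epsilon>, of _ n 0]) (simp_all add: complex_eq_iff)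
    also have "\<dots> \<le> (L2_norm lborel u)\<^sup>2" by (rule gaussian_form_le[OF u \<epsilon>])
    finally show ?thesis by (simp add: ennreal_leI)
  qed
  have "(\<integral>\<^sup>+\<xi>. ennreal ((norm (fourier u \<xi>))\<^sup>2) \<partial>lborel) = (\<integral>\<^sup>+\<xi>. liminf (\<lambda>n. ennreal (?g n \<xi>)) \<partial>lborel)"
  proof (rule nn_integral_cong)
    fix \<xi>
    have "(\<lambda>n. ?g n \<xi>) \<longlonglongrightarrow> exp (- 0 * (norm \<xi>)\<^sup>2) * (norm (fourier u \<xi>))\<^sup>2"
      unfolding norm_gaussian Re_complex_of_real by (intro tendsto_intros \<epsilon>0)
    then have "(\<lambda>n. ennreal (?g n \<xi>)) \<longlonglongrightarrow> ennreal ((norm (fourier u \<xi>))\<^sup>2)" by (intro tendsto_ennrealI) simp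
    then show "ennreal ((norm (fourier u \<xi>))\<^sup>2) = liminf (\<lambda>n. ennreal (?g n \<xi>))"
      by (intro lim_imp_Liminf[symmetric] trivial_limit_sequentially)
  qed
  also have "\<dots> \<le> liminf (\<lambda>n. \<integral>\<^sup>+\<xi>. ennreal (?g n \<xi>) \<partial>lborel)"
    by (rule nn_integral_liminf) measurable
  also have "\<dots> \<le> ennreal ((L2_norm lborel u)\<^sup>2)"
    by (rule Liminf_le) (use bound in auto)
  finally show "fourier u \<in> L2 lborel" "L2_norm lborel (fourier u) \<le> L2_norm lborel u"
    by (auto intro!: L2_norm_le_nn)
qed

section \<open>The Fresnel convolution\<close>

lemma borel_measurable_cnj [measurable]:
  "f \<in> borel_measurable M \<Longrightarrow> (\<lambda>x. cnj (f x)) \<in> borel_measurable M"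
  by (rule borel_measurable_continuous_on[OF continuous_on_cnj[OF continuous_on_id]])

text \<open>
  The convolution with the Fresnel kernel of modulus \<open>1 / (4 \<pi> |b|)\<close>. The propagator with
  Fresnel number \<open>Fr\<close> corresponds to \<open>b = \<pi> / (2 Fr)\<close>.
\<close>

definition fresnel_conv :: "real \<Rightarrow> (real \<times> real \<Rightarrow> complex) \<Rightarrow> real \<times> real \<Rightarrow> complex" where
  "fresnel_conv b u x = (\<integral>y. u y * kernel (\<i> * of_real b) (x - y) \<partial>lborel)"

definition chirp :: "real \<Rightarrow> (real \<times> real \<Rightarrow> complex) \<Rightarrow> real \<times> real \<Rightarrow> complex" where
  "chirp b u y = exp (\<i> * of_real ((norm y)\<^sup>2 / (4 * b))) * u y"

lemma fresnel_conv_measurable [measurable]: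
  assumes [measurable]: "u \<in> borel_measurable borel"
  shows "fresnel_conv b u \<in> borel_measurable borel"
  unfolding fresnel_conv_def by measurable

lemma chirp_measurable [measurable]:
  assumes [measurable]: "u \<in> borel_measurable borel"
  shows "chirp b u \<in> borel_measurable borel"
  unfolding chirp_def by measurable

lemma integrable_kernel_mult:
  assumes u: "integrable lborel u" and \<beta>: "Re \<beta> \<ge> 0"
  shows "integrable lborel (\<lambda>y. u y * kernel \<beta> (x - y))"
proof -
  have [measurable]: "u \<in> borel_measurable borel" using u by auto
  have "integrable lborel (\<lambda>y. 1 / (4 * pi * norm \<beta>) * norm (u y))" using u by simp
  then show ?thesis
  proof (rule Bochner_Integration.integrable_bound)
    show "AE y in lborel. norm (u y * kernel \<beta> (x - y)) \<le> norm (1 / (4 * pi * norm \<beta>) * norm (u y))"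
    proof (rule AE_I2)
      fix y show "norm (u y * kernel \<beta> (x - y)) \<le> norm (1 / (4 * pi * norm \<beta>) * norm (u y))"
        using mult_left_mono[OF norm_kernel_le[OF \<beta>, of "x - y"], of "norm (u y)"]
        by (simp add: norm_mult mult.commute)
    qed
  qed measurable
qed

lemma norm_kernel_conv_le:
  assumes u: "integrable lborel u" and \<beta>: "Re \<beta> \<ge> 0"
  shows "norm (\<integral>y. u y * kernel \<beta> (x - y) \<partial>lborel) \<le> (\<integral>y. norm (u y) \<partial>lborel) / (4 * pi * norm \<beta>)"
proof -
  have "norm (\<integral>y. u y * kernel \<beta> (x - y) \<partial>lborel) \<le> (\<integral>y. norm (u y * kernel \<beta> (x - y)) \<partial>lborel)"
    by (rule integral_norm_bound)
  also have "\<dots> \<le> (\<integral>y. norm (u y) * (1 / (4 * pi * norm \<beta>)) \<partial>lborel)"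
  proof (rule integral_mono)
    fix y show "norm (u y * kernel \<beta> (x - y)) \<le> norm (u y) * (1 / (4 * pi * norm \<beta>))"
      unfolding norm_mult by (intro mult_left_mono norm_kernel_le \<beta>) auto
  qed (use u integrable_kernel_mult[OF u \<beta>] in auto)
  also have "\<dots> = (\<integral>y. norm (u y) \<partial>lborel) / (4 * pi * norm \<beta>)" by simp
  finally show ?thesis .
qed

text \<open>
  The propagator maps \<open>L\<^sup>1\<close> to \<open>L\<^sup>\<infinity>\<close>. The loss of integrability in the expansion of the
  exponential is paid for here.
\<close>

lemma norm_fresnel_conv_le:
  assumes "integrable lborel u"
  shows "norm (fresnel_conv b u x) \<le> (\<integral>y. norm (u y) \<partial>lborel) / (4 * pi * \<bar>b\<bar>)"
  unfolding fresnel_conv_def using norm_kernel_conv_le[OF assms, of "\<i> * of_real b" x] by (simp add: norm_mult)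

lemma fresnel_conv_diff:
  assumes "integrable lborel u" "integrable lborel v"
  shows "fresnel_conv b (\<lambda>y. u y - v y) x = fresnel_conv b u x - fresnel_conv b v x"
  using integrable_kernel_mult[OF assms(1), of "\<i> * of_real b" x] integrable_kernel_mult[OF assms(2), of "\<i> * of_real b" x]
  by (simp add: fresnel_conv_def left_diff_distrib)

lemma fresnel_conv_add:
  assumes "integrable lborel u" "integrable lborel v"
  shows "fresnel_conv b (\<lambda>y. u y + v y) x = fresnel_conv b u x + fresnel_conv b v x"
  using integrable_kernel_mult[OF assms(1), of "\<i> * of_real b" x] integrable_kernel_mult[OF assms(2), of "\<i> * of_real b" x]
  by (simp add: fresnel_conv_def distrib_right)

lemma fresnel_conv_scaleR: "fresnel_conv b (\<lambda>y. r *\<^sub>R u y) x = r *\<^sub>R fresnel_conv b u x"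
  by (simp add: fresnel_conv_def)

lemma fresnel_conv_cong_AE:
  assumes "AE y in lborel. u y = v y" "u \<in> borel_measurable borel" "v \<in> borel_measurable borel"
  shows "fresnel_conv b u x = fresnel_conv b v x"
  unfolding fresnel_conv_def using assms by (intro integral_cong_AE) auto

text \<open>
  The convolution represents the multiplier \<open>gaussian (\<i> b)\<close> weakly: both sides of the
  regularised Parseval identity converge when the real part of \<open>\<beta>\<close> tends to zero.
\<close>

lemma fresnel_duality:
  assumes b: "b \<noteq> 0"
    and w: "integrable lborel w" "w \<in> L2 lborel" and u: "integrable lborel u" "u \<in> L2 lborel"
  shows "(\<integral>\<xi>. cnj (fourier w \<xi>) * (gaussian (\<i> * of_real b) \<xi> * fourier u \<xi>) \<partial>lborel)
     = (\<integral>x. cnj (w x) * fresnel_conv b u x \<partial>lborel)"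
proof -
  have [measurable]: "w \<in> borel_measurable borel" "u \<in> borel_measurable borel" using w u by auto
  define \<epsilon> where "\<epsilon> n = 1 / real (Suc n)" for n
  have \<epsilon>: "\<epsilon> n > 0" for n by (simp add: \<epsilon>_def)
  have \<epsilon>0: "\<epsilon> \<longlonglongrightarrow> 0" unfolding \<epsilon>_def by (rule LIMSEQ_Suc[OF lim_1_over_n])
  define \<beta> where "\<beta> n = Complex (\<epsilon> n) b" for n
  have Re: "Re (\<beta> n) > 0" for n using \<epsilon>[of n] by (simp add: \<beta>_def)
  have \<beta>b: "norm (\<beta> n) \<ge> \<bar>b\<bar>" for n
    using abs_Im_le_cmod[of "\<beta> n"] by (simp add: \<beta>_def)
  have ib: "\<i> * of_real b = Complex 0 b" by (simp add: complex_eq_iff)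
  have \<beta>0: "\<beta> \<longlonglongrightarrow> \<i> * of_real b"
    unfolding \<beta>_def ib by (intro tendsto_Complex \<epsilon>0 tendsto_const)
  have l1: "(\<lambda>n. \<integral>\<xi>. cnj (fourier w \<xi>) * (gaussian (\<beta> n) \<xi> * fourier u \<xi>) \<partial>lborel)
    \<longlonglongrightarrow> (\<integral>\<xi>. cnj (fourier w \<xi>) * (gaussian (\<i> * of_real b) \<xi> * fourier u \<xi>) \<partial>lborel)"
  proof (rule integral_dominated_convergence[where w="\<lambda>\<xi>. norm (fourier w \<xi> * fourier u \<xi>)"])
    show "integrable lborel (\<lambda>\<xi>. norm (fourier w \<xi> * fourier u \<xi>))"
      by (intro integrable_norm integrable_L2_mult fourier_L2 w u)
    show "AE \<xi> in lborel. (\<lambda>n. cnj (fourier w \<xi>) * (gaussian (\<beta> n) \<xi> * fourier u \<xi>))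
      \<longlonglongrightarrow> cnj (fourier w \<xi>) * (gaussian (\<i> * of_real b) \<xi> * fourier u \<xi>)"
      unfolding gaussian_def by (intro AE_I2 tendsto_intros \<beta>0)
    show "AE \<xi> in lborel. norm (cnj (fourier w \<xi>) * (gaussian (\<beta> n) \<xi> * fourier u \<xi>)) \<le> norm (fourier w \<xi> * fourier u \<xi>)" for n
    proof (rule AE_I2)
      fix \<xi>
      have "norm (gaussian (\<beta> n) \<xi>) \<le> 1" using Re[of n] by (simp add: norm_gaussian)
      then have "norm (gaussian (\<beta> n) \<xi>) * norm (fourier w \<xi> * fourier u \<xi>) \<le> 1 * norm (fourier w \<xi> * fourier u \<xi>)"
        by (rule mult_right_mono) simp
      then show "norm (cnj (fourier w \<xi>) * (gaussian (\<beta> n) \<xi> * fourier u \<xi>)) \<le> norm (fourier w \<xi> * fourier u \<xi>)"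
        by (simp add: norm_mult mult_ac)
    qed
  qed measurable
  let ?C = "(\<integral>y. norm (u y) \<partial>lborel) / (4 * pi * \<bar>b\<bar>)"
  have nb: "norm (\<integral>y. u y * kernel (\<beta> n) (x - y) \<partial>lborel) \<le> ?C" for n x
  proof -
    have "norm (\<integral>y. u y * kernel (\<beta> n) (x - y) \<partial>lborel) \<le> (\<integral>y. norm (u y) \<partial>lborel) / (4 * pi * norm (\<beta> n))"
      using Re[of n] by (intro norm_kernel_conv_le u) simp
    also have "\<dots> \<le> ?C"
      using \<beta>b[of n] b by (intro divide_left_mono mult_left_mono mult_pos_pos) (auto intro: integral_nonneg_AE)
    finally show ?thesis .
  qed
  have inner_lim: "(\<lambda>n. \<integral>y. u y * kernel (\<beta> n) (x - y) \<partial>lborel) \<longlonglongrightarrow> fresnel_conv b u x" for x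
    unfolding fresnel_conv_def
  proof (rule integral_dominated_convergence[where w="\<lambda>y. norm (u y) * (1 / (4 * pi * \<bar>b\<bar>))"])
    show "AE y in lborel. (\<lambda>n. u y * kernel (\<beta> n) (x - y)) \<longlonglongrightarrow> u y * kernel (\<i> * of_real b) (x - y)"
      unfolding kernel_def using b by (intro AE_I2 tendsto_intros \<beta>0) auto
    show "AE y in lborel. norm (u y * kernel (\<beta> n) (x - y)) \<le> norm (u y) * (1 / (4 * pi * \<bar>b\<bar>))" for n
    proof (rule AE_I2)
      fix y
      have "norm (kernel (\<beta> n) (x - y)) \<le> 1 / (4 * pi * norm (\<beta> n))"
        using Re[of n] by (intro norm_kernel_le) simp
      also have "\<dots> \<le> 1 / (4 * pi * \<bar>b\<bar>)"
        using \<beta>b[of n] b by (intro divide_left_mono mult_left_mono mult_pos_pos) auto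
      finally show "norm (u y * kernel (\<beta> n) (x - y)) \<le> norm (u y) * (1 / (4 * pi * \<bar>b\<bar>))"
        unfolding norm_mult by (rule mult_left_mono) simp
    qed
  qed (use u in \<open>auto intro!: integrable_mult_left\<close>)
  have l2: "(\<lambda>n. \<integral>x. cnj (w x) * (\<integral>y. u y * kernel (\<beta> n) (x - y) \<partial>lborel) \<partial>lborel)
     \<longlonglongrightarrow> (\<integral>x. cnj (w x) * fresnel_conv b u x \<partial>lborel)"
  proof (rule integral_dominated_convergence[where w="\<lambda>x. norm (w x) * ?C"])
    show "AE x in lborel. (\<lambda>n. cnj (w x) * (\<integral>y. u y * kernel (\<beta> n) (x - y) \<partial>lborel)) \<longlonglongrightarrow> cnj (w x) * fresnel_conv b u x"
      by (intro AE_I2 tendsto_intros inner_lim)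
    show "AE x in lborel. norm (cnj (w x) * (\<integral>y. u y * kernel (\<beta> n) (x - y) \<partial>lborel)) \<le> norm (w x) * ?C" for n
    proof (rule AE_I2)
      fix x show "norm (cnj (w x) * (\<integral>y. u y * kernel (\<beta> n) (x - y) \<partial>lborel)) \<le> norm (w x) * ?C"
        unfolding norm_mult complex_mod_cnj by (rule mult_left_mono[OF nb]) simp
    qed
  qed (use w in \<open>auto intro!: integrable_mult_left\<close>)
  show ?thesis
    by (rule LIMSEQ_unique[OF l1]) (use l2 in \<open>simp add: parseval_regularized[OF w(1) u(1) \<epsilon> \<beta>_def]\<close>)
qed

text \<open>
  Expanding \<open>|x - y|\<^sup>2\<close> in the exponent leaves a quadratic phase in \<open>x\<close>, one in \<open>y\<close>, and
  the kernel of a Fourier transform evaluated at \<open>x / (2 b)\<close>.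
\<close>

lemma fresnel_conv_eq_fourier:
  assumes b: "b \<noteq> 0"
  shows "fresnel_conv b u x = 1 / (2 * \<i> * of_real b) * exp (\<i> * of_real ((norm x)\<^sup>2 / (4 * b))) * fourier (chirp b u) ((1 / (2 * b)) *\<^sub>R x)"
proof -
  have "u y * kernel (\<i> * of_real b) (x - y) =
     (1 / (4 * of_real pi * \<i> * of_real b) * exp (\<i> * of_real ((norm x)\<^sup>2 / (4 * b)))) *
     (exp (- \<i> * of_real (y \<bullet> ((1 / (2 * b)) *\<^sub>R x))) * chirp b u y)" for y
  proof -
    have "(norm (x - y))\<^sup>2 = (norm x)\<^sup>2 + (norm y)\<^sup>2 - 2 * (x \<bullet> y)"
      by (simp add: power2_norm_eq_inner inner_diff_left inner_diff_right inner_commute)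
    then have r: "(norm (x - y))\<^sup>2 / (4 * b) = (norm x)\<^sup>2 / (4 * b) + (- (y \<bullet> ((1 / (2 * b)) *\<^sub>R x)) + (norm y)\<^sup>2 / (4 * b))"
      using b by (simp add: add_divide_distrib diff_divide_distrib inner_commute)
    have "- of_real ((norm (x - y))\<^sup>2) / (4 * (\<i> * of_real b)) = \<i> * of_real ((norm (x - y))\<^sup>2 / (4 * b))"
      using b by (simp add: divide_simps)
    also have "\<dots> = \<i> * of_real ((norm x)\<^sup>2 / (4 * b)) + (- \<i> * of_real (y \<bullet> ((1 / (2 * b)) *\<^sub>R x)) + \<i> * of_real ((norm y)\<^sup>2 / (4 * b)))"
      unfolding r of_real_add of_real_minus by (simp only: distrib_left mult_minus_left mult_minus_right)
    finally have e: "exp (- of_real ((norm (x - y))\<^sup>2) / (4 * (\<i> * of_real b))) =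
       exp (\<i> * of_real ((norm x)\<^sup>2 / (4 * b))) * (exp (- \<i> * of_real (y \<bullet> ((1 / (2 * b)) *\<^sub>R x))) * exp (\<i> * of_real ((norm y)\<^sup>2 / (4 * b))))"
      by (simp only: exp_add)
    show ?thesis
      unfolding kernel_def chirp_def e by (simp only: mult_ac)
  qed
  then have "fresnel_conv b u x = (1 / (4 * of_real pi * \<i> * of_real b) * exp (\<i> * of_real ((norm x)\<^sup>2 / (4 * b)))) *
     (\<integral>y. exp (- \<i> * of_real (y \<bullet> ((1 / (2 * b)) *\<^sub>R x))) * chirp b u y \<partial>lborel)"
    unfolding fresnel_conv_def by (simp only: integral_mult_right_zero)
  then show ?thesis by (simp add: fourier_def mult_ac)
qed

lemma chirp_L12:
  assumes "integrable lborel u" "u \<in> L2 lborel"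
  shows "integrable lborel (chirp b u)" "chirp b u \<in> L2 lborel" "L2_norm lborel (chirp b u) = L2_norm lborel u"
proof -
  have n: "norm (chirp b u y) = norm (u y)" for y by (simp add: chirp_def norm_mult)
  have [measurable]: "u \<in> borel_measurable borel" using assms by auto
  show "integrable lborel (chirp b u)"
    by (rule Bochner_Integration.integrable_bound[OF assms(1)]) (auto simp: n)
  show "chirp b u \<in> L2 lborel" using assms(2) by (simp add: L2_def n)
  show "L2_norm lborel (chirp b u) = L2_norm lborel u" by (simp add: L2_norm_def n)
qed

lemma fresnel_conv_L2:
  assumes b: "b \<noteq> 0" and u: "integrable lborel u" "u \<in> L2 lborel"
  shows "fresnel_conv b u \<in> L2 lborel"
    "L2_norm lborel (fresnel_conv b u) = L2_norm lborel (fourier (chirp b u))"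
proof -
  have [measurable]: "u \<in> borel_measurable borel" using u by auto
  have F: "fourier (chirp b u) \<in> L2 lborel" by (intro fourier_L2 chirp_L12 u)
  have "norm (fresnel_conv b u x) = 1 / (2 * \<bar>b\<bar>) * norm (fourier (chirp b u) ((1 / (2 * b)) *\<^sub>R x))" for x
    unfolding fresnel_conv_eq_fourier[OF b] norm_mult by (simp add: norm_divide norm_mult)
  then have n: "ennreal ((norm (fresnel_conv b u x))\<^sup>2)
      = ennreal (\<bar>1 / (2 * b)\<bar> ^ DIM(real \<times> real)) * ennreal ((norm (fourier (chirp b u) (0 + (1 / (2 * b)) *\<^sub>R x)))\<^sup>2)" for x
    by (simp add: ennreal_mult'[symmetric] power_mult_distrib power_divide power2_eq_square)
  have "(\<integral>\<^sup>+x. ennreal ((norm (fresnel_conv b u x))\<^sup>2) \<partial>lborel) = (\<integral>\<^sup>+x. ennreal ((norm (fourier (chirp b u) x))\<^sup>2) \<partial>lborel)"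
    unfolding n using b by (subst nn_integral_lborel_affine[of _ "1 / (2 * b)" 0]) (auto simp: nn_integral_cmult)
  also have "\<dots> = ennreal ((L2_norm lborel (fourier (chirp b u)))\<^sup>2)" by (rule nn_integral_L2[OF F])
  finally have e: "(\<integral>\<^sup>+x. ennreal ((norm (fresnel_conv b u x))\<^sup>2) \<partial>lborel) = ennreal ((L2_norm lborel (fourier (chirp b u)))\<^sup>2)" .
  show f: "fresnel_conv b u \<in> L2 lborel" using e by (simp add: L2_iff_nn)
  show "L2_norm lborel (fresnel_conv b u) = L2_norm lborel (fourier (chirp b u))"
    using e unfolding nn_integral_L2[OF f] by simp
qed

definition trunc :: "real \<Rightarrow> (real \<times> real \<Rightarrow> complex) \<Rightarrow> real \<times> real \<Rightarrow> complex" where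
  "trunc R f x = indicator (cbox (-R, -R) (R, R)) x *\<^sub>R f x"

lemma truncated_fourier_eq: "truncated_fourier R f \<xi> = fourier (trunc R f) \<xi>"
  by (simp add: truncated_fourier_def fourier_def trunc_def set_lebesgue_integral_def)

lemma mem_cbox_square: "x \<in> cbox (-R, -R) (R, R :: real) \<longleftrightarrow> \<bar>fst x\<bar> \<le> R \<and> \<bar>snd x\<bar> \<le> R"
  by (cases x) (auto simp: cbox_Pair_eq abs_le_iff)

lemma trunc_measurable [measurable]:
  assumes [measurable]: "f \<in> borel_measurable borel"
  shows "trunc R f \<in> borel_measurable borel"
  unfolding trunc_def by measurable

lemma eventually_in_square: "\<forall>\<^sub>F R in at_top. x \<in> cbox (-R, -R) (R, R :: real)"
  using eventually_ge_at_top[of "max \<bar>fst x\<bar> \<bar>snd x\<bar>"]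
  by eventually_elim (auto simp: mem_cbox_square)

lemma trunc_L12:
  assumes f: "f \<in> L2 lborel"
  shows "trunc R f \<in> L2 lborel" "integrable lborel (trunc R f)"
proof -
  have [measurable]: "f \<in> borel_measurable borel" using f by (auto simp: L2_def)
  have "integrable lborel (\<lambda>x. (norm (f x))\<^sup>2)" using f by (simp add: L2_def)
  then have "integrable lborel (\<lambda>x. (norm (trunc R f x))\<^sup>2)"
    by (rule Bochner_Integration.integrable_bound) (auto simp: trunc_def indicator_def)
  then show t: "trunc R f \<in> L2 lborel" by (simp add: L2_def)
  show "integrable lborel (trunc R f)"
    by (rule L2_finite_support_integrable[OF t, of "cbox (-R, -R) (R, R)"])
       (simp_all add: trunc_def emeasure_lborel_cbox_finite[simplified])
qed

lemma L2_norm_trunc_tendsto: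
  assumes f: "f \<in> L2 lborel"
  shows "((\<lambda>R. (L2_norm lborel (trunc R f))\<^sup>2) \<longlongrightarrow> (L2_norm lborel f)\<^sup>2) at_top"
  unfolding L2_norm_sq
proof (rule integral_dominated_convergence_at_top[where w="\<lambda>x. (norm (f x))\<^sup>2"])
  have [measurable]: "f \<in> borel_measurable borel" using f by (auto simp: L2_def)
  show "(\<lambda>x. (norm (f x))\<^sup>2) \<in> borel_measurable lborel" "\<And>R. (\<lambda>x. (norm (trunc R f x))\<^sup>2) \<in> borel_measurable lborel"
    by measurable
  show "integrable lborel (\<lambda>x. (norm (f x))\<^sup>2)" using f by (simp add: L2_def)
  show "AE x in lborel. ((\<lambda>R. (norm (trunc R f x))\<^sup>2) \<longlongrightarrow> (norm (f x))\<^sup>2) at_top"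
  proof (rule AE_I2)
    fix x
    have "\<forall>\<^sub>F R in at_top. (norm (trunc R f x))\<^sup>2 = (norm (f x))\<^sup>2"
      using eventually_in_square[of x] by eventually_elim (simp add: trunc_def)
    then show "((\<lambda>R. (norm (trunc R f x))\<^sup>2) \<longlongrightarrow> (norm (f x))\<^sup>2) at_top" by (rule tendsto_eventually)
  qed
  show "\<forall>\<^sub>F R in at_top. AE x in lborel. norm ((norm (trunc R f x))\<^sup>2) \<le> (norm (f x))\<^sup>2"
    by (auto simp: trunc_def indicator_def)
qed

lemma fresnel_conv_truncation_pairing:
  assumes b: "b \<noteq> 0" and u: "integrable lborel u" "u \<in> L2 lborel"
  shows "(\<integral>\<xi>. cnj (fourier (trunc R (fresnel_conv b u)) \<xi>) * (gaussian (\<i> * of_real b) \<xi> * fourier u \<xi>) \<partial>lborel)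
     = of_real ((L2_norm lborel (trunc R (fresnel_conv b u)))\<^sup>2)"
proof -
  have N: "fresnel_conv b u \<in> L2 lborel" by (rule fresnel_conv_L2[OF b u])
  have "cnj (trunc R (fresnel_conv b u) x) * fresnel_conv b u x = of_real ((norm (trunc R (fresnel_conv b u) x))\<^sup>2)" for x
    by (simp add: trunc_def indicator_def complex_norm_square mult.commute del: of_real_power)
  then show ?thesis
    unfolding fresnel_duality[OF b trunc_L12(2)[OF N] trunc_L12(1)[OF N] u] L2_norm_sq
    by (simp only: integral_complex_of_real)
qed

lemma L2_gaussian_mult:
  assumes V: "V \<in> L2 lborel" and \<beta>: "Re \<beta> = 0"
  shows "(\<lambda>\<xi>. gaussian \<beta> \<xi> * V \<xi>) \<in> L2 lborel" "L2_norm lborel (\<lambda>\<xi>. gaussian \<beta> \<xi> * V \<xi>) = L2_norm lborel V"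
proof -
  have n: "norm (gaussian \<beta> \<xi>) = 1" for \<xi> using \<beta> by (simp add: norm_gaussian)
  have [measurable]: "V \<in> borel_measurable borel" using V by (auto simp: L2_def)
  show "(\<lambda>\<xi>. gaussian \<beta> \<xi> * V \<xi>) \<in> L2 lborel" using V by (simp add: L2_def norm_mult n)
  show "L2_norm lborel (\<lambda>\<xi>. gaussian \<beta> \<xi> * V \<xi>) = L2_norm lborel V" by (simp add: L2_norm_def norm_mult n)
qed

text \<open>
  By duality the squared norm of a truncation of the convolution is the pairing of its transform with
  a function that has the norm of \<open>fourier u\<close>. Cauchy-Schwarz and Bessel's inequality for
  the truncation allow one factor to be cancelled.
\<close>

lemma fresnel_conv_norm_le:
  assumes b: "b \<noteq> 0" and u: "integrable lborel u" "u \<in> L2 lborel"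
  shows "L2_norm lborel (fresnel_conv b u) \<le> L2_norm lborel (fourier u)"
proof -
  let ?N = "fresnel_conv b u"
  have N: "?N \<in> L2 lborel" by (rule fresnel_conv_L2[OF b u])
  have Fu: "fourier u \<in> L2 lborel" by (rule fourier_L2[OF u])
  have "L2_norm lborel (trunc R ?N) \<le> L2_norm lborel (fourier u)" for R
  proof -
    let ?T = "trunc R ?N"
    have FT: "fourier ?T \<in> L2 lborel" "L2_norm lborel (fourier ?T) \<le> L2_norm lborel ?T"
      by (intro fourier_L2 trunc_L12 N)+
    have FT': "(\<lambda>\<xi>. cnj (fourier ?T \<xi>)) \<in> L2 lborel" using FT(1) by (auto simp: L2_def)
    have "(L2_norm lborel ?T)\<^sup>2 = norm (\<integral>\<xi>. cnj (fourier ?T \<xi>) * (gaussian (\<i> * of_real b) \<xi> * fourier u \<xi>) \<partial>lborel)"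
      unfolding fresnel_conv_truncation_pairing[OF b u] by (simp del: of_real_power)
    also have "\<dots> \<le> L2_norm lborel (\<lambda>\<xi>. cnj (fourier ?T \<xi>)) * L2_norm lborel (\<lambda>\<xi>. gaussian (\<i> * of_real b) \<xi> * fourier u \<xi>)"
      by (intro Cauchy_Schwarz_L2 FT' L2_gaussian_mult Fu) simp
    also have "L2_norm lborel (\<lambda>\<xi>. cnj (fourier ?T \<xi>)) = L2_norm lborel (fourier ?T)" by (simp add: L2_norm_def)
    also have "L2_norm lborel (\<lambda>\<xi>. gaussian (\<i> * of_real b) \<xi> * fourier u \<xi>) = L2_norm lborel (fourier u)"
      by (intro L2_gaussian_mult Fu) simp
    also have "L2_norm lborel (fourier ?T) * L2_norm lborel (fourier u) \<le> L2_norm lborel ?T * L2_norm lborel (fourier u)"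
      by (intro mult_right_mono FT) simp
    finally have "L2_norm lborel ?T * L2_norm lborel ?T \<le> L2_norm lborel ?T * L2_norm lborel (fourier u)"
      by (simp add: power2_eq_square)
    then show ?thesis
      by (cases "L2_norm lborel ?T = 0") (auto simp: mult_le_cancel_left less_le)
  qed
  then have "(L2_norm lborel ?N)\<^sup>2 \<le> (L2_norm lborel (fourier u))\<^sup>2"
    by (intro tendsto_upperbound[OF L2_norm_trunc_tendsto[OF N]]) (auto intro!: always_eventually power_mono)
  then show ?thesis by (rule power2_le_imp_le) simp
qed

text \<open>
  Up to a phase the convolution is a rescaled transform of the chirped function, and chirping with \<open>- b\<close> undoes
  chirping with \<open>b\<close>. Hence the preceding inequality for \<open>- b\<close>, applied to the chirped
  function, is the converse inequality.
\<close>

lemma fresnel_conv_isometry: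
  assumes b: "b \<noteq> 0" and u: "integrable lborel u" "u \<in> L2 lborel"
  shows "L2_norm lborel (fresnel_conv b u) = L2_norm lborel (fourier u)"
proof (rule antisym[OF fresnel_conv_norm_le[OF b u]])
  have b': "- b \<noteq> 0" using b by simp
  have "chirp (- b) (chirp b u) = u"
    by (rule ext) (simp add: chirp_def mult.assoc[symmetric] exp_add[symmetric])
  then have "L2_norm lborel (fourier u) = L2_norm lborel (fresnel_conv (- b) (chirp b u))"
    using fresnel_conv_L2(2)[OF b' chirp_L12(1,2)[OF u]] by simp
  also have "\<dots> \<le> L2_norm lborel (fourier (chirp b u))"
    by (rule fresnel_conv_norm_le[OF b' chirp_L12(1,2)[OF u]])
  also have "\<dots> = L2_norm lborel (fresnel_conv b u)" by (rule fresnel_conv_L2(2)[OF b u, symmetric])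
  finally show "L2_norm lborel (fourier u) \<le> L2_norm lborel (fresnel_conv b u)" .
qed

lemma norm_diff_sq_complex: "(norm (a - c :: complex))\<^sup>2 = (norm a)\<^sup>2 + (norm c)\<^sup>2 - 2 * Re (cnj a * c)"
  unfolding cmod_power2 by (simp add: power2_diff)

text \<open>
  In the expansion of the squared distance the mixed term is known from duality and the first
  term is bounded by Bessel's inequality. By the isometry, what remains is the squared norm of
  the convolution outside a square.
\<close>

lemma is_fourier_L2_fresnel_conv:
  assumes b: "b \<noteq> 0" and u: "integrable lborel u" "u \<in> L2 lborel"
  shows "is_fourier_L2 (fresnel_conv b u) (\<lambda>\<xi>. gaussian (\<i> * of_real b) \<xi> * fourier u \<xi>)"
proof -
  let ?N = "fresnel_conv b u" and ?G = "\<lambda>\<xi>. gaussian (\<i> * of_real b) \<xi> * fourier u \<xi>"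
  have N: "?N \<in> L2 lborel" by (rule fresnel_conv_L2[OF b u])
  have bound_step: "((\<lambda>R. f R) \<longlongrightarrow> 0) at_top" if "\<And>R. f R \<le> g R" "((\<lambda>R. g R) \<longlongrightarrow> 0) at_top" for f g :: "real \<Rightarrow> ennreal"
    by (rule tendsto_sandwich[OF always_eventually always_eventually tendsto_const that(2)]) (use that(1) in simp_all)
  have G: "?G \<in> L2 lborel" "L2_norm lborel ?G = L2_norm lborel ?N"
    unfolding fresnel_conv_isometry[OF b u] by (rule L2_gaussian_mult[OF fourier_L2(1)[OF u]], simp)+
  let ?d = "\<lambda>R. (L2_norm lborel ?N)\<^sup>2 - (L2_norm lborel (trunc R ?N))\<^sup>2"
  have "(\<integral>\<^sup>+\<xi>. ennreal ((norm (truncated_fourier R ?N \<xi> - ?G \<xi>))\<^sup>2) \<partial>lborel) \<le> ennreal (?d R)" for R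
  proof -
    let ?T = "trunc R ?N"
    have FT: "fourier ?T \<in> L2 lborel" "L2_norm lborel (fourier ?T) \<le> L2_norm lborel ?T"
      by (intro fourier_L2 trunc_L12 N)+
    have FT': "(\<lambda>\<xi>. cnj (fourier ?T \<xi>)) \<in> L2 lborel" using FT(1) by (auto simp: L2_def)
    have D: "(\<lambda>\<xi>. fourier ?T \<xi> - ?G \<xi>) \<in> L2 lborel" by (rule L2_diff[OF FT(1) G(1)])
    have ip: "integrable lborel (\<lambda>\<xi>. cnj (fourier ?T \<xi>) * ?G \<xi>)" by (rule integrable_L2_mult[OF FT' G(1)])
    have "(L2_norm lborel (\<lambda>\<xi>. fourier ?T \<xi> - ?G \<xi>))\<^sup>2
       = (\<integral>\<xi>. (norm (fourier ?T \<xi>))\<^sup>2 + (norm (?G \<xi>))\<^sup>2 - 2 * Re (cnj (fourier ?T \<xi>) * ?G \<xi>) \<partial>lborel)"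
      unfolding L2_norm_sq norm_diff_sq_complex ..
    also have "\<dots> = (L2_norm lborel (fourier ?T))\<^sup>2 + (L2_norm lborel ?G)\<^sup>2 - 2 * Re (\<integral>\<xi>. cnj (fourier ?T \<xi>) * ?G \<xi> \<partial>lborel)"
    proof -
      have i1: "integrable lborel (\<lambda>\<xi>. (norm (fourier ?T \<xi>))\<^sup>2)" and i2: "integrable lborel (\<lambda>\<xi>. (norm (?G \<xi>))\<^sup>2)"
        using FT(1) G(1) by (auto simp: L2_def)
      have i3: "integrable lborel (\<lambda>\<xi>. Re (cnj (fourier ?T \<xi>) * ?G \<xi>))" by (rule integrable_Re[OF ip])
      show ?thesis
        unfolding L2_norm_sq integral_Re[OF ip, symmetric]
          Bochner_Integration.integral_diff[OF Bochner_Integration.integrable_add[OF i1 i2] integrable_mult_right[OF i3]]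
          Bochner_Integration.integral_add[OF i1 i2] integral_mult_right_zero ..
    qed
    also have "Re (\<integral>\<xi>. cnj (fourier ?T \<xi>) * ?G \<xi> \<partial>lborel) = (L2_norm lborel ?T)\<^sup>2"
      unfolding fresnel_conv_truncation_pairing[OF b u] by (simp del: of_real_power)
    also have "(L2_norm lborel (fourier ?T))\<^sup>2 + (L2_norm lborel ?G)\<^sup>2 - 2 * (L2_norm lborel ?T)\<^sup>2 \<le> ?d R"
      using power_mono[OF FT(2), of 2] by (simp add: G(2))
    finally have "(L2_norm lborel (\<lambda>\<xi>. fourier ?T \<xi> - ?G \<xi>))\<^sup>2 \<le> ?d R" .
    then show ?thesis
      unfolding truncated_fourier_eq nn_integral_L2[OF D] by (rule ennreal_leI)
  qed
  moreover have "((\<lambda>R. ennreal (?d R)) \<longlongrightarrow> 0) at_top"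
  proof -
    have "((\<lambda>R. ?d R) \<longlongrightarrow> (L2_norm lborel ?N)\<^sup>2 - (L2_norm lborel ?N)\<^sup>2) at_top"
      by (intro tendsto_diff tendsto_const L2_norm_trunc_tendsto N)
    then have "((\<lambda>R. ennreal (?d R)) \<longlongrightarrow> ennreal 0) at_top" by (intro tendsto_ennrealI) simp
    then show ?thesis by simp
  qed
  ultimately have "((\<lambda>R. \<integral>\<^sup>+\<xi>. ennreal ((norm (truncated_fourier R ?N \<xi> - ?G \<xi>))\<^sup>2) \<partial>lborel) \<longlongrightarrow> 0) at_top"
    by (rule bound_step)
  then show ?thesis unfolding is_fourier_L2_def using N G(1) by blast
qed

text \<open>
  All truncations to large squares are equal to \<open>u\<close>, so the limit is attained.
\<close>

lemma is_fourier_L2_bounded_support: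
  assumes u: "u \<in> L2 lborel" and supp: "\<And>x. x \<notin> cbox (-R0, -R0) (R0, R0) \<Longrightarrow> u x = 0"
  shows "integrable lborel u" "is_fourier_L2 u (fourier u)"
    "is_fourier_L2 u U \<Longrightarrow> AE \<xi> in lborel. U \<xi> = fourier u \<xi>"
proof -
  show i: "integrable lborel u"
    by (rule L2_finite_support_integrable[OF u, of "cbox (-R0, -R0) (R0, R0)"]) (use supp in \<open>simp_all add: emeasure_lborel_cbox_finite[simplified]\<close>)
  have tu: "trunc R u = u" if "R \<ge> R0" for R
  proof
    fix x show "trunc R u x = u x"
    proof (cases "x \<in> cbox (-R, -R) (R, R)")
      case False
      then have "x \<notin> cbox (-R0, -R0) (R0, R0)" using that by (auto simp: mem_cbox_square)
      then show ?thesis by (simp add: trunc_def supp)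
    qed (simp add: trunc_def)
  qed
  have Fu: "fourier u \<in> L2 lborel" by (rule fourier_L2[OF i u])
  have ev: "\<forall>\<^sub>F R in at_top. (\<integral>\<^sup>+\<xi>. ennreal ((norm (truncated_fourier R u \<xi> - V \<xi>))\<^sup>2) \<partial>lborel) = (\<integral>\<^sup>+\<xi>. ennreal ((norm (fourier u \<xi> - V \<xi>))\<^sup>2) \<partial>lborel)" for V
    using eventually_ge_at_top[of R0] by eventually_elim (simp add: truncated_fourier_eq tu)
  have "((\<lambda>R. \<integral>\<^sup>+\<xi>. ennreal ((norm (truncated_fourier R u \<xi> - fourier u \<xi>))\<^sup>2) \<partial>lborel) \<longlongrightarrow> 0) at_top"
    by (rule tendsto_eventually) (use ev[of "fourier u"] in simp)
  then show "is_fourier_L2 u (fourier u)" by (simp add: is_fourier_L2_def u Fu)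
  assume U: "is_fourier_L2 u U"
  have "(\<integral>\<^sup>+\<xi>. ennreal ((norm (fourier u \<xi> - U \<xi>))\<^sup>2) \<partial>lborel) = 0"
    by (rule tendsto_unique[OF trivial_limit_at_top_linorder tendsto_eventually[OF ev[of U]]])
       (use U in \<open>simp add: is_fourier_L2_def\<close>)
  then show "AE \<xi> in lborel. U \<xi> = fourier u \<xi>"
    using U Fu by (subst (asm) nn_integral_0_iff_AE) (auto simp: is_fourier_L2_def L2_def)
qed

section \<open>Uniqueness of the Fourier transform on square-integrable functions\<close>

lemma kernel_eq_gaussian:
  assumes "\<epsilon> > 0"
  shows "kernel (of_real \<epsilon>) z = of_real (1 / (4 * pi * \<epsilon>)) * gaussian (of_real (1 / (4 * \<epsilon>))) z"
  by (simp add: kernel_def gaussian_def)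

lemma L2_gaussian:
  assumes \<beta>: "Re \<beta> > 0" shows "gaussian \<beta> \<in> L2 lborel"
proof -
  have "integrable lborel (\<lambda>\<xi>. norm (gaussian \<beta> \<xi>))" using integrable_gaussian[OF \<beta>] by simp
  then have "integrable lborel (\<lambda>\<xi>. (norm (gaussian \<beta> \<xi>))\<^sup>2)"
  proof (rule Bochner_Integration.integrable_bound)
    show "AE \<xi> in lborel. norm ((norm (gaussian \<beta> \<xi>))\<^sup>2) \<le> norm (norm (gaussian \<beta> \<xi>))"
    proof (rule AE_I2)
      fix \<xi>
      have "norm (gaussian \<beta> \<xi>) \<le> 1" using \<beta> by (simp add: norm_gaussian)
      then show "norm ((norm (gaussian \<beta> \<xi>))\<^sup>2) \<le> norm (norm (gaussian \<beta> \<xi>))"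
        by (simp add: power2_eq_square mult_left_le)
    qed
  qed measurable
  then show ?thesis by (simp add: L2_def)
qed

text \<open>
  The convolution of a truncation of \<open>w\<close> with a Gaussian is the pairing of its transform with a
  fixed square-integrable function and so tends to zero; it also converges to the convolution
  of \<open>w\<close>.
\<close>

lemma gaussian_conv_zero:
  assumes w: "w \<in> L2 lborel"
    and lim: "((\<lambda>R. \<integral>\<^sup>+\<xi>. ennreal ((norm (truncated_fourier R w \<xi>))\<^sup>2) \<partial>lborel) \<longlongrightarrow> 0) at_top"
    and a: "a > 0"
  shows "(\<integral>y. w y * gaussian (of_real a) (x - y) \<partial>lborel) = 0"
proof -
  \<comment> \<open>the parameter for which \<open>kernel \<epsilon>\<close> is a multiple of \<open>gaussian a\<close>\<close>
  define \<epsilon> where "\<epsilon> = 1 / (4 * a)"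
  have \<epsilon>: "\<epsilon> > 0" "1 / (4 * \<epsilon>) = a" using a by (auto simp: \<epsilon>_def)
  have [measurable]: "w \<in> borel_measurable borel" using w by (auto simp: L2_def)
  let ?g = "\<lambda>y. gaussian (of_real a) (x - y)"
  have g: "?g \<in> L2 lborel"
  proof -
    have "integrable lborel (\<lambda>y. (norm (gaussian (of_real a) y))\<^sup>2)"
      using L2_gaussian[of "of_real a"] a by (simp add: L2_def)
    from integrable_lborel_affine[OF this, of "-1" x] show ?thesis by (simp add: L2_def)
  qed
  have FT: "fourier (trunc R w) \<in> L2 lborel" for R by (intro fourier_L2 trunc_L12 w)
  have "((\<lambda>R. ennreal ((L2_norm lborel (fourier (trunc R w)))\<^sup>2)) \<longlongrightarrow> ennreal 0) at_top"
    using lim unfolding truncated_fourier_eq nn_integral_L2[OF FT] by simp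
  then have "((\<lambda>R. (L2_norm lborel (fourier (trunc R w)))\<^sup>2) \<longlongrightarrow> 0) at_top"
    by (subst (asm) tendsto_ennreal_iff) auto
  from tendsto_real_sqrt[OF this] have L: "((\<lambda>R. L2_norm lborel (fourier (trunc R w))) \<longlongrightarrow> 0) at_top"
    by simp
  let ?c = "of_real (pi / a) :: complex"
  let ?e = "\<lambda>\<xi>. exp (\<i> * of_real (x \<bullet> \<xi>)) * gaussian (of_real \<epsilon>) \<xi>"
  have e: "?e \<in> L2 lborel"
  proof (rule L2_bounded_mult[where C=1])
    show "gaussian (of_real \<epsilon>) \<in> L2 lborel" by (rule L2_gaussian) (use \<epsilon> in simp)
    show "(\<lambda>\<xi>. exp (\<i> * of_real (x \<bullet> \<xi>))) \<in> borel_measurable lborel" by measurable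
  qed simp
  have smooth: "(\<integral>\<xi>. ?e \<xi> * fourier (trunc R w) \<xi> \<partial>lborel)
       = of_real (2 * a) * (\<integral>y. trunc R w y * ?g y \<partial>lborel)" for R
  proof -
    have k: "trunc R w y * kernel (of_real \<epsilon>) (x - y) = of_real (a / pi) * (trunc R w y * ?g y)" for y
      unfolding kernel_eq_gaussian[OF \<epsilon>(1)] \<epsilon>(2) by (simp add: \<epsilon>_def)
    have "(\<integral>\<xi>. ?e \<xi> * fourier (trunc R w) \<xi> \<partial>lborel)
       = 2 * of_real pi * (\<integral>y. trunc R w y * kernel (of_real \<epsilon>) (x - y) \<partial>lborel)"
      using fourier_gaussian_smoothing[OF trunc_L12(2)[OF w] \<epsilon>(1) complex_of_real_def, of x R]
      unfolding mult.assoc[of "exp _"] .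
    then show ?thesis unfolding k integral_mult_right_zero by simp
  qed
  have "((\<lambda>R. \<integral>y. trunc R w y * ?g y \<partial>lborel) \<longlongrightarrow> 0) at_top"
  proof (rule Lim_null_comparison)
    have "norm (of_real (2 * a) * (\<integral>y. trunc R w y * ?g y \<partial>lborel))
       \<le> L2_norm lborel ?e * L2_norm lborel (fourier (trunc R w))" for R
      unfolding smooth[symmetric] by (rule Cauchy_Schwarz_L2[OF e FT])
    then show "\<forall>\<^sub>F R in at_top. norm (\<integral>y. trunc R w y * ?g y \<partial>lborel) \<le> L2_norm lborel ?e / (2 * a) * L2_norm lborel (fourier (trunc R w))"
      using a by (intro always_eventually allI) (simp add: norm_mult field_simps)
    show "((\<lambda>R. L2_norm lborel ?e / (2 * a) * L2_norm lborel (fourier (trunc R w))) \<longlongrightarrow> 0) at_top"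
      by (intro tendsto_mult_right_zero L)
  qed
  moreover have "((\<lambda>R. \<integral>y. trunc R w y * ?g y \<partial>lborel) \<longlongrightarrow> (\<integral>y. w y * ?g y \<partial>lborel)) at_top"
  proof (rule integral_dominated_convergence_at_top[where w="\<lambda>y. norm (w y * ?g y)"])
    show "integrable lborel (\<lambda>y. norm (w y * ?g y))" by (intro integrable_norm integrable_L2_mult w g)
    show "AE y in lborel. ((\<lambda>R. trunc R w y * ?g y) \<longlongrightarrow> w y * ?g y) at_top"
    proof (rule AE_I2)
      fix y
      have "\<forall>\<^sub>F R in at_top. trunc R w y * ?g y = w y * ?g y"
        using eventually_in_square[of y] by eventually_elim (simp add: trunc_def)
      then show "((\<lambda>R. trunc R w y * ?g y) \<longlongrightarrow> w y * ?g y) at_top" by (rule tendsto_eventually)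
    qed
    show "\<forall>\<^sub>F R in at_top. AE y in lborel. norm (trunc R w y * ?g y) \<le> norm (w y * ?g y)"
      by (rule always_eventually) (simp add: trunc_def indicator_def norm_mult)
  qed measurable
  ultimately show ?thesis by (rule tendsto_unique[OF trivial_limit_at_top_linorder, symmetric])
qed

text \<open>
  Gaussian means converge at every point of continuity; the limit carries the mass \<open>\<pi>\<close> of
  \<open>gaussian 1\<close>.
\<close>

lemma gaussian_average_tendsto:
  fixes f :: "real \<times> real \<Rightarrow> real"
  assumes [measurable]: "f \<in> borel_measurable borel" and bd: "\<And>x. \<bar>f x\<bar> \<le> 1" and cont: "isCont f y"
    and c: "\<And>n. c n > 0" "c \<longlonglongrightarrow> 0"
  shows "(\<lambda>n. \<integral>z. f (y + c n *\<^sub>R z) *\<^sub>R gaussian 1 z \<partial>lborel) \<longlonglongrightarrow> of_real (pi * f y)"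
proof -
  have "(\<lambda>n. \<integral>z. f (y + c n *\<^sub>R z) *\<^sub>R gaussian 1 z \<partial>lborel) \<longlonglongrightarrow> (\<integral>z. f y *\<^sub>R gaussian 1 z \<partial>lborel)"
  proof (rule integral_dominated_convergence[where w="\<lambda>z. norm (gaussian 1 z)"])
    show "AE z in lborel. (\<lambda>n. f (y + c n *\<^sub>R z) *\<^sub>R gaussian 1 z) \<longlonglongrightarrow> f y *\<^sub>R gaussian 1 z"
    proof (rule AE_I2)
      fix z
      have "(\<lambda>n. y + c n *\<^sub>R z) \<longlonglongrightarrow> y + 0 *\<^sub>R z" by (intro tendsto_intros c)
      then have "(\<lambda>n. f (y + c n *\<^sub>R z)) \<longlonglongrightarrow> f y"
        by (intro isCont_tendsto_compose[OF cont]) simp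
      then show "(\<lambda>n. f (y + c n *\<^sub>R z) *\<^sub>R gaussian 1 z) \<longlonglongrightarrow> f y *\<^sub>R gaussian 1 z"
        by (intro tendsto_intros)
    qed
    show "AE z in lborel. norm (f (y + c n *\<^sub>R z) *\<^sub>R gaussian 1 z) \<le> norm (gaussian 1 z)" for n
    proof (rule AE_I2)
      fix z show "norm (f (y + c n *\<^sub>R z) *\<^sub>R gaussian 1 z) \<le> norm (gaussian 1 z)"
        using mult_right_mono[OF bd[of "y + c n *\<^sub>R z"], of "norm (gaussian 1 z)"] by simp
    qed
  qed (use integrable_gaussian[of 1] in auto)
  moreover have "(\<integral>z. gaussian 1 z \<partial>lborel) = of_real pi"
    using gaussian_fourier[of 1 1 0 0] by (simp add: complex_eq_iff)
  ultimately show ?thesis by (simp add: scaleR_conv_of_real mult.commute)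
qed

lemma indicator_box_isCont:
  fixes y :: "'a::euclidean_space"
  assumes "y \<notin> cbox a b - box a b"
  shows "isCont (indicator (box a b) :: 'a \<Rightarrow> real) y"
proof (cases "y \<in> box a b")
  case True
  have "\<forall>\<^sub>F z in nhds y. indicator (box a b) z = (1 :: real)"
    using True by (intro eventually_nhds[THEN iffD2] exI[of _ "box a b"]) (auto simp: open_box)
  then show ?thesis
    by (subst isCont_cong[where g="\<lambda>_. 1"]) auto
next
  case False
  then have "y \<in> - cbox a b" using assms box_subset_cbox[of a b] by auto
  then have "\<forall>\<^sub>F z in nhds y. indicator (box a b) z = (0 :: real)"
    by (intro eventually_nhds[THEN iffD2] exI[of _ "- cbox a b"])
       (auto simp: closed_cbox intro!: indicator_simps(2) dest: subsetD[OF box_subset_cbox])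
  then show ?thesis
    by (subst isCont_cong[where g="\<lambda>_. 0"]) auto
qed

lemma AE_not_box_boundary: "AE y in lborel. y \<notin> cbox a b - box (a::'a::euclidean_space) b"
proof -
  have "cbox a b - box a b \<in> null_sets lebesgue"
    using negligible_frontier_interval[of a b] by (simp add: negligible_iff_null_sets)
  then have "cbox a b - box a b \<in> null_sets lborel" by (subst (asm) null_sets_completion_iff) auto
  then show ?thesis by (rule AE_not_in)
qed

text \<open>
  Integrate the vanishing convolution over the box and move the Gaussian to the indicator. The
  resulting Gaussian means of the indicator converge to it off the boundary of the box.
\<close>

lemma box_integral_zero:
  assumes \<gamma>: "integrable lborel \<gamma>"
    and zero: "\<And>a x. a > 0 \<Longrightarrow> (\<integral>y. \<gamma> y * gaussian (of_real a) (x - y) \<partial>lborel) = 0"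
  shows "(\<integral>y. indicator (box a b) y *\<^sub>R \<gamma> y \<partial>lborel) = 0"
proof -
  have [measurable]: "\<gamma> \<in> borel_measurable borel" using \<gamma> by auto
  let ?I = "indicator (box a b) :: real \<times> real \<Rightarrow> real"
  define c where "c n = 1 / real (Suc n)" for n
  have c: "c n > 0" for n by (simp add: c_def)
  have c0: "c \<longlonglongrightarrow> 0" unfolding c_def by (rule LIMSEQ_Suc[OF lim_1_over_n])
  define m where "m n y = (\<integral>z. ?I (y + c n *\<^sub>R z) *\<^sub>R gaussian 1 z \<partial>lborel)" for n y
  have m_meas [measurable]: "m n \<in> borel_measurable borel" for n unfolding m_def by measurable
  have bI: "integrable lborel ?I"
    by (rule integrable_real_indicator) (simp_all add: emeasure_lborel_box_finite[simplified])
  have m_zero: "(\<integral>y. \<gamma> y * m n y \<partial>lborel) = 0" for n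
  proof -
    let ?a = "1 / (c n)\<^sup>2"
    have a: "?a > 0" using c[of n] by simp
    \<comment> \<open>the Gaussian of parameter \<open>1 / c\<^sup>2\<close> is the unit Gaussian dilated by \<open>c\<close>\<close>
    have gs: "gaussian (of_real ?a) (c n *\<^sub>R z) = gaussian 1 z" for z
      using c[of n] by (simp add: gaussian_def power_mult_distrib)
    have meq: "of_real ((c n)\<^sup>2) * m n y = (\<integral>x. ?I x *\<^sub>R gaussian (of_real ?a) (x - y) \<partial>lborel)" for y
    proof -
      have "integrable lborel (\<lambda>x. ?I x *\<^sub>R gaussian (of_real ?a) (x - y))"
      proof (rule Bochner_Integration.integrable_bound[OF bI])
        show "AE x in lborel. norm (?I x *\<^sub>R gaussian (of_real ?a) (x - y)) \<le> norm (?I x)"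
          by (rule AE_I2) (simp add: norm_gaussian mult_left_le)
      qed measurable
      from integral_lborel_affine[OF this, of "c n" y] c[of n] show ?thesis
        unfolding add_diff_cancel_left' gs
        by (simp add: m_def scaleR_conv_of_real power2_eq_square)
    qed
    let ?f = "\<lambda>x y. ?I x *\<^sub>R (\<gamma> y * gaussian (of_real ?a) (x - y))"
    have "integrable (lborel \<Otimes>\<^sub>M lborel) (\<lambda>z. (of_real (?I (fst z)) :: complex) * \<gamma> (snd z))"
      using integrable_lborel_prod_mult(1)[of "\<lambda>x. of_real (?I x)" \<gamma>] bI \<gamma> by (simp add: lborel_prod)
    then have int: "integrable (lborel \<Otimes>\<^sub>M lborel) (case_prod ?f)"
    proof (rule Bochner_Integration.integrable_bound)
      show "AE z in lborel \<Otimes>\<^sub>M lborel. norm (case z of (x, y) \<Rightarrow> ?f x y) \<le> norm ((of_real (?I (fst z)) :: complex) * \<gamma> (snd z))"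
      proof (rule AE_I2, clarify)
        fix x y :: "real \<times> real"
        have "norm (gaussian (of_real ?a) (x - y)) \<le> 1" by (simp add: norm_gaussian)
        then have "\<bar>?I x\<bar> * norm (\<gamma> y) * norm (gaussian (of_real ?a) (x - y)) \<le> \<bar>?I x\<bar> * norm (\<gamma> y) * 1"
          by (rule mult_left_mono) simp
        then show "norm (?f x y) \<le> norm ((of_real (?I (fst (x, y))) :: complex) * \<gamma> (snd (x, y)))"
          by (simp add: norm_mult mult.assoc)
      qed
    qed measurable
    have "of_real ((c n)\<^sup>2) * (\<integral>y. \<gamma> y * m n y \<partial>lborel) = (\<integral>y. \<gamma> y * (of_real ((c n)\<^sup>2) * m n y) \<partial>lborel)"
      by (subst integral_mult_right_zero[symmetric]) (simp only: mult.left_commute)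
    also have "\<dots> = (\<integral>y. (\<integral>x. ?f x y \<partial>lborel) \<partial>lborel)"
      unfolding meq by (subst integral_mult_right_zero[symmetric]) simp
    also have "\<dots> = (\<integral>x. (\<integral>y. ?f x y \<partial>lborel) \<partial>lborel)" by (rule lborel_pair.Fubini_integral[OF int])
    also have "\<dots> = 0" by (simp only: integral_scaleR_right zero[OF a]) simp
    finally show ?thesis using c[of n] by simp
  qed
  have mb: "norm (m n y) \<le> (\<integral>z. norm (gaussian 1 z) \<partial>lborel)" for n y
  proof -
    have "norm (m n y) \<le> (\<integral>z. norm (?I (y + c n *\<^sub>R z) *\<^sub>R gaussian 1 z) \<partial>lborel)"
      unfolding m_def by (rule integral_norm_bound)
    also have "\<dots> \<le> (\<integral>z. norm (gaussian 1 z) \<partial>lborel)"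
    proof (rule integral_mono)
      show g: "integrable lborel (\<lambda>z. norm (gaussian 1 z))" using integrable_gaussian[of 1] by simp
      show "integrable lborel (\<lambda>z. norm (?I (y + c n *\<^sub>R z) *\<^sub>R gaussian 1 z))"
        by (rule Bochner_Integration.integrable_bound[OF g]) (auto simp: indicator_def)
    qed (simp add: indicator_def)
    finally show ?thesis .
  qed
  have "(\<lambda>n. \<integral>y. \<gamma> y * m n y \<partial>lborel) \<longlonglongrightarrow> (\<integral>y. \<gamma> y * of_real (pi * ?I y) \<partial>lborel)"
  proof (rule integral_dominated_convergence[where w="\<lambda>y. norm (\<gamma> y) * (\<integral>z. norm (gaussian 1 z) \<partial>lborel)"])
    show "AE y in lborel. (\<lambda>n. \<gamma> y * m n y) \<longlonglongrightarrow> \<gamma> y * of_real (pi * ?I y)"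
      using AE_not_box_boundary[of a b]
    proof eventually_elim
      case (elim y)
      show ?case unfolding m_def
        by (intro tendsto_mult tendsto_const gaussian_average_tendsto c c0 indicator_box_isCont[OF elim])
           (auto simp: indicator_def)
    qed
    show "AE y in lborel. norm (\<gamma> y * m n y) \<le> norm (\<gamma> y) * (\<integral>z. norm (gaussian 1 z) \<partial>lborel)" for n
      unfolding norm_mult by (intro AE_I2 mult_left_mono mb) simp
  qed (use \<gamma> in \<open>auto intro!: integrable_mult_left\<close>)
  then have "(\<integral>y. \<gamma> y * of_real (pi * ?I y) \<partial>lborel) = 0"
    unfolding m_zero by (simp add: LIMSEQ_const_iff)
  moreover have "\<gamma> y * of_real (pi * ?I y) = pi *\<^sub>R (?I y *\<^sub>R \<gamma> y)" for y
    by (simp add: scaleR_conv_of_real)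
  ultimately have "pi *\<^sub>R (\<integral>y. ?I y *\<^sub>R \<gamma> y \<partial>lborel) = 0" by (simp only: integral_scaleR_right)
  then show ?thesis by simp
qed

text \<open>
  The boxes are stable under intersection and generate the Borel sets, so the integral over every
  Borel set vanishes.
\<close>

lemma AE_zero_if_box_integrals_zero:
  fixes \<gamma> :: "'a::euclidean_space \<Rightarrow> complex"
  assumes \<gamma>: "integrable lborel \<gamma>"
    and zero: "\<And>a b. (\<integral>y. indicator (box a b) y *\<^sub>R \<gamma> y \<partial>lborel) = 0"
  shows "AE y in lborel. \<gamma> y = 0"
proof (rule sigma_finite_measure.density_zero[OF sigma_finite_lborel \<gamma>])
  have [measurable]: "\<gamma> \<in> borel_measurable borel" using \<gamma> by auto
  let ?J = "\<lambda>A. \<integral>y. indicator A y *\<^sub>R \<gamma> y \<partial>lborel"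
  have total: "(\<integral>y. \<gamma> y \<partial>lborel) = 0"
  proof -
    let ?B = "\<lambda>n. box (- (real n *\<^sub>R One)) (real n *\<^sub>R One :: 'a)"
    have "(\<lambda>n. ?J (?B n)) \<longlonglongrightarrow> (\<integral>y. \<gamma> y \<partial>lborel)"
    proof (rule integral_dominated_convergence[where w="\<lambda>y. norm (\<gamma> y)"])
      show "AE y in lborel. (\<lambda>n. indicator (?B n) y *\<^sub>R \<gamma> y) \<longlonglongrightarrow> \<gamma> y"
      proof (rule AE_I2)
        fix y :: 'a
        obtain N :: nat where N: "norm y < real N" using reals_Archimedean2 by blast
        have "indicator (?B n) y *\<^sub>R \<gamma> y = \<gamma> y" if "n \<ge> N" for n
        proof -
          have "y \<in> ?B n"
          proof (unfold mem_box, intro ballI)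
            fix i :: 'a assume i: "i \<in> Basis"
            have "\<bar>y \<bullet> i\<bar> < real n" using Basis_le_norm[OF i, of y] N that by linarith
            then show "- (real n *\<^sub>R One) \<bullet> i < y \<bullet> i \<and> y \<bullet> i < real n *\<^sub>R One \<bullet> i" using i by (auto simp: abs_less_iff)
          qed
          then show ?thesis by simp
        qed
        then have "\<forall>\<^sub>F n in sequentially. indicator (?B n) y *\<^sub>R \<gamma> y = \<gamma> y"
          unfolding eventually_sequentially by blast
        then show "(\<lambda>n. indicator (?B n) y *\<^sub>R \<gamma> y) \<longlonglongrightarrow> \<gamma> y" by (rule tendsto_eventually)
      qed
      show "AE y in lborel. norm (indicator (?B n) y *\<^sub>R \<gamma> y) \<le> norm (\<gamma> y)" for n
        by (rule AE_I2) (simp add: indicator_def)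
    qed (use \<gamma> in auto)
    then show ?thesis unfolding zero by (simp add: LIMSEQ_const_iff)
  qed
  fix A :: "'a set" assume "A \<in> sets lborel"
  then have A: "A \<in> sigma_sets UNIV (range (\<lambda>(a, b). box a b))"
    by (simp add: borel_eq_box)
  have st: "Int_stable (range (\<lambda>(a, b). box a b :: 'a set))"
    by (auto simp: Int_stable_def box_Int_box image_iff)
  have sb: "B \<in> sets borel" if "B \<in> sigma_sets UNIV (range (\<lambda>(a, b). box a b :: 'a set))" for B
    using that by (simp add: borel_eq_box)
  have int: "integrable lborel (\<lambda>y. indicator B y *\<^sub>R \<gamma> y)" if "B \<in> sets borel" for B
    using that \<gamma> by (intro integrable_mult_indicator) auto
  have sp: "range (\<lambda>(a, b). box a b :: 'a set) \<subseteq> Pow UNIV" by simp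
  have "?J A = 0"
    using st sp A
  proof (induction rule: sigma_sets_induct_disjoint)
    case (basic A) then show ?case using zero by auto
  next
    case (compl A)
    have "?J (UNIV - A) = (\<integral>y. \<gamma> y - indicator A y *\<^sub>R \<gamma> y \<partial>lborel)"
      by (intro Bochner_Integration.integral_cong) (auto simp: indicator_def)
    also have "\<dots> = 0" using compl total int[OF sb[OF compl(1)]] \<gamma> by simp
    finally show ?case .
  next
    case (union A)
    have "(LINT y:(\<Union>i. A i)|lborel. \<gamma> y) = (\<Sum>i. (LINT y:(A i)|lborel. \<gamma> y))"
    proof (rule lebesgue_integral_countable_add)
      show "A i \<in> sets lborel" for i using union(2) sb by (auto simp: subset_eq)
      show "A i \<inter> A j = {}" if "i \<noteq> j" for i j using union(1) that by (auto simp: disjoint_family_on_def)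
      show "set_integrable lborel (\<Union> (range A)) \<gamma>" unfolding set_integrable_def
        by (rule int) (use union(2) sb in auto)
    qed
    then show ?case using union(3) by (simp add: set_lebesgue_integral_def)
  qed simp_all
  then show "set_lebesgue_integral lborel A \<gamma> = 0" by (simp add: set_lebesgue_integral_def)
qed

text \<open>
  All convolutions of \<open>w\<close> with Gaussians vanish, but \<open>w\<close> need not be integrable. Its product with
  one fixed Gaussian is, and by completing the square the convolutions of this product with
  Gaussians are multiples of convolutions of \<open>w\<close> with narrower ones.
\<close>

lemma AE_zero_if_fourier_zero:
  assumes w: "w \<in> L2 lborel"
    and lim: "((\<lambda>R. \<integral>\<^sup>+\<xi>. ennreal ((norm (truncated_fourier R w \<xi>))\<^sup>2) \<partial>lborel) \<longlongrightarrow> 0) at_top"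
  shows "AE x in lborel. w x = 0"
proof -
  have [measurable]: "w \<in> borel_measurable borel" using w by (auto simp: L2_def)
  define \<gamma> where "\<gamma> y = w y * gaussian 1 y" for y
  have \<gamma>: "integrable lborel \<gamma>"
    unfolding \<gamma>_def by (rule integrable_L2_mult[OF w L2_gaussian]) simp
  have "(\<integral>y. \<gamma> y * gaussian (of_real a) (x - y) \<partial>lborel) = 0" if a: "a > 0" for a x
  proof -
    define x' where "x' = (a / (1 + a)) *\<^sub>R x"
    define K where "K = a / (1 + a) * (norm x)\<^sup>2"
    have ex: "(norm y)\<^sup>2 + a * (norm (x - y))\<^sup>2 = K + (1 + a) * (norm (x' - y))\<^sup>2" for y
    proof -
      have 1: "(norm (x - y))\<^sup>2 = x \<bullet> x - 2 * (x \<bullet> y) + y \<bullet> y"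
        by (simp add: power2_norm_eq_inner inner_diff_left inner_diff_right inner_commute)
      have "(norm (s *\<^sub>R x - y))\<^sup>2 = s\<^sup>2 * (x \<bullet> x) - 2 * s * (x \<bullet> y) + y \<bullet> y" for s
        unfolding power2_norm_eq_inner inner_diff_left inner_diff_right inner_scaleR_left inner_scaleR_right
        by (simp add: inner_commute power2_eq_square algebra_simps)
      then have 2: "(norm (x' - y))\<^sup>2 = (a / (1 + a))\<^sup>2 * (x \<bullet> x) - 2 * (a / (1 + a)) * (x \<bullet> y) + y \<bullet> y"
        unfolding x'_def .
      have s: "(1 + a) * (a / (1 + a)) = a" using a by simp
      have "r + a * (p - 2 * q + r) = s * p + (1 + a) * (s\<^sup>2 * p - 2 * s * q + r)" if "(1 + a) * s = a" for p q r s :: real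
      proof -
        have "s * p + (1 + a) * (s\<^sup>2 * p - 2 * s * q + r) = s * p + ((1 + a) * s) * (s * p) - 2 * ((1 + a) * s) * q + (1 + a) * r"
          by (simp add: algebra_simps power2_eq_square)
        also have "\<dots> = ((1 + a) * s) * p - 2 * a * q + (1 + a) * r" by (subst that, subst that) (simp add: algebra_simps)
        finally show ?thesis unfolding that by (simp add: algebra_simps)
      qed
      from this[OF s] show ?thesis
        unfolding 1 2 K_def unfolding power2_norm_eq_inner .
    qed
    have "\<gamma> y * gaussian (of_real a) (x - y) = of_real (exp (- K)) * (w y * gaussian (of_real (1 + a)) (x' - y))" for y
    proof -
      have "gaussian 1 y * gaussian (of_real a) (x - y) = of_real (exp (- ((norm y)\<^sup>2 + a * (norm (x - y))\<^sup>2)))"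
        by (simp add: gaussian_def exp_add[symmetric] exp_of_real[symmetric])
      also have "\<dots> = of_real (exp (- K)) * gaussian (of_real (1 + a)) (x' - y)"
        unfolding ex minus_add_distrib exp_add of_real_mult by (simp add: gaussian_def exp_of_real[symmetric] algebra_simps)
      finally show ?thesis by (simp add: \<gamma>_def mult_ac)
    qed
    then show ?thesis
      using gaussian_conv_zero[OF w lim, of "1 + a" x'] a by (simp del: of_real_add)
  qed
  then have "AE y in lborel. \<gamma> y = 0"
    by (intro AE_zero_if_box_integrals_zero[OF \<gamma>] box_integral_zero[OF \<gamma>])
  then show ?thesis by eventually_elim (simp add: \<gamma>_def gaussian_def)
qed

lemma is_fourier_L2_unique:
  assumes v: "is_fourier_L2 v V" and v': "is_fourier_L2 v' V'" and eq: "AE \<xi> in lborel. V \<xi> = V' \<xi>"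
  shows "AE x in lborel. v x = v' x"
proof -
  have L: "v \<in> L2 lborel" "v' \<in> L2 lborel" "V \<in> L2 lborel" "V' \<in> L2 lborel"
    using v v' by (auto simp: is_fourier_L2_def)
  have [measurable]: "v \<in> borel_measurable borel" "v' \<in> borel_measurable borel" "V \<in> borel_measurable borel" "V' \<in> borel_measurable borel"
    using L by (auto simp: L2_def)
  let ?w = "\<lambda>x. v x - v' x"
  have w: "?w \<in> L2 lborel" by (rule L2_diff[OF L(1,2)])
  let ?A = "\<lambda>R. \<integral>\<^sup>+\<xi>. ennreal ((norm (truncated_fourier R v \<xi> - V \<xi>))\<^sup>2) \<partial>lborel"
  let ?B = "\<lambda>R. \<integral>\<^sup>+\<xi>. ennreal ((norm (truncated_fourier R v' \<xi> - V' \<xi>))\<^sup>2) \<partial>lborel"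
  have le: "(\<integral>\<^sup>+\<xi>. ennreal ((norm (truncated_fourier R ?w \<xi>))\<^sup>2) \<partial>lborel) \<le> 2 * ?A R + 2 * ?B R" for R
  proof -
    have t: "truncated_fourier R ?w \<xi> = truncated_fourier R v \<xi> - truncated_fourier R v' \<xi>" for \<xi>
    proof -
      have "trunc R ?w = (\<lambda>x. trunc R v x - trunc R v' x)" by (simp add: trunc_def fun_eq_iff scaleR_diff_right)
      then show ?thesis unfolding truncated_fourier_eq by (simp add: fourier_diff trunc_L12 L)
    qed
    have "(\<integral>\<^sup>+\<xi>. ennreal ((norm (truncated_fourier R ?w \<xi>))\<^sup>2) \<partial>lborel)
      \<le> (\<integral>\<^sup>+\<xi>. 2 * ennreal ((norm (truncated_fourier R v \<xi> - V \<xi>))\<^sup>2) + 2 * ennreal ((norm (truncated_fourier R v' \<xi> - V' \<xi>))\<^sup>2) \<partial>lborel)"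
    proof (rule nn_integral_mono_AE, use eq in eventually_elim)
      fix \<xi> assume e: "V \<xi> = V' \<xi>"
      let ?p = "truncated_fourier R v \<xi> - V \<xi>" and ?q = "truncated_fourier R v' \<xi> - V' \<xi>"
      have "(norm (truncated_fourier R ?w \<xi>))\<^sup>2 = (norm (?p - ?q))\<^sup>2" by (simp add: t e)
      also have "\<dots> \<le> (norm ?p + norm ?q)\<^sup>2" by (intro power_mono norm_triangle_ineq4) simp
      also have "\<dots> \<le> 2 * (norm ?p)\<^sup>2 + 2 * (norm ?q)\<^sup>2"
        using sum_squares_bound[of "norm ?p" "norm ?q"] by (simp add: power2_sum)
      finally show "ennreal ((norm (truncated_fourier R ?w \<xi>))\<^sup>2) \<le> 2 * ennreal ((norm ?p)\<^sup>2) + 2 * ennreal ((norm ?q)\<^sup>2)"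
        by (simp add: ennreal_mult[symmetric] ennreal_plus[symmetric] ennreal_leI del: ennreal_plus flip: ennreal_numeral)
    qed
    also have "\<dots> = 2 * ?A R + 2 * ?B R"
      unfolding truncated_fourier_eq by (subst nn_integral_add) (auto simp: nn_integral_cmult)
    finally show ?thesis .
  qed
  have "((\<lambda>R. 2 * ?A R + 2 * ?B R) \<longlongrightarrow> 2 * 0 + 2 * 0) at_top"
    using v v' by (intro tendsto_add ennreal_tendsto_cmult) (auto simp: is_fourier_L2_def)
  then have l0: "((\<lambda>R. 2 * ?A R + 2 * ?B R) \<longlongrightarrow> 0) at_top" by simp
  have "((\<lambda>R. \<integral>\<^sup>+\<xi>. ennreal ((norm (truncated_fourier R ?w \<xi>))\<^sup>2) \<partial>lborel) \<longlongrightarrow> 0) at_top"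
    by (rule tendsto_sandwich[OF always_eventually always_eventually tendsto_const l0]) (use le in auto)
  from AE_zero_if_fourier_zero[OF w this] show ?thesis by eventually_elim simp
qed

text \<open>
  The convolution with the Fresnel kernel has the required transform, and a square-integrable
  function is determined by its transform up to a null set.
\<close>

lemma is_fresnel_L2_characterization:
  assumes Fr: "Fr > 0" and u: "u \<in> L2 lborel" and supp: "\<And>x. x \<notin> cbox (-R0, -R0) (R0, R0) \<Longrightarrow> u x = 0"
  shows "is_fresnel_L2 Fr u (fresnel_conv (pi / (2 * Fr)) u)"
    and "is_fresnel_L2 Fr u v \<Longrightarrow> AE x in lborel. v x = fresnel_conv (pi / (2 * Fr)) u x"
proof -
  let ?b = "pi / (2 * Fr)"
  have b: "?b \<noteq> 0" using Fr by simp
  have m: "fresnel_multiplier Fr \<xi> = gaussian (\<i> * of_real ?b) \<xi>" for \<xi>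
    by (simp add: fresnel_multiplier_def gaussian_def mult.assoc)
  have F: "integrable lborel u" "is_fourier_L2 u (fourier u)"
    "\<And>U. is_fourier_L2 u U \<Longrightarrow> AE \<xi> in lborel. U \<xi> = fourier u \<xi>"
    using is_fourier_L2_bounded_support[OF u supp] by auto
  have N: "is_fourier_L2 (fresnel_conv ?b u) (\<lambda>\<xi>. fresnel_multiplier Fr \<xi> * fourier u \<xi>)"
    unfolding m by (rule is_fourier_L2_fresnel_conv[OF b F(1) u])
  then show "is_fresnel_L2 Fr u (fresnel_conv ?b u)" using F(2) unfolding is_fresnel_L2_def by blast
  assume "is_fresnel_L2 Fr u v"
  then obtain U where U: "is_fourier_L2 u U" "is_fourier_L2 v (\<lambda>\<xi>. fresnel_multiplier Fr \<xi> * U \<xi>)"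
    unfolding is_fresnel_L2_def by blast
  show "AE x in lborel. v x = fresnel_conv ?b u x"
    by (rule is_fourier_L2_unique[OF U(2) N]) (use F(3)[OF U(1)] in eventually_elim, simp)
qed

section \<open>Slicewise propagation\<close>

definition slice :: "(real \<times> real) set \<Rightarrow> ((real \<times> real) \<times> real \<Rightarrow> complex) \<Rightarrow> real \<Rightarrow> real \<times> real \<Rightarrow> complex" where
  "slice \<Omega>' u \<theta> x = (if x \<in> \<Omega>' then u (x, \<theta>) else 0)"

lemma slice_measurable:
  assumes [measurable]: "\<Omega>' \<in> sets borel" "u \<in> borel_measurable borel"
  shows "slice \<Omega>' u \<theta> \<in> borel_measurable borel" "(\<lambda>q. slice \<Omega>' u (snd q) (fst q)) \<in> borel_measurable borel"
proof -
  have u: "u \<in> borel_measurable (borel \<Otimes>\<^sub>M borel)" using assms(2) by (simp add: borel_prod)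
  note [measurable] = u
  show "slice \<Omega>' u \<theta> \<in> borel_measurable borel" unfolding slice_def by measurable
  have "(\<lambda>q. slice \<Omega>' u (snd q) (fst q)) \<in> borel_measurable (borel \<Otimes>\<^sub>M borel)" unfolding slice_def by measurable
  then show "(\<lambda>q. slice \<Omega>' u (snd q) (fst q)) \<in> borel_measurable borel" by (simp add: borel_prod)
qed

text \<open>
  The convolutions of the slices form a jointly measurable function, so the description by which
  \<open>fresnel\<close> is chosen is satisfiable. By uniqueness the chosen function agrees with them for
  almost every angle and then almost everywhere in the slice; joint measurability turns this into
  a single null set of the product.
\<close>

lemma fresnel_eq_conv:
  assumes Fr: "Fr > 0" and \<Omega>': "open \<Omega>'" "bounded \<Omega>'" and u: "u \<in> borel_measurable borel"
    and sl: "\<And>\<theta>. \<theta> \<in> {0..<pi} \<Longrightarrow> slice \<Omega>' u \<theta> \<in> L2 lborel"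
  shows "fresnel Fr \<Omega>' u \<in> borel_measurable borel"
    and "AE q in detector_measure \<Omega>'. fresnel Fr \<Omega>' u q = fresnel_conv (pi / (2 * Fr)) (slice \<Omega>' u (snd q)) (fst q)"
proof -
  let ?b = "pi / (2 * Fr)"
  have O [measurable]: "\<Omega>' \<in> sets borel" using \<Omega>'(1) by simp
  have u' [measurable]: "u \<in> borel_measurable (borel \<Otimes>\<^sub>M borel)" using u by (simp add: borel_prod)
  obtain R1 where R1: "\<Omega>' \<subseteq> cbox (- R1, - R1) (R1, R1)"
  proof -
    obtain B where B: "\<And>x. x \<in> \<Omega>' \<Longrightarrow> norm x \<le> B" using \<Omega>'(2) by (auto simp: bounded_iff)
    have "\<bar>fst x\<bar> \<le> B \<and> \<bar>snd x\<bar> \<le> B" if "x \<in> \<Omega>'" for x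
      using B[OF that] norm_fst_le[of "fst x" "snd x"] norm_snd_le[of "snd x" "fst x"] by auto
    then show ?thesis using that[of B] by (auto simp: subset_eq mem_cbox_square)
  qed
  have supp: "slice \<Omega>' u \<theta> x = 0" if "x \<notin> cbox (- R1, - R1) (R1, R1)" for \<theta> x
    using that R1 by (auto simp: slice_def)
  define v0 where "v0 q = fresnel_conv ?b (slice \<Omega>' u (snd q)) (fst q)" for q
  have v0m: "v0 \<in> borel_measurable borel"
  proof -
    have "v0 \<in> borel_measurable (borel \<Otimes>\<^sub>M borel)"
      unfolding v0_def fresnel_conv_def slice_def by measurable
    then show ?thesis by (simp add: borel_prod)
  qed
  let ?P = "\<lambda>v. v \<in> borel_measurable borel \<and> (AE \<theta> in lborel. \<theta> \<in> {0..<pi} \<longrightarrow>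
        is_fresnel_L2 Fr (\<lambda>x. if x \<in> \<Omega>' then u (x, \<theta>) else 0) (\<lambda>x. v (x, \<theta>)))"
  have sl_eq: "(\<lambda>x. if x \<in> \<Omega>' then u (x, \<theta>) else 0) = slice \<Omega>' u \<theta>" for \<theta> by (simp add: slice_def fun_eq_iff)
  have "?P v0"
  proof (intro conjI v0m AE_I2 impI)
    fix \<theta> :: real assume "\<theta> \<in> {0..<pi}"
    from is_fresnel_L2_characterization(1)[OF Fr sl[OF this] supp]
    show "is_fresnel_L2 Fr (\<lambda>x. if x \<in> \<Omega>' then u (x, \<theta>) else 0) (\<lambda>x. v0 (x, \<theta>))"
      unfolding sl_eq v0_def fst_conv snd_conv .
  qed
  then have P: "?P (fresnel Fr \<Omega>' u)" unfolding fresnel_def by (rule someI[of ?P])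
  then show vm: "fresnel Fr \<Omega>' u \<in> borel_measurable borel" by blast
  let ?v = "fresnel Fr \<Omega>' u"
  have ae: "AE \<theta> in lborel. AE x in lborel. \<theta> \<in> {0..<pi} \<longrightarrow> ?v (x, \<theta>) = v0 (x, \<theta>)"
    using P[THEN conjunct2]
  proof eventually_elim
    case (elim \<theta>)
    show ?case
    proof (cases "\<theta> \<in> {0..<pi}")
      case True
      then have "is_fresnel_L2 Fr (slice \<Omega>' u \<theta>) (\<lambda>x. ?v (x, \<theta>))" using elim unfolding sl_eq by blast
      then have "AE x in lborel. ?v (x, \<theta>) = fresnel_conv ?b (slice \<Omega>' u \<theta>) x"
        using is_fresnel_L2_characterization(2)[OF Fr sl[OF True] supp] by blast
      then show ?thesis by eventually_elim (simp add: v0_def)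
    qed (simp only: simp_thms, simp)
  qed
  have [measurable]: "?v \<in> borel_measurable (borel \<Otimes>\<^sub>M borel)" "v0 \<in> borel_measurable (borel \<Otimes>\<^sub>M borel)"
    using vm v0m by (simp_all add: borel_prod)
  have meas: "{z \<in> space (lborel \<Otimes>\<^sub>M lborel). snd z \<in> {0..<pi} \<longrightarrow> ?v (fst z, snd z) = v0 (fst z, snd z)} \<in> sets (lborel \<Otimes>\<^sub>M lborel)"
    by measurable
  have "AE z in lborel \<Otimes>\<^sub>M lborel. snd z \<in> {0..<pi} \<longrightarrow> ?v (fst z, snd z) = v0 (fst z, snd z)"
  proof (rule lborel_pair.AE_pair_measure[OF meas])
    show "AE x in lborel. AE y in lborel. snd (x, y) \<in> {0..<pi} \<longrightarrow> ?v (fst (x, y), snd (x, y)) = v0 (fst (x, y), snd (x, y))"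
      using iffD2[OF lborel_pair.AE_commute[of "\<lambda>x \<theta>. \<theta> \<in> {0..<pi} \<longrightarrow> ?v (x, \<theta>) = v0 (x, \<theta>)", OF meas] ae]
      unfolding fst_conv snd_conv .
  qed
  then have "AE z in lborel. snd z \<in> {0..<pi} \<longrightarrow> ?v z = v0 z" unfolding prod.collapse lborel_prod .
  moreover have "\<Omega>' \<times> {0..<pi} \<in> sets lborel" by (simp add: borel_Times)
  ultimately show "AE q in detector_measure \<Omega>'. fresnel Fr \<Omega>' u q = fresnel_conv ?b (slice \<Omega>' u (snd q)) (fst q)"
    unfolding detector_measure_def by (subst AE_restrict_space_iff) (auto simp: v0_def elim!: AE_mp)
qed

section \<open>Projections along rays\<close>

definition zero_ext :: "'a set \<Rightarrow> ('a \<Rightarrow> complex) \<Rightarrow> 'a \<Rightarrow> complex" where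
  "zero_ext \<Omega> f p = (if p \<in> \<Omega> then f p else 0)"

text \<open>
  The point at depth \<open>z\<close> on the ray that hits the detector at \<open>x\<close> under the angle \<open>\<theta>\<close>.
\<close>

definition ray :: "real \<Rightarrow> real \<times> real \<Rightarrow> real \<Rightarrow> real \<times> real \<times> real" where
  "ray \<theta> x z = (fst x * cos \<theta> - z * sin \<theta>, snd x, fst x * sin \<theta> + z * cos \<theta>)"

lemma projection_eq: "projection \<Omega> f q = (\<integral>z. zero_ext \<Omega> f (ray (snd q) (fst q) z) \<partial>lborel)"
proof -
  obtain x y \<theta> where q: "q = ((x, y), \<theta>)" by (metis prod.collapse)
  show ?thesis unfolding q projection.simps rotated.simps by (simp add: zero_ext_def ray_def)
qed

lemma L2_zero_ext:
  assumes \<Omega>: "open \<Omega>" and f: "f \<in> L2 (object_measure \<Omega>)"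
  shows "zero_ext \<Omega> f \<in> L2 lborel" "L2_norm lborel (zero_ext \<Omega> f) = L2_norm (object_measure \<Omega>) f"
proof -
  have \<Omega>s: "\<Omega> \<inter> space lborel \<in> sets lborel" using \<Omega> by simp
  have e: "zero_ext \<Omega> f = (\<lambda>x. indicator \<Omega> x *\<^sub>R f x)" by (auto simp: zero_ext_def fun_eq_iff indicator_def)
  have e2: "(norm (indicator \<Omega> x *\<^sub>R f x))\<^sup>2 = indicator \<Omega> x *\<^sub>R (norm (f x))\<^sup>2" for x
    by (auto simp: indicator_def)
  have "f \<in> borel_measurable (restrict_space lborel \<Omega>)" "integrable (restrict_space lborel \<Omega>) (\<lambda>x. (norm (f x))\<^sup>2)"
    using f by (auto simp: L2_def object_measure_def)
  then show "zero_ext \<Omega> f \<in> L2 lborel"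
    unfolding e L2_def mem_Collect_eq e2
    by (simp add: borel_measurable_restrict_space_iff[OF \<Omega>s] integrable_restrict_space[OF \<Omega>s] set_integrable_def)
  show "L2_norm lborel (zero_ext \<Omega> f) = L2_norm (object_measure \<Omega>) f"
    unfolding e L2_norm_def e2 object_measure_def integral_restrict_space[OF \<Omega>s] set_lebesgue_integral_def ..
qed

text \<open>
  Invariance under a rotation by one-dimensional substitutions only. For fixed \<open>x\<close> the variable
  \<open>z\<close> is replaced by the first rotated coordinate \<open>p\<close>, and after an exchange of the integrals
  \<open>x\<close> is replaced by the second one, \<open>(x - c p) / s\<close>. The two Jacobians \<open>1 / |s|\<close> and \<open>|s|\<close> cancel.
  Angles in \<open>[0, \<pi>)\<close> have \<open>s = 0\<close> only for the identity.
\<close>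

lemma nn_integral_rotation:
  fixes g :: "real \<times> real \<Rightarrow> ennreal"
  assumes g: "g \<in> borel_measurable borel" and cs: "c\<^sup>2 + s\<^sup>2 = 1" "s \<noteq> 0 \<or> c = 1"
  shows "(\<integral>\<^sup>+x. (\<integral>\<^sup>+z. g (x * c - z * s, x * s + z * c) \<partial>lborel) \<partial>lborel) = (\<integral>\<^sup>+p. (\<integral>\<^sup>+q. g (p, q) \<partial>lborel) \<partial>lborel)"
proof (cases "s = 0")
  case True
  then show ?thesis using cs by simp
next
  case s: False
  have [measurable]: "g \<in> borel_measurable (borel \<Otimes>\<^sub>M borel)" using g by (simp add: borel_prod)
  have 1: "ennreal \<bar>s\<bar> * (\<integral>\<^sup>+z. g (x * c - z * s, x * s + z * c) \<partial>lborel) = (\<integral>\<^sup>+p. g (p, (x - c * p) / s) \<partial>lborel)" for x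
  proof -
    have "(x - c * (x * c + - s * z)) / s = x * s + z * c" for z
    proof -
      have "x - c * (x * c + - s * z) = x * (1 - c\<^sup>2) + c * s * z" by (simp add: algebra_simps power2_eq_square)
      also have "1 - c\<^sup>2 = s\<^sup>2" using cs by simp
      finally show ?thesis using s by (simp add: field_simps power2_eq_square)
    qed
    then show ?thesis
      using nn_integral_real_affine[of "\<lambda>p. g (p, (x - c * p) / s)" "- s" "x * c"] s by (simp add: mult.commute)
  qed
  have 2: "(\<integral>\<^sup>+x. g (p, (x - c * p) / s) \<partial>lborel) = ennreal \<bar>s\<bar> * (\<integral>\<^sup>+q. g (p, q) \<partial>lborel)" for p
  proof -
    have "(c * p + s * q - c * p) / s = q" for q using s by simp
    then show ?thesis
      using nn_integral_real_affine[of "\<lambda>x. g (p, (x - c * p) / s)" s "c * p"] s by simp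
  qed
  have "ennreal \<bar>s\<bar> * (\<integral>\<^sup>+x. (\<integral>\<^sup>+z. g (x * c - z * s, x * s + z * c) \<partial>lborel) \<partial>lborel)
     = (\<integral>\<^sup>+x. (\<integral>\<^sup>+p. g (p, (x - c * p) / s) \<partial>lborel) \<partial>lborel)"
    by (subst nn_integral_cmult[symmetric]) (simp_all add: 1)
  also have "\<dots> = (\<integral>\<^sup>+p. (\<integral>\<^sup>+x. g (p, (x - c * p) / s) \<partial>lborel) \<partial>lborel)"
    by (rule lborel_pair.Fubini') measurable
  also have "\<dots> = ennreal \<bar>s\<bar> * (\<integral>\<^sup>+p. (\<integral>\<^sup>+q. g (p, q) \<partial>lborel) \<partial>lborel)"
    by (simp add: 2 nn_integral_cmult)
  finally show ?thesis using s by (simp add: ennreal_mult_cancel_left)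
qed

lemma nn_integral_ray:
  fixes g :: "real \<times> real \<times> real \<Rightarrow> ennreal"
  assumes g: "g \<in> borel_measurable borel" and \<theta>: "\<theta> \<in> {0..<pi}"
  shows "(\<integral>\<^sup>+x. (\<integral>\<^sup>+z. g (ray \<theta> x z) \<partial>lborel) \<partial>lborel) = (\<integral>\<^sup>+p. g p \<partial>lborel)"
proof -
  have [measurable]: "g \<in> borel_measurable (borel \<Otimes>\<^sub>M (borel \<Otimes>\<^sub>M borel))" using g by (simp add: borel_prod)
  have cs: "(cos \<theta>)\<^sup>2 + (sin \<theta>)\<^sup>2 = 1" "sin \<theta> \<noteq> 0 \<or> cos \<theta> = 1"
    using \<theta> sin_gt_zero[of \<theta>] by (auto simp: le_less)
  have "(\<integral>\<^sup>+x. (\<integral>\<^sup>+z. g (ray \<theta> x z) \<partial>lborel) \<partial>lborel) = (\<integral>\<^sup>+x. (\<integral>\<^sup>+z. g (ray \<theta> x z) \<partial>lborel) \<partial>(lborel \<Otimes>\<^sub>M lborel))"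
    by (simp add: lborel_prod)
  also have "\<dots> = (\<integral>\<^sup>+y. (\<integral>\<^sup>+x. (\<integral>\<^sup>+z. g (ray \<theta> (x, y) z) \<partial>lborel) \<partial>lborel) \<partial>lborel)"
    by (rule lborel_pair.nn_integral_snd[symmetric]) (unfold ray_def, measurable)
  also have "\<dots> = (\<integral>\<^sup>+y. (\<integral>\<^sup>+p. (\<integral>\<^sup>+q. g (p, y, q) \<partial>lborel) \<partial>lborel) \<partial>lborel)"
  proof (rule nn_integral_cong)
    fix y :: real
    have "(\<lambda>(p, q). g (p, y, q)) \<in> borel_measurable (borel \<Otimes>\<^sub>M borel)" by measurable
    then have "(\<lambda>(p, q). g (p, y, q)) \<in> borel_measurable borel" by (simp add: borel_prod)
    from nn_integral_rotation[OF this cs]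
    show "(\<integral>\<^sup>+x. (\<integral>\<^sup>+z. g (ray \<theta> (x, y) z) \<partial>lborel) \<partial>lborel) = (\<integral>\<^sup>+p. (\<integral>\<^sup>+q. g (p, y, q) \<partial>lborel) \<partial>lborel)"
      by (simp add: ray_def)
  qed
  also have "\<dots> = (\<integral>\<^sup>+p. (\<integral>\<^sup>+y. (\<integral>\<^sup>+q. g (p, y, q) \<partial>lborel) \<partial>lborel) \<partial>lborel)"
    by (rule lborel_pair.Fubini') measurable
  also have "\<dots> = (\<integral>\<^sup>+p. (\<integral>\<^sup>+r. g (p, r) \<partial>(lborel \<Otimes>\<^sub>M lborel)) \<partial>lborel)"
    by (intro nn_integral_cong lborel.nn_integral_fst) measurable
  also have "\<dots> = (\<integral>\<^sup>+p. g p \<partial>(lborel \<Otimes>\<^sub>M (lborel \<Otimes>\<^sub>M lborel)))"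
    unfolding lborel_prod[where 'a=real and 'b=real] by (rule lborel.nn_integral_fst) (simp add: lborel_prod g)
  also have "\<dots> = (\<integral>\<^sup>+p. g p \<partial>lborel)" by (simp add: lborel_prod)
  finally show ?thesis .
qed

lemma ray_measurable:
  assumes g: "g \<in> borel_measurable borel"
  shows "(\<lambda>z. g (ray \<theta> x z)) \<in> borel_measurable borel"
    "(\<lambda>(x, z). g (ray \<theta> x z)) \<in> borel_measurable (borel \<Otimes>\<^sub>M borel)"
    "(\<lambda>(q, z). g (ray (snd q) (fst q) z)) \<in> borel_measurable (borel \<Otimes>\<^sub>M borel)"
proof -
  have [measurable]: "g \<in> borel_measurable (borel \<Otimes>\<^sub>M (borel \<Otimes>\<^sub>M borel))" using g by (simp add: borel_prod)
  show "(\<lambda>z. g (ray \<theta> x z)) \<in> borel_measurable borel" unfolding ray_def by measurable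
  have "(\<lambda>(x, z). g (ray \<theta> x z)) \<in> borel_measurable ((borel \<Otimes>\<^sub>M borel) \<Otimes>\<^sub>M borel)" unfolding ray_def by measurable
  then show "(\<lambda>(x, z). g (ray \<theta> x z)) \<in> borel_measurable (borel \<Otimes>\<^sub>M borel)" by (simp add: borel_prod)
  have "(\<lambda>(q, z). g (ray (snd q) (fst q) z)) \<in> borel_measurable (((borel \<Otimes>\<^sub>M borel) \<Otimes>\<^sub>M borel) \<Otimes>\<^sub>M borel)" unfolding ray_def by measurable
  then show "(\<lambda>(q, z). g (ray (snd q) (fst q) z)) \<in> borel_measurable (borel \<Otimes>\<^sub>M borel)" by (simp add: borel_prod)
qed

lemma projection_measurable:
  assumes \<Omega>: "open \<Omega>" and f: "f \<in> L2 (object_measure \<Omega>)"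
  shows "projection \<Omega> f \<in> borel_measurable borel"
proof -
  have z: "zero_ext \<Omega> f \<in> borel_measurable borel" using L2_zero_ext(1)[OF \<Omega> f] by (simp add: L2_def)
  have "(\<lambda>q. \<integral>z. zero_ext \<Omega> f (ray (snd q) (fst q) z) \<partial>lborel) \<in> borel_measurable borel"
    by (rule lborel.borel_measurable_lebesgue_integral) (use ray_measurable(3)[OF z] in simp)
  then show ?thesis by (simp add: projection_eq[abs_def])
qed

lemma abs_le_norm_ray: "\<bar>z\<bar> \<le> norm (ray \<theta> x z)"
proof (rule power2_le_imp_le)
  have "(norm (ray \<theta> x z))\<^sup>2 = (fst x * cos \<theta> - z * sin \<theta>)\<^sup>2 + (snd x)\<^sup>2 + (fst x * sin \<theta> + z * cos \<theta>)\<^sup>2"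
    by (simp add: ray_def norm_Pair)
  also have "\<dots> = (fst x)\<^sup>2 * ((sin \<theta>)\<^sup>2 + (cos \<theta>)\<^sup>2) + (snd x)\<^sup>2 + z\<^sup>2 * ((sin \<theta>)\<^sup>2 + (cos \<theta>)\<^sup>2)"
    unfolding power2_sum power2_diff power_mult_distrib by (simp only: distrib_left) simp
  finally show "\<bar>z\<bar>\<^sup>2 \<le> (norm (ray \<theta> x z))\<^sup>2" by simp
qed simp

text \<open>
  A ray meets the ball of radius \<open>B\<close> in depths between \<open>- B\<close> and \<open>B\<close>, so Cauchy-Schwarz along the
  ray costs the factor \<open>2 B\<close>, and integrating over all rays of one angle gives the full norm by
  rotation invariance. The constant does not depend on the angle; this uniformity, which is more
  than boundedness on the product space, is used throughout.
\<close>

lemma projection_bound: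
  assumes \<Omega>: "open \<Omega>" "\<forall>p\<in>\<Omega>. norm p \<le> B" "B \<ge> 0"
    and f: "f \<in> L2 (object_measure \<Omega>)" and \<theta>: "\<theta> \<in> {0..<pi}"
  shows "AE x in lborel. integrable lborel (\<lambda>z. zero_ext \<Omega> f (ray \<theta> x z))"
    and "(\<lambda>x. projection \<Omega> f (x, \<theta>)) \<in> L2 lborel"
    and "L2_norm lborel (\<lambda>x. projection \<Omega> f (x, \<theta>)) \<le> sqrt (2 * B) * L2_norm (object_measure \<Omega>) f"
proof -
  let ?f = "zero_ext \<Omega> f" and ?n = "L2_norm (object_measure \<Omega>) f"
  have fm: "?f \<in> borel_measurable borel" using L2_zero_ext(1)[OF \<Omega>(1) f] by (simp add: L2_def)
  note [measurable] = ray_measurable(1)[OF fm, of \<theta>] ray_measurable(2)[OF fm, of \<theta>]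
  define A where "A x = (\<integral>\<^sup>+z. ennreal (norm (?f (ray \<theta> x z))) \<partial>lborel)" for x
  define S where "S x = (\<integral>\<^sup>+z. ennreal ((norm (?f (ray \<theta> x z)))\<^sup>2) \<partial>lborel)" for x
  have Sm [measurable]: "S \<in> borel_measurable borel" unfolding S_def by measurable
  have AS: "(A x)\<^sup>2 \<le> ennreal (2 * B) * S x" for x
  proof -
    have supp: "?f (ray \<theta> x z) = 0" if "z \<notin> {-B..B}" for z
      using that bspec[OF \<Omega>(2), of "ray \<theta> x z"] abs_le_norm_ray[of z \<theta> x] by (auto simp: zero_ext_def abs_le_iff)
    have "A x = (\<integral>\<^sup>+z. indicator {-B..B} z * ennreal (norm (?f (ray \<theta> x z))) \<partial>lborel)"
      unfolding A_def by (intro nn_integral_cong) (use supp in \<open>auto simp: indicator_def\<close>)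
    also have "\<dots>\<^sup>2 \<le> (\<integral>\<^sup>+z. (indicator {-B..B} z)\<^sup>2 \<partial>lborel) * (\<integral>\<^sup>+z. (ennreal (norm (?f (ray \<theta> x z))))\<^sup>2 \<partial>lborel)"
      by (rule Cauchy_Schwarz_nn_integral) measurable
    also have "(\<integral>\<^sup>+z. (indicator {-B..B} z)\<^sup>2 \<partial>lborel) = (\<integral>\<^sup>+z. indicator {-B..B} z \<partial>lborel)"
      by (intro nn_integral_cong) (auto simp: indicator_def)
    also have "\<dots> = ennreal (2 * B)" using \<Omega>(3) by simp
    also have "(\<integral>\<^sup>+z. (ennreal (norm (?f (ray \<theta> x z))))\<^sup>2 \<partial>lborel) = S x"
      by (simp add: S_def ennreal_power)
    finally show ?thesis .
  qed
  have "(\<integral>\<^sup>+x. S x \<partial>lborel) = (\<integral>\<^sup>+p. ennreal ((norm (?f p))\<^sup>2) \<partial>lborel)"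
    unfolding S_def by (rule nn_integral_ray[OF _ \<theta>, of "\<lambda>p. ennreal ((norm (?f p))\<^sup>2)"]) (use fm in measurable)
  also have "\<dots> = ennreal (?n\<^sup>2)" using nn_integral_L2[OF L2_zero_ext(1)[OF \<Omega>(1) f]] L2_zero_ext(2)[OF \<Omega>(1) f] by simp
  finally have IS: "(\<integral>\<^sup>+x. S x \<partial>lborel) = ennreal (?n\<^sup>2)" .
  then have "AE x in lborel. S x \<noteq> \<infinity>" by (intro nn_integral_PInf_AE) auto
  then show "AE x in lborel. integrable lborel (\<lambda>z. ?f (ray \<theta> x z))"
  proof eventually_elim
    case (elim x)
    have "(A x)\<^sup>2 < \<infinity>" using AS[of x] elim by (auto simp: ennreal_mult_less_top less_top intro: le_less_trans)
    then have "A x < \<infinity>" by (auto simp: power_eq_top_ennreal less_top[symmetric])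
    then show ?case unfolding integrable_iff_bounded A_def by simp
  qed
  have pm: "(\<lambda>x. projection \<Omega> f (x, \<theta>)) \<in> borel_measurable borel"
    unfolding projection_eq fst_conv snd_conv by measurable
  have "(\<integral>\<^sup>+x. ennreal ((norm (projection \<Omega> f (x, \<theta>)))\<^sup>2) \<partial>lborel) \<le> (\<integral>\<^sup>+x. ennreal (2 * B) * S x \<partial>lborel)"
  proof (rule nn_integral_mono)
    fix x
    have "ennreal (norm (projection \<Omega> f (x, \<theta>))) \<le> A x"
      unfolding projection_eq fst_conv snd_conv A_def by (rule norm_integral_le_nn_integral)
    then have "(ennreal (norm (projection \<Omega> f (x, \<theta>))))\<^sup>2 \<le> (A x)\<^sup>2" by (intro power_mono) auto
    then show "ennreal ((norm (projection \<Omega> f (x, \<theta>)))\<^sup>2) \<le> ennreal (2 * B) * S x"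
      using AS[of x] by (auto simp: ennreal_power)
  qed
  also have "\<dots> = ennreal ((sqrt (2 * B) * ?n)\<^sup>2)"
    using \<Omega>(3) by (simp add: nn_integral_cmult IS ennreal_mult[symmetric] power_mult_distrib)
  finally show "(\<lambda>x. projection \<Omega> f (x, \<theta>)) \<in> L2 lborel"
    "L2_norm lborel (\<lambda>x. projection \<Omega> f (x, \<theta>)) \<le> sqrt (2 * B) * ?n"
    using pm \<Omega>(3) by (auto intro!: L2_norm_le_nn)
qed

lemma projection_add:
  assumes \<Omega>: "open \<Omega>" "\<forall>p\<in>\<Omega>. norm p \<le> B" "B \<ge> 0"
    and f: "f \<in> L2 (object_measure \<Omega>)" and h: "h \<in> L2 (object_measure \<Omega>)" and \<theta>: "\<theta> \<in> {0..<pi}"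
  shows "AE x in lborel. projection \<Omega> (\<lambda>p. f p + h p) (x, \<theta>) = projection \<Omega> f (x, \<theta>) + projection \<Omega> h (x, \<theta>)"
  using projection_bound(1)[OF \<Omega> f \<theta>] projection_bound(1)[OF \<Omega> h \<theta>]
proof eventually_elim
  case (elim x)
  have "zero_ext \<Omega> (\<lambda>p. f p + h p) p = zero_ext \<Omega> f p + zero_ext \<Omega> h p" for p by (simp add: zero_ext_def)
  then show ?case using elim by (simp add: projection_eq)
qed

lemma projection_scaleR: "projection \<Omega> (\<lambda>p. r *\<^sub>R f p) q = r *\<^sub>R projection \<Omega> f q"
proof -
  have "zero_ext \<Omega> (\<lambda>p. r *\<^sub>R f p) p = r *\<^sub>R zero_ext \<Omega> f p" for p by (simp add: zero_ext_def)
  then show ?thesis by (simp add: projection_eq)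
qed

text \<open>
  Apply the bound to the difference, which has norm zero.
\<close>

lemma projection_cong_AE:
  assumes \<Omega>: "open \<Omega>" "\<forall>p\<in>\<Omega>. norm p \<le> B" "B \<ge> 0"
    and f: "f \<in> L2 (object_measure \<Omega>)" and g: "g \<in> L2 (object_measure \<Omega>)" and \<theta>: "\<theta> \<in> {0..<pi}"
    and eq: "AE p in object_measure \<Omega>. f p = g p"
  shows "AE x in lborel. projection \<Omega> f (x, \<theta>) = projection \<Omega> g (x, \<theta>)"
proof -
  let ?d = "\<lambda>p. f p - g p"
  have d: "?d \<in> L2 (object_measure \<Omega>)" by (rule L2_diff[OF f g])
  have "L2_norm (object_measure \<Omega>) ?d = L2_norm (object_measure \<Omega>) (\<lambda>_. 0 :: complex)"
    by (rule L2_norm_cong_AE) (use d eq in \<open>auto simp: L2_def\<close>)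
  then have "L2_norm lborel (\<lambda>x. projection \<Omega> ?d (x, \<theta>)) = 0"
    using projection_bound(3)[OF \<Omega> d \<theta>] by (simp add: L2_norm_def order_antisym integral_nonneg_AE)
  then have "(\<integral>\<^sup>+x. ennreal ((norm (projection \<Omega> ?d (x, \<theta>)))\<^sup>2) \<partial>lborel) = 0"
    using nn_integral_L2[OF projection_bound(2)[OF \<Omega> d \<theta>]] by simp
  then have "AE x in lborel. projection \<Omega> ?d (x, \<theta>) = 0"
    using L2_measurable[OF projection_bound(2)[OF \<Omega> d \<theta>]] by (subst (asm) nn_integral_0_iff_AE) auto
  with projection_add[OF \<Omega> g d \<theta>] show ?thesis by eventually_elim simp
qed

text \<open>
  The projection is insensitive to null sets, so the sign may be assumed at every point, where it
  passes to the integrals over the rays.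
\<close>

lemma projection_Im_nonneg:
  assumes \<Omega>: "open \<Omega>" "\<forall>p\<in>\<Omega>. norm p \<le> B" "B \<ge> 0"
    and f: "f \<in> L2 (object_measure \<Omega>)" and \<theta>: "\<theta> \<in> {0..<pi}"
    and pos: "AE p in object_measure \<Omega>. Im (f p) \<ge> 0"
  shows "AE x in lborel. Im (projection \<Omega> f (x, \<theta>)) \<ge> 0"
proof -
  define g where "g p = (if Im (f p) \<ge> 0 then f p else 0)" for p
  have [measurable]: "f \<in> borel_measurable (object_measure \<Omega>)" using f by (simp add: L2_def)
  have [measurable]: "(\<lambda>p. Im (f p)) \<in> borel_measurable (object_measure \<Omega>)"
    by (rule borel_measurable_continuous_on[OF continuous_on_Im[OF continuous_on_id]]) fact
  have gm: "g \<in> borel_measurable (object_measure \<Omega>)" unfolding g_def by measurable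
  have g: "g \<in> L2 (object_measure \<Omega>)"
  proof -
    have "integrable (object_measure \<Omega>) (\<lambda>p. (norm (f p))\<^sup>2)" using f by (simp add: L2_def)
    then have "integrable (object_measure \<Omega>) (\<lambda>p. (norm (g p))\<^sup>2)"
      by (rule Bochner_Integration.integrable_bound) (use gm in \<open>auto simp: g_def\<close>)
    with gm show ?thesis by (simp add: L2_def)
  qed
  have "AE p in object_measure \<Omega>. f p = g p" using pos by eventually_elim (simp add: g_def)
  from projection_cong_AE[OF \<Omega> f g \<theta> this] show ?thesis
  proof eventually_elim
    case (elim x)
    have *: "Im (zero_ext \<Omega> g p) \<ge> 0" for p by (simp add: zero_ext_def g_def)
    have "Im (\<integral>z. zero_ext \<Omega> g (ray \<theta> x z) \<partial>lborel) \<ge> 0"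
    proof (cases "integrable lborel (\<lambda>z. zero_ext \<Omega> g (ray \<theta> x z))")
      case True
      show ?thesis unfolding integral_Im[OF True, symmetric] by (rule integral_nonneg_AE) (use * in simp)
    qed (simp add: not_integrable_integral_eq)
    then show ?case unfolding elim by (simp add: projection_eq)
  qed
qed

section \<open>The extended exponential\<close>

lemma exp_taylor_half_plane:
  fixes a b :: complex
  assumes "Re a \<le> 1" "Re b \<le> 1"
  shows "norm (exp b - exp a - exp a * (b - a)) \<le> exp 1 * (norm (b - a))\<^sup>2"
proof -
  have "cmod (exp b - (\<Sum>i\<le>1. exp a * (b - a) ^ i / fact i)) \<le> exp 1 * cmod (b - a) ^ Suc 1 / fact 1"
  proof (rule complex_Taylor[of "{z. Re z \<le> 1}" 1 "\<lambda>_. exp"])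
    show "convex {z. Re z \<le> 1}" by (rule convex_halfspace_Re_le)
  qed (use assms in \<open>auto intro: DERIV_exp[THEN DERIV_subset]\<close>)
  then show ?thesis by (simp add: numeral_2_eq_2 algebra_simps)
qed

text \<open>
  The derivative exists, and from the right it is that of the identity.
\<close>

lemma extension_derivative_at_0:
  fixes S :: "real \<Rightarrow> real"
  assumes S: "S C1_differentiable_on UNIV" and pos: "\<And>t. t \<ge> 0 \<Longrightarrow> S t = t"
  shows "(S has_real_derivative 1) (at 0)"
proof -
  obtain D where D: "(S has_real_derivative D) (at 0)"
    using S by (auto simp: C1_differentiable_on_eq real_differentiable_def)
  then have "((\<lambda>t. (S t - S 0) / (t - 0)) \<longlongrightarrow> D) (at_right 0)"
    unfolding has_field_derivative_iff by (rule tendsto_mono[rotated]) (simp add: at_le)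
  moreover have "((\<lambda>t. (S t - S 0) / (t - 0)) \<longlongrightarrow> 1) (at_right 0)"
  proof (rule tendsto_eventually)
    show "\<forall>\<^sub>F t in at_right 0. (S t - S 0) / (t - 0) = 1"
      using eventually_at_right_less[of "0::real"] by eventually_elim (simp add: pos)
  qed
  ultimately have "D = 1" by (intro tendsto_unique[of "at_right (0::real)"]) auto
  with D show ?thesis by simp
qed

text \<open>
  Near zero the gap is controlled by the derivative. On the negative axis \<open>S\<close> takes values in
  \<open>[- 1 / k, 0]\<close>, so away from zero the gap grows at most linearly and is absorbed by either bound.
\<close>

lemma extension_gap:
  fixes S :: "real \<Rightarrow> real"
  assumes k: "k > 0" and S: "S C1_differentiable_on UNIV" "mono S"
    and pos: "\<And>t. t \<ge> 0 \<Longrightarrow> S t = t" and lower: "\<And>t. t < 0 \<Longrightarrow> S t \<ge> - 1 / k"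
    and \<epsilon>: "\<epsilon> > 0"
  shows "\<exists>K\<ge>0. \<forall>t<0. \<bar>S t - t\<bar> \<le> \<epsilon> * \<bar>t\<bar> + K * t\<^sup>2" "\<exists>C\<ge>0. \<forall>t<0. \<bar>S t - t\<bar> \<le> C * \<bar>t\<bar>"
proof -
  have "(S has_derivative (*) 1) (at 0)"
    using extension_derivative_at_0[OF S(1) pos] unfolding has_field_derivative_def .
  then have "\<exists>d>0. \<forall>t. norm (t - 0) < d \<longrightarrow> norm (S t - S 0 - 1 * (t - 0)) \<le> \<epsilon> * norm (t - 0)"
    unfolding has_derivative_at_alt using \<epsilon> by blast
  then obtain \<delta> where \<delta>: "\<delta> > 0" "\<And>t. \<bar>t\<bar> < \<delta> \<Longrightarrow> \<bar>S t - t\<bar> \<le> \<epsilon> * \<bar>t\<bar>"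
    using pos[of 0] by (auto simp: real_norm_def)
  have far: "\<bar>S t - t\<bar> \<le> 1 / k + \<bar>t\<bar>" if "t < 0" for t
  proof -
    have "S t \<le> 0" using monoD[OF S(2), of t 0] pos[of 0] that by simp
    then show ?thesis using lower[OF that] k by (auto simp: abs_le_iff)
  qed
  show "\<exists>K\<ge>0. \<forall>t<0. \<bar>S t - t\<bar> \<le> \<epsilon> * \<bar>t\<bar> + K * t\<^sup>2"
  proof (intro exI[of _ "1 / (k * \<delta>\<^sup>2) + 1 / \<delta>"] conjI allI impI)
    show "0 \<le> 1 / (k * \<delta>\<^sup>2) + 1 / \<delta>" using k \<delta>(1) by simp
    fix t :: real assume t: "t < 0"
    show "\<bar>S t - t\<bar> \<le> \<epsilon> * \<bar>t\<bar> + (1 / (k * \<delta>\<^sup>2) + 1 / \<delta>) * t\<^sup>2"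
    proof (cases "\<bar>t\<bar> < \<delta>")
      case True
      have "0 \<le> (1 / (k * \<delta>\<^sup>2) + 1 / \<delta>) * t\<^sup>2" using k \<delta>(1) by simp
      then show ?thesis using \<delta>(2)[OF True] by linarith
    next
      case False
      then have d: "\<delta> \<le> \<bar>t\<bar>" by simp
      have "1 / k \<le> 1 / (k * \<delta>\<^sup>2) * t\<^sup>2"
        using power_mono[OF d, of 2] k \<delta>(1) by (simp add: field_simps)
      moreover have "\<bar>t\<bar> \<le> 1 / \<delta> * t\<^sup>2"
        using mult_right_mono[OF d, of "\<bar>t\<bar>"] \<delta>(1) by (simp add: field_simps power2_eq_square)
      moreover have "0 \<le> \<epsilon> * \<bar>t\<bar>" using \<epsilon> by simp
      ultimately show ?thesis using far[OF t] unfolding distrib_right by linarith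
    qed
  qed
  show "\<exists>C\<ge>0. \<forall>t<0. \<bar>S t - t\<bar> \<le> C * \<bar>t\<bar>"
  proof (intro exI[of _ "\<epsilon> + (1 / (k * \<delta>) + 1)"] conjI allI impI)
    show "0 \<le> \<epsilon> + (1 / (k * \<delta>) + 1)" using k \<delta>(1) \<epsilon> by simp
    fix t :: real assume t: "t < 0"
    show "\<bar>S t - t\<bar> \<le> (\<epsilon> + (1 / (k * \<delta>) + 1)) * \<bar>t\<bar>"
    proof (cases "\<bar>t\<bar> < \<delta>")
      case True
      have "0 \<le> (1 / (k * \<delta>) + 1) * \<bar>t\<bar>" using k \<delta>(1) by simp
      then show ?thesis using \<delta>(2)[OF True] unfolding distrib_right by linarith
    next
      case False
      then have "1 / k \<le> 1 / (k * \<delta>) * \<bar>t\<bar>" using k \<delta>(1) by (simp add: field_simps)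
      moreover have "0 \<le> \<epsilon> * \<bar>t\<bar>" using \<epsilon> by simp
      ultimately show ?thesis using far[OF t] unfolding distrib_right by linarith
    qed
  qed
qed

text \<open>
  A first order expansion whose remainder is uniform in the base point of the closed upper half
  plane, and valid for increments of any size. The exponents at \<open>g\<close> and \<open>g + \<eta>\<close> have real part
  at most one, where the exponential has bounded second derivative; the new exponent differs from the
  linear one by \<open>k\<close> times the gap of \<open>S\<close>, which only occurs if \<open>\<eta>\<close> is large enough to cross the
  real axis.
\<close>

lemma extended_exp_remainder:
  fixes S :: "real \<Rightarrow> real"
  assumes k: "k > 0" and S: "S C1_differentiable_on UNIV" "mono S"
    and pos: "\<And>t. t \<ge> 0 \<Longrightarrow> S t = t" and lower: "\<And>t. t < 0 \<Longrightarrow> S t \<ge> - 1 / k"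
    and \<epsilon>: "\<epsilon> > 0"
  shows "\<exists>K\<ge>0. \<forall>g \<eta>. Im g \<ge> 0 \<longrightarrow>
    norm (extended_exp k S (g + \<eta>) - exp (\<i> * of_real k * g) - \<i> * of_real k * exp (\<i> * of_real k * g) * \<eta>)
      \<le> \<epsilon> * norm \<eta> + K * (norm \<eta>)\<^sup>2"
proof -
  obtain K1 where K1: "K1 \<ge> 0" "\<And>t. t < 0 \<Longrightarrow> \<bar>S t - t\<bar> \<le> \<epsilon> / k * \<bar>t\<bar> + K1 * t\<^sup>2"
    using extension_gap(1)[OF k S pos lower divide_pos_pos[OF \<epsilon> k]] by blast
  obtain C where C: "C \<ge> 0" "\<And>t. t < 0 \<Longrightarrow> \<bar>S t - t\<bar> \<le> C * \<bar>t\<bar>"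
    using extension_gap(2)[OF k S pos lower \<epsilon>] by blast
  define K where "K = exp 1 * (k * (1 + C))\<^sup>2 + k * K1"
  show ?thesis
  proof (intro exI[of _ K] conjI allI impI)
    show "K \<ge> 0" using k K1 C by (simp add: K_def)
    fix g \<eta> :: complex assume g: "Im g \<ge> 0"
    define t where "t = Im (g + \<eta>)"
    define a where "a = \<i> * of_real k * g"
    define b where "b = \<i> * of_real k * (of_real (Re (g + \<eta>)) + \<i> * of_real (S t))"
    have gap: "\<bar>S t - t\<bar> \<le> C * norm \<eta>" "k * \<bar>S t - t\<bar> \<le> \<epsilon> * norm \<eta> + k * K1 * (norm \<eta>)\<^sup>2"
    proof -
      have *: "\<bar>S t - t\<bar> \<le> C * norm \<eta> \<and> \<bar>S t - t\<bar> \<le> \<epsilon> / k * norm \<eta> + K1 * (norm \<eta>)\<^sup>2"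
      proof (cases "t < 0")
        case True
        \<comment> \<open>to get below the axis from \<open>g\<close>, the increment has to be at least as long as the overshoot\<close>
        have tn: "\<bar>t\<bar> \<le> norm \<eta>" using True g abs_Im_le_cmod[of \<eta>] by (simp add: t_def)
        have "C * \<bar>t\<bar> \<le> C * norm \<eta>" using tn C by (intro mult_left_mono)
        moreover have "\<epsilon> / k * \<bar>t\<bar> \<le> \<epsilon> / k * norm \<eta>" using tn \<epsilon> k by (intro mult_left_mono) auto
        moreover have "K1 * t\<^sup>2 \<le> K1 * (norm \<eta>)\<^sup>2" using power_mono[OF tn, of 2] K1 by (intro mult_left_mono) auto
        ultimately show ?thesis using K1(2)[OF True] C(2)[OF True] by linarith
      next
        case False
        then show ?thesis using pos[of t] C K1 \<epsilon> k by simp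
      qed
      then show "\<bar>S t - t\<bar> \<le> C * norm \<eta>" by simp
      have "k * \<bar>S t - t\<bar> \<le> k * (\<epsilon> / k * norm \<eta> + K1 * (norm \<eta>)\<^sup>2)" using * k by (intro mult_left_mono) auto
      then show "k * \<bar>S t - t\<bar> \<le> \<epsilon> * norm \<eta> + k * K1 * (norm \<eta>)\<^sup>2" using k by (simp add: algebra_simps)
    qed
    have diff: "b - a - \<i> * of_real k * \<eta> = of_real (- k * (S t - t))"
      by (simp add: a_def b_def t_def complex_eq_iff algebra_simps)
    have nd: "norm (b - a - \<i> * of_real k * \<eta>) = k * \<bar>S t - t\<bar>"
      unfolding diff norm_of_real using k by (simp add: abs_mult)
    have ba: "norm (b - a) \<le> k * (1 + C) * norm \<eta>"
    proof -
      have "norm (b - a) \<le> norm (b - a - \<i> * of_real k * \<eta>) + norm (\<i> * of_real k * \<eta>)"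
        using norm_triangle_ineq[of "b - a - \<i> * of_real k * \<eta>" "\<i> * of_real k * \<eta>"] by simp
      also have "\<dots> = k * \<bar>S t - t\<bar> + k * norm \<eta>" unfolding nd using k by (simp add: norm_mult)
      also have "\<dots> \<le> k * (C * norm \<eta>) + k * norm \<eta>" using gap(1) k by (intro add_right_mono mult_left_mono) auto
      finally show ?thesis by (simp add: algebra_simps)
    qed
    have Ra: "Re a \<le> 0" using g k by (simp add: a_def)
    have Rb: "Re b \<le> 1"
    proof (cases "t < 0")
      case True
      then show ?thesis using lower[OF True] k by (simp add: b_def field_simps)
    next
      case False
      then have "0 \<le> k * S t" using pos[of t] k by simp
      then show ?thesis by (simp add: b_def)
    qed
    have "extended_exp k S (g + \<eta>) - exp (\<i> * of_real k * g) - \<i> * of_real k * exp (\<i> * of_real k * g) * \<eta>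
      = (exp b - exp a - exp a * (b - a)) + exp a * (b - a - \<i> * of_real k * \<eta>)"
      unfolding extended_exp_def t_def[symmetric] b_def[symmetric] a_def[symmetric] by (simp add: algebra_simps)
    also have "norm \<dots> \<le> norm (exp b - exp a - exp a * (b - a)) + norm (exp a * (b - a - \<i> * of_real k * \<eta>))"
      by (rule norm_triangle_ineq)
    also have "\<dots> \<le> exp 1 * (norm (b - a))\<^sup>2 + 1 * (k * \<bar>S t - t\<bar>)"
      unfolding norm_mult[of "exp a"] nd using Ra Rb k
      by (intro add_mono exp_taylor_half_plane mult_right_mono) auto
    also have "\<dots> \<le> exp 1 * (k * (1 + C) * norm \<eta>)\<^sup>2 + (\<epsilon> * norm \<eta> + k * K1 * (norm \<eta>)\<^sup>2)"
      using gap(2) power_mono[OF ba, of 2] by (intro add_mono mult_left_mono) auto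
    also have "\<dots> = \<epsilon> * norm \<eta> + K * (norm \<eta>)\<^sup>2" 
      unfolding K_def power_mult_distrib[of "k * (1 + C)"] by (simp only: distrib_right mult.assoc add_ac)
    finally show "norm (extended_exp k S (g + \<eta>) - exp (\<i> * of_real k * g) - \<i> * of_real k * exp (\<i> * of_real k * g) * \<eta>)
      \<le> \<epsilon> * norm \<eta> + K * (norm \<eta>)\<^sup>2" .
  qed
qed

lemma norm_extended_exp_le:
  assumes k: "k > 0" and pos: "\<And>t. t \<ge> 0 \<Longrightarrow> S t = t" and lower: "\<And>t. t < 0 \<Longrightarrow> S t \<ge> - 1 / k"
  shows "norm (extended_exp k S z) \<le> exp 1"
proof -
  have "- k * S (Im z) \<le> 1"
  proof (cases "Im z < 0")
    case True
    then show ?thesis using lower[OF True] k by (simp add: field_simps)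
  next
    case False
    then have "0 \<le> k * S (Im z)" using pos[of "Im z"] k by simp
    then show ?thesis by simp
  qed
  then show ?thesis by (simp add: extended_exp_def)
qed

lemma extended_exp_eq:
  assumes "\<And>t. t \<ge> 0 \<Longrightarrow> S t = t" "Im z \<ge> 0"
  shows "extended_exp k S z = exp (\<i> * of_real k * z)"
  using assms(1)[OF assms(2)] by (simp add: extended_exp_def complex_eq[symmetric])

section \<open>Waves on the detector window\<close>

lemma L2_norm_le_pointwise:
  assumes f: "f \<in> L2 M" and g: "g \<in> borel_measurable M" and le: "AE x in M. norm (g x) \<le> c * norm (f x)" and c: "c \<ge> 0"
  shows "g \<in> L2 M" "L2_norm M g \<le> c * L2_norm M f"
proof -
  have "(\<integral>\<^sup>+x. ennreal ((norm (g x))\<^sup>2) \<partial>M) \<le> (\<integral>\<^sup>+x. ennreal (c\<^sup>2) * ennreal ((norm (f x))\<^sup>2) \<partial>M)"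
  proof (rule nn_integral_mono_AE, use le in eventually_elim)
    fix x assume "norm (g x) \<le> c * norm (f x)"
    then have "(norm (g x))\<^sup>2 \<le> c\<^sup>2 * (norm (f x))\<^sup>2"
      using power_mono[of "norm (g x)" "c * norm (f x)" 2] by (simp add: power_mult_distrib)
    then show "ennreal ((norm (g x))\<^sup>2) \<le> ennreal (c\<^sup>2) * ennreal ((norm (f x))\<^sup>2)"
      by (simp add: ennreal_mult[symmetric] ennreal_leI)
  qed
  also have "\<dots> = ennreal (c\<^sup>2) * ennreal ((L2_norm M f)\<^sup>2)"
    using L2_measurable[OF f] by (simp add: nn_integral_cmult nn_integral_L2[OF f])
  also have "\<dots> = ennreal ((c * L2_norm M f)\<^sup>2)"
    by (simp add: ennreal_mult[symmetric] power_mult_distrib)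
  finally show "g \<in> L2 M" "L2_norm M g \<le> c * L2_norm M f"
    using g c by (auto intro!: L2_norm_le_nn)
qed

lemma L2_finite_measure_bounded:
  fixes f :: "'a \<Rightarrow> 'b::real_normed_vector"
  assumes fin: "finite_measure M" and f: "f \<in> borel_measurable M" and le: "AE x in M. norm (f x) \<le> c" and c: "c \<ge> 0"
  shows "f \<in> L2 M" "L2_norm M f \<le> c * sqrt (measure M (space M))"
proof -
  interpret finite_measure M by (rule fin)
  have "(\<integral>\<^sup>+x. ennreal ((norm (f x))\<^sup>2) \<partial>M) \<le> (\<integral>\<^sup>+x. ennreal (c\<^sup>2) \<partial>M)"
    by (rule nn_integral_mono_AE, use le in eventually_elim) (auto intro!: ennreal_leI power_mono)
  also have "\<dots> = ennreal ((c * sqrt (measure M (space M)))\<^sup>2)"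
    by (simp add: emeasure_eq_measure ennreal_mult[symmetric] power_mult_distrib)
  finally show "f \<in> L2 M" "L2_norm M f \<le> c * sqrt (measure M (space M))"
    using f c by (auto intro!: L2_norm_le_nn)
qed

locale detector =
  fixes \<Omega>' :: "(real \<times> real) set" and Fr :: real
  assumes \<Omega>': "bounded_domain \<Omega>'" and Fr: "Fr > 0"
begin

abbreviation "N \<equiv> detector_measure \<Omega>'"
abbreviation "V u q \<equiv> fresnel_conv (pi / (2 * Fr)) (slice \<Omega>' u (snd q)) (fst q)"

text \<open>
  The constant \<open>c0\<close> is the modulus of the Fresnel kernel.
\<close>

definition area :: real where "area = measure lborel \<Omega>'"
definition c0 :: real where "c0 = 1 / (4 * pi * (pi / (2 * Fr)))"

lemma c0_pos: "c0 > 0" using Fr by (simp add: c0_def)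

lemma open_\<Omega>': "open \<Omega>'" and bounded_\<Omega>': "bounded \<Omega>'"
  using \<Omega>' by (auto simp: bounded_domain_def)

lemma \<Omega>'_sets [measurable]: "\<Omega>' \<in> sets borel" using open_\<Omega>' by simp

lemma \<Omega>'_finite: "emeasure lborel \<Omega>' < \<infinity>"
  by (rule emeasure_bounded_finite[OF bounded_\<Omega>'])

lemma area_nonneg: "area \<ge> 0" by (simp add: area_def)

lemma window_sets: "\<Omega>' \<times> {0..<pi} \<in> sets lborel" by (simp add: borel_Times)

lemma space_N: "q \<in> space N \<Longrightarrow> fst q \<in> \<Omega>' \<and> snd q \<in> {0..<pi}"
  by (auto simp: detector_measure_def space_restrict_space)

lemma finite_N: "finite_measure N"
proof
  have "emeasure N (space N) = emeasure lborel (\<Omega>' \<times> {0..<pi})"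
    using window_sets by (simp add: detector_measure_def emeasure_restrict_space space_restrict_space)
  also have "\<dots> < \<infinity>"
    by (rule emeasure_bounded_finite) (intro bounded_Times bounded_\<Omega>' bounded_subset[OF bounded_closed_interval[of 0 pi]], auto)
  finally show "emeasure N (space N) \<noteq> \<infinity>" by simp
qed

lemma measurable_N: "u \<in> borel_measurable borel \<Longrightarrow> u \<in> borel_measurable N"
  unfolding detector_measure_def by (rule measurable_restrict_space1) simp

text \<open>
  The slices are controlled at every angle by one constant. Membership in \<open>L\<^sup>2\<close> of the product
  would only control almost every slice, and not uniformly, whereas the uniform bound gives bounds
  in the supremum norm after propagation.
\<close>

definition wave :: "((real \<times> real) \<times> real \<Rightarrow> complex) \<Rightarrow> real \<Rightarrow> bool" where
  "wave u c \<longleftrightarrow> u \<in> borel_measurable borel \<and> c \<ge> 0 \<and>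
     (\<forall>\<theta>\<in>{0..<pi}. slice \<Omega>' u \<theta> \<in> L2 lborel \<and> L2_norm lborel (slice \<Omega>' u \<theta>) \<le> c)"

lemma wave_integrable:
  assumes "wave u c" "\<theta> \<in> {0..<pi}"
  shows "integrable lborel (slice \<Omega>' u \<theta>)" "(\<integral>x. norm (slice \<Omega>' u \<theta> x) \<partial>lborel) \<le> sqrt area * c"
proof -
  have s: "slice \<Omega>' u \<theta> \<in> L2 lborel" "L2_norm lborel (slice \<Omega>' u \<theta>) \<le> c" using assms by (auto simp: wave_def)
  have o: "\<Omega>' \<in> sets lborel" by simp
  have z: "\<And>x. x \<notin> \<Omega>' \<Longrightarrow> slice \<Omega>' u \<theta> x = 0" by (simp add: slice_def)
  show "integrable lborel (slice \<Omega>' u \<theta>)" by (rule L2_finite_support_integrable(1)[OF s(1) o \<Omega>'_finite z])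
  have "(\<integral>x. norm (slice \<Omega>' u \<theta> x) \<partial>lborel) \<le> sqrt (measure lborel \<Omega>') * L2_norm lborel (slice \<Omega>' u \<theta>)"
    by (rule L2_finite_support_integrable(2)[OF s(1) o \<Omega>'_finite z])
  also have "\<dots> \<le> sqrt area * c" unfolding area_def using s(2) by (intro mult_left_mono) auto
  finally show "(\<integral>x. norm (slice \<Omega>' u \<theta> x) \<partial>lborel) \<le> sqrt area * c" .
qed

lemma V_le:
  assumes "integrable lborel (slice \<Omega>' u (snd q))" "(\<integral>x. norm (slice \<Omega>' u (snd q) x) \<partial>lborel) \<le> a"
  shows "norm (V u q) \<le> c0 * a"
proof -
  have "norm (V u q) \<le> (\<integral>y. norm (slice \<Omega>' u (snd q) y) \<partial>lborel) / (4 * pi * \<bar>pi / (2 * Fr)\<bar>)"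
    by (rule norm_fresnel_conv_le[OF assms(1)])
  also have "\<dots> = c0 * (\<integral>y. norm (slice \<Omega>' u (snd q) y) \<partial>lborel)"
    using Fr by (simp add: c0_def)
  also have "\<dots> \<le> c0 * a" using assms(2) c0_pos by (intro mult_left_mono) auto
  finally show ?thesis .
qed

lemma wave_V_le:
  assumes "wave u c" "q \<in> space N"
  shows "norm (V u q) \<le> c0 * (sqrt area * c)"
  using wave_integrable[OF assms(1)] space_N[OF assms(2)] by (intro V_le) auto

text \<open>
  The representative chosen by \<open>fresnel\<close> is replaced by the convolution \<open>V u\<close>, which is defined at
  every point.
\<close>

lemma wave_fresnel:
  assumes "wave u c"
  shows "fresnel Fr \<Omega>' u \<in> borel_measurable borel" "AE q in N. fresnel Fr \<Omega>' u q = V u q"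
  using fresnel_eq_conv[OF Fr open_\<Omega>' bounded_\<Omega>', of u] assms by (auto simp: wave_def)

lemma wave_L2:
  assumes w: "wave u c" shows "u \<in> L2 N"
proof -
  have u: "u \<in> borel_measurable borel" and sl: "\<And>\<theta>. \<theta> \<in> {0..<pi} \<Longrightarrow> slice \<Omega>' u \<theta> \<in> L2 lborel \<and> L2_norm lborel (slice \<Omega>' u \<theta>) \<le> c"
    and c: "c \<ge> 0" using w by (auto simp: wave_def)
  have [measurable]: "u \<in> borel_measurable (borel \<Otimes>\<^sub>M borel)" using u by (simp add: borel_prod)
  have "(\<integral>\<^sup>+q. ennreal ((norm (u q))\<^sup>2) \<partial>N) = (\<integral>\<^sup>+q. ennreal ((norm (u q))\<^sup>2) * indicator (\<Omega>' \<times> {0..<pi}) q \<partial>lborel)"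
    unfolding detector_measure_def using window_sets by (intro nn_integral_restrict_space) simp
  also have "\<dots> = (\<integral>\<^sup>+q. ennreal ((norm (u q))\<^sup>2) * indicator (\<Omega>' \<times> {0..<pi}) q \<partial>(lborel \<Otimes>\<^sub>M lborel))"
    by (simp add: lborel_prod)
  also have "\<dots> = (\<integral>\<^sup>+\<theta>. (\<integral>\<^sup>+x. ennreal ((norm (u (x, \<theta>)))\<^sup>2) * indicator (\<Omega>' \<times> {0..<pi}) (x, \<theta>) \<partial>lborel) \<partial>lborel)"
    by (rule lborel_pair.nn_integral_snd[symmetric]) measurable
  also have "\<dots> \<le> (\<integral>\<^sup>+\<theta>. ennreal (c\<^sup>2) * indicator {0..<pi} \<theta> \<partial>lborel)"
  proof (rule nn_integral_mono)
    fix \<theta>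
    show "(\<integral>\<^sup>+x. ennreal ((norm (u (x, \<theta>)))\<^sup>2) * indicator (\<Omega>' \<times> {0..<pi}) (x, \<theta>) \<partial>lborel) \<le> ennreal (c\<^sup>2) * indicator {0..<pi} \<theta>"
    proof (cases "\<theta> \<in> {0..<pi}")
      case True
      have "(\<integral>\<^sup>+x. ennreal ((norm (u (x, \<theta>)))\<^sup>2) * indicator (\<Omega>' \<times> {0..<pi}) (x, \<theta>) \<partial>lborel)
        = (\<integral>\<^sup>+x. ennreal ((norm (slice \<Omega>' u \<theta> x))\<^sup>2) \<partial>lborel)"
        using True by (intro nn_integral_cong) (auto simp: slice_def indicator_def)
      also have "\<dots> = ennreal ((L2_norm lborel (slice \<Omega>' u \<theta>))\<^sup>2)" using sl[OF True] by (intro nn_integral_L2) simp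
      also have "\<dots> \<le> ennreal (c\<^sup>2)" using sl[OF True] by (intro ennreal_leI power_mono) auto
      finally show ?thesis using True by simp
    next
      case False
      then have "indicator (\<Omega>' \<times> {0..<pi}) (x, \<theta>) = (0 :: ennreal)" for x by (auto simp: indicator_def)
      then show ?thesis by simp
    qed
  qed
  also have "\<dots> = ennreal (c\<^sup>2) * ennreal pi" by (simp add: nn_integral_cmult)
  also have "\<dots> < \<infinity>" by (simp add: ennreal_mult_less_top)
  finally show ?thesis using measurable_N[OF u] by (simp add: L2_iff_nn)
qed

lemma wave_dominated:
  assumes w: "wave w c" and u: "u \<in> borel_measurable borel" and a: "a \<ge> 0"
    and le: "\<And>\<theta>. \<theta> \<in> {0..<pi} \<Longrightarrow> AE x in lborel. norm (u (x, \<theta>)) \<le> a * norm (w (x, \<theta>))"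
  shows "wave u (a * c)"
  unfolding wave_def
proof (intro conjI ballI u)
  show "0 \<le> a * c" using a w by (simp add: wave_def)
  fix \<theta> assume \<theta>: "\<theta> \<in> {0..<pi}"
  have s: "slice \<Omega>' w \<theta> \<in> L2 lborel" "L2_norm lborel (slice \<Omega>' w \<theta>) \<le> c" using w \<theta> by (auto simp: wave_def)
  have m: "slice \<Omega>' u \<theta> \<in> borel_measurable lborel" using slice_measurable(1)[OF \<Omega>'_sets u] by simp
  have l: "AE x in lborel. norm (slice \<Omega>' u \<theta> x) \<le> a * norm (slice \<Omega>' w \<theta> x)"
    using le[OF \<theta>] by eventually_elim (simp add: slice_def)
  show "slice \<Omega>' u \<theta> \<in> L2 lborel" by (rule L2_norm_le_pointwise(1)[OF s(1) m l a])
  have "L2_norm lborel (slice \<Omega>' u \<theta>) \<le> a * L2_norm lborel (slice \<Omega>' w \<theta>)" by (rule L2_norm_le_pointwise(2)[OF s(1) m l a])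
  also have "\<dots> \<le> a * c" using s a by (intro mult_left_mono)
  finally show "L2_norm lborel (slice \<Omega>' u \<theta>) \<le> a * c" .
qed

lemma wave_one: "wave (\<lambda>_. 1) (sqrt area)"
  unfolding wave_def
proof (intro conjI ballI)
  fix \<theta> :: real
  have e: "(norm (slice \<Omega>' (\<lambda>_. 1) \<theta> x))\<^sup>2 = indicator \<Omega>' x" for x by (simp add: slice_def indicator_def)
  have m: "slice \<Omega>' (\<lambda>_. 1) \<theta> \<in> borel_measurable lborel" using slice_measurable(1)[OF \<Omega>'_sets, of "\<lambda>_. 1"] by simp
  have i: "integrable lborel (indicator \<Omega>' :: _ \<Rightarrow> real)" by (rule integrable_real_indicator) (use \<Omega>'_finite in simp_all)
  show "slice \<Omega>' (\<lambda>_. 1) \<theta> \<in> L2 lborel" using m i by (simp add: L2_def e)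
  show "L2_norm lborel (slice \<Omega>' (\<lambda>_. 1) \<theta>) \<le> sqrt area" by (simp add: L2_norm_def e area_def)
qed (simp_all add: area_nonneg)

lemma V_cong_AE:
  assumes "u \<in> borel_measurable borel" "v \<in> borel_measurable borel" "AE x in lborel. u (x, snd q) = v (x, snd q)"
  shows "V u q = V v q"
proof (rule fresnel_conv_cong_AE)
  show "AE y in lborel. slice \<Omega>' u (snd q) y = slice \<Omega>' v (snd q) y"
    using assms(3) by eventually_elim (simp add: slice_def)
qed (intro slice_measurable \<Omega>'_sets assms)+

lemma fresnel_cong:
  assumes w: "wave u c" "wave v c'"
    and eq: "\<forall>\<theta>\<in>{0..<pi}. AE x in lborel. u (x, \<theta>) = v (x, \<theta>)"
  shows "AE q in N. fresnel Fr \<Omega>' u q = fresnel Fr \<Omega>' v q"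
  using wave_fresnel(2)[OF w(1)] wave_fresnel(2)[OF w(2)] AE_space
proof eventually_elim
  case (elim q)
  have "V u q = V v q"
    by (rule V_cong_AE) (use w eq space_N[OF elim(3)] in \<open>auto simp: wave_def\<close>)
  then show ?case using elim by simp
qed

lemma V_add:
  assumes "wave u c" "wave v c'" "q \<in> space N"
  shows "V (\<lambda>q. u q + v q) q = V u q + V v q"
proof -
  have \<theta>: "snd q \<in> {0..<pi}" using space_N[OF assms(3)] by simp
  have "slice \<Omega>' (\<lambda>q. u q + v q) (snd q) = (\<lambda>x. slice \<Omega>' u (snd q) x + slice \<Omega>' v (snd q) x)"
    by (auto simp: slice_def fun_eq_iff)
  then show ?thesis
    using fresnel_conv_add[OF wave_integrable(1)[OF assms(1) \<theta>] wave_integrable(1)[OF assms(2) \<theta>]] by simp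
qed

lemma V_scaleR: "V (\<lambda>q. r *\<^sub>R u q) q = r *\<^sub>R V u q"
proof -
  have "slice \<Omega>' (\<lambda>q. r *\<^sub>R u q) (snd q) = (\<lambda>x. r *\<^sub>R slice \<Omega>' u (snd q) x)"
    by (auto simp: slice_def fun_eq_iff)
  then show ?thesis by (simp add: fresnel_conv_scaleR)
qed

lemma wave_intensity_L2:
  assumes w: "wave u c" shows "(\<lambda>q. (norm (fresnel Fr \<Omega>' u q))\<^sup>2) \<in> L2 N"
proof (rule L2_finite_measure_bounded(1)[OF finite_N])
  have [measurable]: "fresnel Fr \<Omega>' u \<in> borel_measurable borel" by (rule wave_fresnel(1)[OF w])
  show "(\<lambda>q. (norm (fresnel Fr \<Omega>' u q))\<^sup>2) \<in> borel_measurable N" by (rule measurable_N) measurable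
  show "AE q in N. norm ((norm (fresnel Fr \<Omega>' u q))\<^sup>2) \<le> (c0 * (sqrt area * c))\<^sup>2"
    using wave_fresnel(2)[OF w] AE_space
  proof eventually_elim
    case (elim q)
    then show ?case using power_mono[OF wave_V_le[OF w elim(2)], of 2] by simp
  qed
qed simp

end

section \<open>Intensities and their derivatives\<close>

text \<open>
  A radius \<open>B\<close> of a ball that contains the object and a bound \<open>CP\<close> of the probe are fixed, so that the
  constants in the estimates are explicit.
\<close>

locale phase_contrast = detector \<Omega>' Fr
  for \<Omega>' :: "(real \<times> real) set" and Fr :: real +
  fixes \<Omega> :: "(real \<times> real \<times> real) set" and k :: real and P :: "real \<times> real \<Rightarrow> complex" and S :: "real \<Rightarrow> real"
    and B CP :: real
  assumes \<Omega>_open: "open \<Omega>" and \<Omega>_bound: "\<forall>p\<in>\<Omega>. norm p \<le> B" and B: "B \<ge> 0"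
    and k: "k > 0" and P [measurable]: "P \<in> borel_measurable borel"
    and P_bound: "AE x in lborel. norm (P x) \<le> CP" and CP: "CP \<ge> 0"
    and S: "S C1_differentiable_on UNIV" "mono S"
    and S_pos: "\<And>t. t \<ge> 0 \<Longrightarrow> S t = t" and S_lower: "\<And>t. t < 0 \<Longrightarrow> S t \<ge> - 1 / k"
begin

abbreviation "M \<equiv> object_measure \<Omega>"
abbreviation "ew \<equiv> exit_wave k P \<Omega>"
abbreviation "xw \<equiv> extended_exit_wave k S P \<Omega>"

text \<open>
  The derivative of the exit wave at \<open>f\<close> in direction \<open>h\<close>.
\<close>

abbreviation "dw f h q \<equiv> \<i> * of_real k * exit_wave k P \<Omega> f q * projection \<Omega> h q"
abbreviation "T \<equiv> extended_forward_op k Fr S P \<Omega> \<Omega>'"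
abbreviation "D \<equiv> forward_derivative k Fr P \<Omega> \<Omega>'"

text \<open>
  The norm of the projection at a single angle is at most \<open>\<beta>\<close>.
\<close>

definition \<beta> :: real where "\<beta> = sqrt (2 * B)"

lemma \<beta>_nonneg: "\<beta> \<ge> 0" using B by (simp add: \<beta>_def)

lemma S_continuous: "continuous_on UNIV S"
  using C1_differentiable_imp_continuous_on[OF S(1)] .

lemma S_measurable [measurable]: "S \<in> borel_measurable borel"
  by (rule borel_measurable_continuous_onI[OF S_continuous])

lemma P_fst: "(\<lambda>q. P (fst q)) \<in> borel_measurable (borel :: ((real \<times> real) \<times> real) measure)"
proof -
  have "(\<lambda>q. P (fst q)) \<in> borel_measurable (borel \<Otimes>\<^sub>M (borel :: real measure))" by measurable
  then show ?thesis by (simp add: borel_prod)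
qed

lemma xw_measurable: "f \<in> L2 M \<Longrightarrow> xw f \<in> borel_measurable borel"
proof -
  assume f: "f \<in> L2 M"
  note [measurable] = P_fst projection_measurable[OF \<Omega>_open f]
  show ?thesis unfolding extended_exit_wave_def[abs_def] extended_exp_def by measurable
qed

lemma ew_measurable: "f \<in> L2 M \<Longrightarrow> ew f \<in> borel_measurable borel"
proof -
  assume f: "f \<in> L2 M"
  note [measurable] = P_fst projection_measurable[OF \<Omega>_open f]
  show ?thesis unfolding exit_wave_def[abs_def] by measurable
qed

lemma projection_wave:
  assumes h: "h \<in> L2 M" shows "wave (projection \<Omega> h) (\<beta> * L2_norm M h)"
  unfolding wave_def
proof (intro conjI ballI projection_measurable[OF \<Omega>_open h])
  show "0 \<le> \<beta> * L2_norm M h" using \<beta>_nonneg by simp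
  fix \<theta> :: real assume \<theta>: "\<theta> \<in> {0..<pi}"
  note b = projection_bound[OF \<Omega>_open \<Omega>_bound B h \<theta>]
  have m: "slice \<Omega>' (projection \<Omega> h) \<theta> \<in> borel_measurable lborel"
    using slice_measurable(1)[OF \<Omega>'_sets projection_measurable[OF \<Omega>_open h]] by simp
  have l: "AE x in lborel. norm (slice \<Omega>' (projection \<Omega> h) \<theta> x) \<le> 1 * norm (projection \<Omega> h (x, \<theta>))"
    by (simp add: slice_def)
  show "slice \<Omega>' (projection \<Omega> h) \<theta> \<in> L2 lborel" by (rule L2_norm_le_pointwise(1)[OF b(2) m l]) simp
  show "L2_norm lborel (slice \<Omega>' (projection \<Omega> h) \<theta>) \<le> \<beta> * L2_norm M h"
    using L2_norm_le_pointwise(2)[OF b(2) m l] b(3) by (simp add: \<beta>_def)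
qed

lemma xw_wave:
  assumes f: "f \<in> L2 M" shows "wave (xw f) (CP * exp 1 * sqrt area)"
proof (rule wave_dominated[OF wave_one xw_measurable[OF f]])
  fix \<theta> :: real
  show "AE x in lborel. norm (xw f (x, \<theta>)) \<le> CP * exp 1 * norm (1 :: complex)"
    using P_bound
  proof eventually_elim
    case (elim x)
    then show ?case
      unfolding extended_exit_wave_def norm_mult fst_conv
      using norm_extended_exp_le[OF k S_pos S_lower, of "projection \<Omega> f (x, \<theta>)"] CP by (auto intro!: mult_mono)
  qed
qed (use CP in simp)

lemma admissible_L2: "f \<in> admissible \<Omega> \<Longrightarrow> f \<in> L2 M" by (simp add: admissible_def)

lemma admissible_Im:
  assumes f: "f \<in> admissible \<Omega>" and \<theta>: "\<theta> \<in> {0..<pi}"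
  shows "AE x in lborel. Im (projection \<Omega> f (x, \<theta>)) \<ge> 0"
proof (rule projection_Im_nonneg[OF \<Omega>_open \<Omega>_bound B admissible_L2[OF f] \<theta>])
  show "AE p in M. 0 \<le> Im (f p)" using f by (auto simp: admissible_def)
qed

lemma xw_eq_ew:
  assumes f: "f \<in> admissible \<Omega>"
  shows "\<forall>\<theta>\<in>{0..<pi}. AE x in lborel. xw f (x, \<theta>) = ew f (x, \<theta>)"
proof
  fix \<theta> :: real assume "\<theta> \<in> {0..<pi}"
  from admissible_Im[OF f this] show "AE x in lborel. xw f (x, \<theta>) = ew f (x, \<theta>)"
    by eventually_elim (simp add: extended_exit_wave_def exit_wave_def extended_exp_eq[OF S_pos])
qed

lemma ew_bound:
  assumes f: "f \<in> admissible \<Omega>" and \<theta>: "\<theta> \<in> {0..<pi}"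
  shows "AE x in lborel. norm (ew f (x, \<theta>)) \<le> CP"
  using admissible_Im[OF f \<theta>] P_bound
proof eventually_elim
  case (elim x)
  have "norm (exp (\<i> * of_real k * projection \<Omega> f (x, \<theta>))) \<le> 1" using elim(1) k by simp
  then have "norm (P x) * norm (exp (\<i> * of_real k * projection \<Omega> f (x, \<theta>))) \<le> CP * 1"
    using elim(2) CP by (intro mult_mono) auto
  then show ?case by (simp add: exit_wave_def norm_mult)
qed

lemma ew_wave:
  assumes f: "f \<in> admissible \<Omega>" shows "wave (ew f) (CP * sqrt area)"
  by (rule wave_dominated[OF wave_one ew_measurable[OF admissible_L2[OF f]] CP]) (use ew_bound[OF f] in simp)

lemma dw_wave:
  assumes f: "f \<in> admissible \<Omega>" and h: "h \<in> L2 M"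
  shows "wave (dw f h) (k * CP * (\<beta> * L2_norm M h))"
proof (rule wave_dominated[OF projection_wave[OF h]])
  note [measurable] = ew_measurable[OF admissible_L2[OF f]] projection_measurable[OF \<Omega>_open h]
  show "dw f h \<in> borel_measurable borel" by measurable
  fix \<theta> :: real assume \<theta>: "\<theta> \<in> {0..<pi}"
  show "AE x in lborel. norm (dw f h (x, \<theta>)) \<le> k * CP * norm (projection \<Omega> h (x, \<theta>))"
    using ew_bound[OF f \<theta>]
  proof eventually_elim
    case (elim x)
    show ?case unfolding norm_mult using elim k by (auto intro!: mult_right_mono mult_left_mono)
  qed
qed (use k CP in simp)

text \<open>
  The pointwise remainder of the exponential is \<open>\<epsilon>\<close> times the projected increment plus a multiple of
  its square. In \<open>L\<^sup>1\<close> of the window the square is bounded by the squared norm of the increment, and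
  the propagator turns the estimate into one at every point.
\<close>

lemma propagated_remainder_le:
  assumes \<epsilon>: "\<epsilon> > 0"
  shows "\<exists>K\<ge>0. \<forall>f\<in>admissible \<Omega>. \<forall>h\<in>L2 M. \<forall>q\<in>space N.
    norm (V (xw (\<lambda>p. f p + h p)) q - V (ew f) q - V (dw f h) q)
      \<le> c0 * (CP * (\<epsilon> * (sqrt area * (\<beta> * L2_norm M h)) + K * (\<beta> * L2_norm M h)\<^sup>2))"
proof -
  obtain K where K: "K \<ge> 0" "\<And>g \<eta>. Im g \<ge> 0 \<Longrightarrow>
    norm (extended_exp k S (g + \<eta>) - exp (\<i> * of_real k * g) - \<i> * of_real k * exp (\<i> * of_real k * g) * \<eta>)
      \<le> \<epsilon> * norm \<eta> + K * (norm \<eta>)\<^sup>2"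
    using extended_exp_remainder[OF k S S_pos S_lower \<epsilon>] by blast
  show ?thesis
  proof (intro exI[of _ K] conjI ballI K(1))
    fix f h :: "real \<times> real \<times> real \<Rightarrow> complex" and q assume f: "f \<in> admissible \<Omega>" and h: "h \<in> L2 M" and q: "q \<in> space N"
    let ?n = "\<beta> * L2_norm M h"
    let ?u = "xw (\<lambda>p. f p + h p)" and ?r = "\<lambda>q. (xw (\<lambda>p. f p + h p) q - ew f q) - dw f h q"
    have fL: "f \<in> L2 M" by (rule admissible_L2[OF f])
    define \<theta> where "\<theta> = snd q"
    have \<theta>: "\<theta> \<in> {0..<pi}" using space_N[OF q] by (simp add: \<theta>_def)
    note wu = xw_wave[OF L2_add[OF fL h]] and we = ew_wave[OF f] and wd = dw_wave[OF f h] and wp = projection_wave[OF h]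
    have e: "slice \<Omega>' ?r \<theta> = (\<lambda>x. (slice \<Omega>' ?u \<theta> x - slice \<Omega>' (ew f) \<theta> x) - slice \<Omega>' (dw f h) \<theta> x)"
      by (auto simp: slice_def fun_eq_iff)
    have i1: "integrable lborel (\<lambda>x. slice \<Omega>' ?u \<theta> x - slice \<Omega>' (ew f) \<theta> x)"
      by (intro Bochner_Integration.integrable_diff wave_integrable(1)[OF wu \<theta>] wave_integrable(1)[OF we \<theta>])
    have i: "integrable lborel (slice \<Omega>' ?r \<theta>)"
      unfolding e by (intro Bochner_Integration.integrable_diff i1 wave_integrable(1)[OF wd \<theta>])
    have Vr: "V ?r q = V ?u q - V (ew f) q - V (dw f h) q"
      unfolding \<theta>_def[symmetric] e
      by (simp only: fresnel_conv_diff[OF i1 wave_integrable(1)[OF wd \<theta>]]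
          fresnel_conv_diff[OF wave_integrable(1)[OF wu \<theta>] wave_integrable(1)[OF we \<theta>]])
    let ?s = "slice \<Omega>' (projection \<Omega> h) \<theta>"
    have s: "?s \<in> L2 lborel" "L2_norm lborel ?s \<le> ?n" using wp \<theta> by (auto simp: wave_def)
    have is2: "integrable lborel (\<lambda>x. (norm (?s x))\<^sup>2)" using s by (simp add: L2_def)
    have is1: "integrable lborel (\<lambda>x. norm (?s x))" using wave_integrable(1)[OF wp \<theta>] by simp
    have "AE x in lborel. norm (slice \<Omega>' ?r \<theta> x) \<le> CP * (\<epsilon> * norm (?s x) + K * (norm (?s x))\<^sup>2)"
      using admissible_Im[OF f \<theta>] P_bound projection_add[OF \<Omega>_open \<Omega>_bound B fL h \<theta>]
    proof eventually_elim
      case (elim x)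
      let ?g = "projection \<Omega> f (x, \<theta>)" and ?\<eta> = "projection \<Omega> h (x, \<theta>)"
      have "?r (x, \<theta>) = P x * (extended_exp k S (?g + ?\<eta>) - exp (\<i> * of_real k * ?g) - \<i> * of_real k * exp (\<i> * of_real k * ?g) * ?\<eta>)"
        by (simp add: extended_exit_wave_def exit_wave_def elim(3) algebra_simps)
      then have "norm (?r (x, \<theta>)) \<le> CP * (\<epsilon> * norm ?\<eta> + K * (norm ?\<eta>)\<^sup>2)"
        using K(2)[OF elim(1), of ?\<eta>] elim(2) CP by (simp only: norm_mult) (intro mult_mono, auto)
      then show ?case by (simp add: slice_def)
    qed
    then have "(\<integral>x. norm (slice \<Omega>' ?r \<theta> x) \<partial>lborel) \<le> (\<integral>x. CP * (\<epsilon> * norm (?s x) + K * (norm (?s x))\<^sup>2) \<partial>lborel)"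
      using i is1 is2 by (intro integral_mono_AE) auto
    also have "\<dots> = CP * (\<epsilon> * (\<integral>x. norm (?s x) \<partial>lborel) + K * (L2_norm lborel ?s)\<^sup>2)"
      using is1 is2 by (simp add: L2_norm_sq)
    also have "\<dots> \<le> CP * (\<epsilon> * (sqrt area * ?n) + K * ?n\<^sup>2)"
      using CP \<epsilon> K(1) wave_integrable(2)[OF wp \<theta>] s(2)
      by (intro mult_left_mono add_mono power_mono) auto
    finally have "norm (V ?r q) \<le> c0 * (CP * (\<epsilon> * (sqrt area * ?n) + K * ?n\<^sup>2))"
      using i unfolding \<theta>_def by (intro V_le)
    then show "norm (V ?u q - V (ew f) q - V (dw f h) q) \<le> c0 * (CP * (\<epsilon> * (sqrt area * ?n) + K * ?n\<^sup>2))"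
      unfolding Vr .
  qed
qed

text \<open>
  The propagated field is differentiable as a map into the bounded functions, uniformly over the
  admissible set.
\<close>

lemma propagated_remainder_small:
  assumes \<epsilon>: "\<epsilon> > 0"
  shows "\<exists>\<delta>>0. \<forall>f\<in>admissible \<Omega>. \<forall>h\<in>L2 M. L2_norm M h < \<delta> \<longrightarrow> (\<forall>q\<in>space N.
    norm (V (xw (\<lambda>p. f p + h p)) q - V (ew f) q - V (dw f h) q) \<le> \<epsilon> * L2_norm M h)"
proof -
  \<comment> \<open>the linear coefficient of the preceding estimate, increased by one so that it may be divided by\<close>
  define a where "a = c0 * CP * sqrt area * \<beta> + 1"
  have a: "a > 0" using c0_pos CP area_nonneg \<beta>_nonneg by (auto simp: a_def intro!: add_nonneg_pos mult_nonneg_nonneg)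
  obtain K where K: "K \<ge> 0" "\<And>f h q. f \<in> admissible \<Omega> \<Longrightarrow> h \<in> L2 M \<Longrightarrow> q \<in> space N \<Longrightarrow>
    norm (V (xw (\<lambda>p. f p + h p)) q - V (ew f) q - V (dw f h) q)
      \<le> c0 * (CP * (\<epsilon> / (2 * a) * (sqrt area * (\<beta> * L2_norm M h)) + K * (\<beta> * L2_norm M h)\<^sup>2))"
    using propagated_remainder_le[of "\<epsilon> / (2 * a)"] \<epsilon> a by auto
  define c where "c = c0 * CP * K * \<beta>\<^sup>2 + 1"
  have c: "c > 0" using c0_pos CP K(1) by (auto simp: c_def intro!: add_nonneg_pos mult_nonneg_nonneg)
  show ?thesis
  proof (intro exI[of _ "\<epsilon> / (2 * c)"] conjI ballI impI)
    show "\<epsilon> / (2 * c) > 0" using \<epsilon> c by simp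
    fix f h :: "real \<times> real \<times> real \<Rightarrow> complex" and q assume f: "f \<in> admissible \<Omega>" and h: "h \<in> L2 M" and n: "L2_norm M h < \<epsilon> / (2 * c)" and q: "q \<in> space N"
    let ?n = "L2_norm M h"
    have "c0 * (CP * (\<epsilon> / (2 * a) * (sqrt area * (\<beta> * ?n)) + K * (\<beta> * ?n)\<^sup>2))
      = (a - 1) * (\<epsilon> / (2 * a) * ?n) + (c - 1) * ?n * ?n"
      by (simp add: a_def c_def algebra_simps power2_eq_square)
    also have "\<dots> \<le> a * (\<epsilon> / (2 * a) * ?n) + c * ?n * ?n"
      using \<epsilon> a c by (intro add_mono mult_right_mono) auto
    also have "\<dots> \<le> \<epsilon> / 2 * ?n + \<epsilon> / 2 * ?n"
      using a c n by (intro add_mono mult_right_mono) (auto simp: field_simps)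
    finally show "norm (V (xw (\<lambda>p. f p + h p)) q - V (ew f) q - V (dw f h) q) \<le> \<epsilon> * ?n"
      using K(2)[OF f h q] by simp
  qed
qed

text \<open>
  For admissible \<open>f\<close>, the linearised wave for a unit increment is at most \<open>\<mu>\<close> and the wave itself
  at most \<open>\<nu>\<close> in the supremum norm, after propagation.
\<close>

definition \<mu> :: real where "\<mu> = c0 * (sqrt area * (k * CP * \<beta>))"
definition \<nu> :: real where "\<nu> = c0 * (sqrt area * (CP * sqrt area))"

lemma \<mu>_nonneg: "\<mu> \<ge> 0" and \<nu>_nonneg: "\<nu> \<ge> 0"
  using c0_pos k CP area_nonneg \<beta>_nonneg by (simp_all add: \<mu>_def \<nu>_def)

lemma V_dw_le: "f \<in> admissible \<Omega> \<Longrightarrow> h \<in> L2 M \<Longrightarrow> q \<in> space N \<Longrightarrow> norm (V (dw f h) q) \<le> \<mu> * L2_norm M h"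
  using wave_V_le[OF dw_wave, of f h q] by (simp add: \<mu>_def mult_ac)

lemma V_ew_le: "f \<in> admissible \<Omega> \<Longrightarrow> q \<in> space N \<Longrightarrow> norm (V (ew f) q) \<le> \<nu>"
  using wave_V_le[OF ew_wave, of f q] by (simp add: \<nu>_def)

lemma T_AE: "f \<in> L2 M \<Longrightarrow> AE q in N. T f q = (norm (V (xw f) q))\<^sup>2"
  using wave_fresnel(2)[OF xw_wave[of f]] unfolding extended_forward_op_def by (auto elim!: AE_mp)

lemma T_AE_admissible:
  assumes f: "f \<in> admissible \<Omega>" shows "AE q in N. T f q = (norm (V (ew f) q))\<^sup>2"
  using fresnel_cong[OF xw_wave[OF admissible_L2[OF f]] ew_wave[OF f] xw_eq_ew[OF f]] wave_fresnel(2)[OF ew_wave[OF f]]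
  by eventually_elim (simp add: extended_forward_op_def)

lemma D_AE:
  assumes f: "f \<in> admissible \<Omega>" and h: "h \<in> L2 M"
  shows "AE q in N. D f h q = 2 * Re (cnj (V (ew f) q) * V (dw f h) q)"
  using wave_fresnel(2)[OF ew_wave[OF f]] wave_fresnel(2)[OF dw_wave[OF f h]]
  by eventually_elim (simp add: forward_derivative_def)

lemma T_measurable: "f \<in> L2 M \<Longrightarrow> T f \<in> borel_measurable N"
  using L2_measurable[OF wave_intensity_L2[OF xw_wave[of f]]] by (simp add: extended_forward_op_def[abs_def])

lemma D_measurable:
  assumes f: "f \<in> admissible \<Omega>" and h: "h \<in> L2 M"
  shows "D f h \<in> borel_measurable N"
proof -
  note [measurable] = wave_fresnel(1)[OF ew_wave[OF f]] wave_fresnel(1)[OF dw_wave[OF f h]]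
  show ?thesis unfolding forward_derivative_def[abs_def] by (rule measurable_N) measurable
qed

lemma Re_cnj_mult_le: "\<bar>Re (cnj a * b)\<bar> \<le> norm a * norm b"
  using abs_Re_le_cmod[of "cnj a * b"] by (simp add: norm_mult)

lemma intensity_expansion:
  fixes a b d :: complex
  shows "(norm b)\<^sup>2 - (norm a)\<^sup>2 = (norm (b - a))\<^sup>2 + 2 * Re (cnj a * (b - a))"
    and "(norm b)\<^sup>2 - (norm a)\<^sup>2 - 2 * Re (cnj a * d) = (norm (b - a))\<^sup>2 + 2 * Re (cnj a * (b - a - d))"
  unfolding cmod_power2 by (simp_all add: power2_eq_square algebra_simps)

lemma field_increment_le:
  assumes f: "f \<in> admissible \<Omega>" and h: "h \<in> L2 M" and q: "q \<in> space N" and e: "e \<ge> 0"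
    and r: "norm (V (xw (\<lambda>p. f p + h p)) q - V (ew f) q - V (dw f h) q) \<le> e * L2_norm M h"
  shows "norm (V (xw (\<lambda>p. f p + h p)) q - V (ew f) q) \<le> (e + \<mu>) * L2_norm M h"
  using norm_triangle_ineq[of "V (xw (\<lambda>p. f p + h p)) q - V (ew f) q - V (dw f h) q" "V (dw f h) q"]
    r V_dw_le[OF f h q] by (simp add: distrib_right)

text \<open>
  With \<open>b\<close> and \<open>a\<close> the new and the old field and \<open>d\<close> the propagated linear part, the remainder of
  the intensity is \<open>|b - a|\<^sup>2 + 2 Re (cnj a (b - a - d))\<close>. The first term is quadratic in the increment,
  the second is the bounded field times the small remainder.
\<close>

lemma T_frechet:
  assumes f: "f \<in> admissible \<Omega>" and \<epsilon>: "\<epsilon> > 0"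
  shows "\<exists>\<delta>>0. \<forall>h\<in>L2 M. L2_norm M h < \<delta> \<longrightarrow>
        L2_norm N (\<lambda>q. T (\<lambda>p. f p + h p) q - T f q - D f h q) \<le> \<epsilon> * L2_norm M h"
proof -
  define s where "s = sqrt (measure N (space N)) + 1"
  have s: "s > 0" "sqrt (measure N (space N)) \<le> s" by (auto simp: s_def intro: add_nonneg_pos)
  \<comment> \<open>the accuracy of the field expansion for which the mixed term takes up half of \<open>\<epsilon>\<close>; it is at most one, so that the increment of the field is at most \<open>1 + \<mu>\<close> times the norm of \<open>h\<close>\<close>
  define e where "e = min 1 (\<epsilon> / (4 * (\<nu> + 1) * s))"
  have e: "e > 0" "e \<le> 1" "e \<le> \<epsilon> / (4 * (\<nu> + 1) * s)" using \<epsilon> s \<nu>_nonneg by (auto simp: e_def)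
  obtain \<delta>1 where \<delta>1: "\<delta>1 > 0" "\<And>h q. h \<in> L2 M \<Longrightarrow> L2_norm M h < \<delta>1 \<Longrightarrow> q \<in> space N \<Longrightarrow>
    norm (V (xw (\<lambda>p. f p + h p)) q - V (ew f) q - V (dw f h) q) \<le> e * L2_norm M h"
    using propagated_remainder_small[OF e(1)] f by blast
  define m where "m = (1 + \<mu>)\<^sup>2"
  have m: "m > 0" using \<mu>_nonneg by (simp add: m_def)
  \<comment> \<open>the second bound leaves the other half of \<open>\<epsilon>\<close> to the quadratic term\<close>
  define \<delta> where "\<delta> = min \<delta>1 (\<epsilon> / (2 * m * s))"
  show ?thesis
  proof (intro exI[of _ \<delta>] conjI ballI impI)
    show "\<delta> > 0" using \<delta>1 \<epsilon> m s by (simp add: \<delta>_def)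
    fix h :: "real \<times> real \<times> real \<Rightarrow> complex" assume h: "h \<in> L2 M" and n: "L2_norm M h < \<delta>"
    let ?n = "L2_norm M h"
    have n1: "?n < \<delta>1" and n2: "?n \<le> \<epsilon> / (2 * m * s)" using n by (auto simp: \<delta>_def)
    have fh: "(\<lambda>p. f p + h p) \<in> L2 M" by (rule L2_add[OF admissible_L2[OF f] h])
    let ?c = "m * ?n\<^sup>2 + 2 * (\<nu> * (e * ?n))"
    have c: "?c \<ge> 0" using m \<nu>_nonneg e by simp
    have "AE q in N. norm (T (\<lambda>p. f p + h p) q - T f q - D f h q) \<le> ?c"
      using T_AE[OF fh] T_AE_admissible[OF f] D_AE[OF f h] AE_space
    proof eventually_elim
      case (elim q)
      let ?b = "V (xw (\<lambda>p. f p + h p)) q" and ?a = "V (ew f) q" and ?d = "V (dw f h) q"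
      have r: "norm (?b - ?a - ?d) \<le> e * ?n" by (rule \<delta>1(2)[OF h n1 elim(4)])
      have "norm (?b - ?a) \<le> (e + \<mu>) * ?n" by (rule field_increment_le[OF f h elim(4) less_imp_le[OF e(1)] r])
      also have "\<dots> \<le> (1 + \<mu>) * ?n" using e by (intro mult_right_mono) auto
      finally have "(norm (?b - ?a))\<^sup>2 \<le> m * ?n\<^sup>2"
        using power_mono[of "norm (?b - ?a)" "(1 + \<mu>) * ?n" 2] by (simp add: m_def power_mult_distrib)
      moreover have "\<bar>Re (cnj ?a * (?b - ?a - ?d))\<bar> \<le> \<nu> * (e * ?n)"
        by (rule order_trans[OF Re_cnj_mult_le mult_mono[OF V_ew_le[OF f elim(4)] r]]) (use \<nu>_nonneg in auto)
      moreover have "0 \<le> (norm (?b - ?a))\<^sup>2" by simp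
      ultimately have "\<bar>(norm (?b - ?a))\<^sup>2 + 2 * Re (cnj ?a * (?b - ?a - ?d))\<bar> \<le> ?c" by linarith
      then show ?case unfolding elim(1-3) real_norm_def intensity_expansion(2) .
    qed
    then have "L2_norm N (\<lambda>q. T (\<lambda>p. f p + h p) q - T f q - D f h q) \<le> ?c * sqrt (measure N (space N))"
      by (intro L2_finite_measure_bounded(2)[OF finite_N] c borel_measurable_diff T_measurable D_measurable f h fh admissible_L2)
    also have "\<dots> \<le> ?c * s" using s c by (intro mult_left_mono)
    also have "\<dots> = (m * s * ?n) * ?n + (2 * \<nu> * s * e) * ?n" by (simp add: algebra_simps power2_eq_square)
    also have "\<dots> \<le> \<epsilon> / 2 * ?n + \<epsilon> / 2 * ?n"
    proof (intro add_mono mult_right_mono L2_norm_nonneg)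
      show "m * s * ?n \<le> \<epsilon> / 2" using mult_left_mono[OF n2, of "m * s"] m s by (simp add: field_simps)
      have "2 * \<nu> * s * e \<le> 2 * (\<nu> + 1) * s * e" using s e by (intro mult_right_mono) auto
      also have "\<dots> \<le> 2 * (\<nu> + 1) * s * (\<epsilon> / (4 * (\<nu> + 1) * s))" using e s \<nu>_nonneg by (intro mult_left_mono) auto
      also have "\<dots> = 2 * ((\<nu> + 1) * s) * (\<epsilon> / (4 * ((\<nu> + 1) * s)))" by (simp only: mult.assoc)
      also have "\<dots> = \<epsilon> / 2" using s \<nu>_nonneg by simp
      finally show "2 * \<nu> * s * e \<le> \<epsilon> / 2" .
    qed
    finally show "L2_norm N (\<lambda>q. T (\<lambda>p. f p + h p) q - T f q - D f h q) \<le> \<epsilon> * ?n" by simp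
  qed
qed

text \<open>
  The same expansion without the linear part; the increment of the field is at most a constant times
  the norm of \<open>h\<close>.
\<close>

lemma T_continuous:
  assumes f: "f \<in> admissible \<Omega>" and \<epsilon>: "\<epsilon> > 0"
  shows "\<exists>\<delta>>0. \<forall>h\<in>L2 M. L2_norm M h < \<delta> \<longrightarrow> L2_norm N (\<lambda>q. T (\<lambda>p. f p + h p) q - T f q) < \<epsilon>"
proof -
  define s where "s = sqrt (measure N (space N)) + 1"
  have s: "s > 0" "sqrt (measure N (space N)) \<le> s" by (auto simp: s_def intro: add_nonneg_pos)
  obtain \<delta>1 where \<delta>1: "\<delta>1 > 0" "\<And>h q. h \<in> L2 M \<Longrightarrow> L2_norm M h < \<delta>1 \<Longrightarrow> q \<in> space N \<Longrightarrow>
    norm (V (xw (\<lambda>p. f p + h p)) q - V (ew f) q - V (dw f h) q) \<le> 1 * L2_norm M h"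
    using propagated_remainder_small[of 1] f by fastforce
  define Q where "Q = (1 + \<mu>)\<^sup>2 + 2 * (\<nu> * (1 + \<mu>)) + 1"
  have Q: "Q > 0" using \<mu>_nonneg \<nu>_nonneg by (auto simp: Q_def intro!: add_nonneg_pos)
  define \<delta> where "\<delta> = min \<delta>1 (min 1 (\<epsilon> / (Q * s)))"
  show ?thesis
  proof (intro exI[of _ \<delta>] conjI ballI impI)
    show "\<delta> > 0" using \<delta>1 \<epsilon> Q s by (simp add: \<delta>_def)
    fix h :: "real \<times> real \<times> real \<Rightarrow> complex" assume h: "h \<in> L2 M" and n: "L2_norm M h < \<delta>"
    let ?n = "L2_norm M h"
    have n1: "?n < \<delta>1" and n2: "?n \<le> 1" and n3: "?n < \<epsilon> / (Q * s)" using n by (auto simp: \<delta>_def)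
    have fh: "(\<lambda>p. f p + h p) \<in> L2 M" by (rule L2_add[OF admissible_L2[OF f] h])
    have c: "Q * ?n \<ge> 0" using Q by simp
    have "AE q in N. norm (T (\<lambda>p. f p + h p) q - T f q) \<le> Q * ?n"
      using T_AE[OF fh] T_AE_admissible[OF f] AE_space
    proof eventually_elim
      case (elim q)
      let ?b = "V (xw (\<lambda>p. f p + h p)) q" and ?a = "V (ew f) q"
      have i: "norm (?b - ?a) \<le> (1 + \<mu>) * ?n"
        by (rule field_increment_le[OF f h elim(3) zero_le_one \<delta>1(2)[OF h n1 elim(3)]])
      have "(norm (?b - ?a))\<^sup>2 \<le> (1 + \<mu>)\<^sup>2 * (?n * ?n)"
        using power_mono[OF i norm_ge_zero, of 2] by (simp only: power_mult_distrib power2_eq_square[of ?n])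
      also have "\<dots> \<le> (1 + \<mu>)\<^sup>2 * (1 * ?n)" using n2 by (intro mult_left_mono mult_right_mono) auto
      finally have "(norm (?b - ?a))\<^sup>2 \<le> (1 + \<mu>)\<^sup>2 * ?n" by simp
      moreover have "\<bar>Re (cnj ?a * (?b - ?a))\<bar> \<le> \<nu> * ((1 + \<mu>) * ?n)"
        by (rule order_trans[OF Re_cnj_mult_le mult_mono[OF V_ew_le[OF f elim(3)] i]]) (use \<nu>_nonneg in auto)
      moreover have "0 \<le> (norm (?b - ?a))\<^sup>2" "0 \<le> ?n" by simp_all
      moreover have "Q * ?n = (1 + \<mu>)\<^sup>2 * ?n + 2 * (\<nu> * ((1 + \<mu>) * ?n)) + ?n" by (simp add: Q_def algebra_simps)
      ultimately have "\<bar>(norm (?b - ?a))\<^sup>2 + 2 * Re (cnj ?a * (?b - ?a))\<bar> \<le> Q * ?n" by linarith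
      then show ?case unfolding elim(1,2) real_norm_def intensity_expansion(1) .
    qed
    then have "L2_norm N (\<lambda>q. T (\<lambda>p. f p + h p) q - T f q) \<le> Q * ?n * sqrt (measure N (space N))"
      by (intro L2_finite_measure_bounded(2)[OF finite_N] c borel_measurable_diff T_measurable f h fh admissible_L2)
    also have "\<dots> \<le> Q * ?n * s" using s c by (intro mult_left_mono)
    also have "\<dots> < \<epsilon>" using n3 Q s by (simp add: field_simps)
    finally show "L2_norm N (\<lambda>q. T (\<lambda>p. f p + h p) q - T f q) < \<epsilon>" .
  qed
qed

lemma D_bounded_linear:
  assumes f: "f \<in> admissible \<Omega>" shows "L2_bounded_linear M N (D f)"
proof -
  have bound: "AE q in N. norm (D f h q) \<le> 2 * (\<nu> * (\<mu> * L2_norm M h))" if h: "h \<in> L2 M" for h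
    using D_AE[OF f h] AE_space
  proof eventually_elim
    case (elim q)
    have "\<bar>Re (cnj (V (ew f) q) * V (dw f h) q)\<bar> \<le> \<nu> * (\<mu> * L2_norm M h)"
      by (rule order_trans[OF Re_cnj_mult_le mult_mono[OF V_ew_le[OF f elim(2)] V_dw_le[OF f h elim(2)]]]) (use \<nu>_nonneg in auto)
    then show ?case unfolding elim(1) by simp
  qed
  have nn: "2 * (\<nu> * (\<mu> * L2_norm M h)) \<ge> 0" for h :: "real \<times> real \<times> real \<Rightarrow> complex" using \<nu>_nonneg \<mu>_nonneg by simp
  note est = L2_finite_measure_bounded[OF finite_N D_measurable[OF f] bound nn]
  have cong: "V (dw f g) q = V (dw f h) q"
    if g: "g \<in> L2 M" and h: "h \<in> L2 M" and eq: "AE p in M. g p = h p" and q: "q \<in> space N" for g h q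
  proof (rule V_cong_AE)
    have \<theta>: "snd q \<in> {0..<pi}" using space_N[OF q] by simp
    show "AE x in lborel. dw f g (x, snd q) = dw f h (x, snd q)"
      using projection_cong_AE[OF \<Omega>_open \<Omega>_bound B g h \<theta> eq] by eventually_elim simp
  qed (use dw_wave[OF f g] dw_wave[OF f h] in \<open>simp_all add: wave_def\<close>)
  have add: "V (dw f (\<lambda>p. g p + h p)) q = V (dw f g) q + V (dw f h) q"
    if g: "g \<in> L2 M" and h: "h \<in> L2 M" and q: "q \<in> space N" for g h q
  proof -
    have \<theta>: "snd q \<in> {0..<pi}" using space_N[OF q] by simp
    have "V (dw f (\<lambda>p. g p + h p)) q = V (\<lambda>q. dw f g q + dw f h q) q"
    proof (rule V_cong_AE)
      show "AE x in lborel. dw f (\<lambda>p. g p + h p) (x, snd q) = dw f g (x, snd q) + dw f h (x, snd q)"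
        using projection_add[OF \<Omega>_open \<Omega>_bound B g h \<theta>] by eventually_elim (simp add: distrib_left)
      show "(\<lambda>q. dw f g q + dw f h q) \<in> borel_measurable borel"
        using dw_wave[OF f g] dw_wave[OF f h] by (intro borel_measurable_add) (simp_all add: wave_def)
    qed (use dw_wave[OF f L2_add[OF g h]] in \<open>simp add: wave_def\<close>)
    also have "\<dots> = V (dw f g) q + V (dw f h) q" by (rule V_add[OF dw_wave[OF f g] dw_wave[OF f h] q])
    finally show ?thesis .
  qed
  have scale: "V (dw f (\<lambda>p. r *\<^sub>R h p)) q = r *\<^sub>R V (dw f h) q" for r h q
  proof -
    have "dw f (\<lambda>p. r *\<^sub>R h p) = (\<lambda>q. r *\<^sub>R dw f h q)" by (simp add: fun_eq_iff projection_scaleR)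
    then show ?thesis by (simp only: V_scaleR)
  qed
  show ?thesis
    unfolding L2_bounded_linear_def L2_well_defined_on_def
  proof (intro conjI ballI allI impI)
    fix h :: "real \<times> real \<times> real \<Rightarrow> complex" assume h: "h \<in> L2 M" show "D f h \<in> L2 N" by (rule est(1)[OF h h])
  next
    fix g h :: "real \<times> real \<times> real \<Rightarrow> complex" assume gh: "g \<in> L2 M" "h \<in> L2 M" and eq: "AE p in M. g p = h p"
    show "AE q in N. D f g q = D f h q"
      using D_AE[OF f gh(1)] D_AE[OF f gh(2)] AE_space
      by eventually_elim (simp add: cong[OF gh eq])
  next
    fix g h :: "real \<times> real \<times> real \<Rightarrow> complex" assume gh: "g \<in> L2 M" "h \<in> L2 M"
    show "AE q in N. D f (\<lambda>p. g p + h p) q = D f g q + D f h q"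
      using D_AE[OF f gh(1)] D_AE[OF f gh(2)] D_AE[OF f L2_add[OF gh]] AE_space
    proof eventually_elim
      case (elim q)
      show ?case unfolding elim(1-3) add[OF gh elim(4)] distrib_left by simp
    qed
  next
    fix r :: real and h :: "real \<times> real \<times> real \<Rightarrow> complex" assume h: "h \<in> L2 M"
    show "AE q in N. D f (\<lambda>p. r *\<^sub>R h p) q = r *\<^sub>R D f h q"
      using D_AE[OF f h] D_AE[OF f L2_scaleR[OF h, of r]]
    proof eventually_elim
      case (elim q)
      show ?case unfolding elim(1,2) scale by (simp add: algebra_simps)
    qed
  next
    show "\<exists>C. \<forall>h\<in>L2 M. L2_norm N (D f h) \<le> C * L2_norm M h"
    proof (intro exI[of _ "2 * (\<nu> * \<mu>) * sqrt (measure N (space N))"] ballI)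
      fix h :: "real \<times> real \<times> real \<Rightarrow> complex" assume h: "h \<in> L2 M"
      show "L2_norm N (D f h) \<le> 2 * (\<nu> * \<mu>) * sqrt (measure N (space N)) * L2_norm M h"
        using est(2)[OF h h] by (simp add: mult_ac)
    qed
  qed
qed

lemma xw_cong:
  assumes f: "f \<in> L2 M" and g: "g \<in> L2 M" and eq: "AE p in M. f p = g p"
  shows "\<forall>\<theta>\<in>{0..<pi}. AE x in lborel. xw f (x, \<theta>) = xw g (x, \<theta>)"
proof
  fix \<theta> :: real assume "\<theta> \<in> {0..<pi}"
  from projection_cong_AE[OF \<Omega>_open \<Omega>_bound B f g this eq]
  show "AE x in lborel. xw f (x, \<theta>) = xw g (x, \<theta>)"
    by eventually_elim (simp add: extended_exit_wave_def)
qed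

lemma T_well_defined: "L2_well_defined_on M N (L2 M) T"
  unfolding L2_well_defined_on_def
proof (intro conjI ballI impI)
  fix f :: "real \<times> real \<times> real \<Rightarrow> complex" assume f: "f \<in> L2 M"
  show "T f \<in> L2 N" using wave_intensity_L2[OF xw_wave[OF f]] by (simp add: extended_forward_op_def[abs_def])
next
  fix f g :: "real \<times> real \<times> real \<Rightarrow> complex" assume fg: "f \<in> L2 M" "g \<in> L2 M" and eq: "AE p in M. f p = g p"
  show "AE q in N. T f q = T g q"
    using fresnel_cong[OF xw_wave[OF fg(1)] xw_wave[OF fg(2)] xw_cong[OF fg eq]]
    by eventually_elim (simp add: extended_forward_op_def)
qed

lemma T_eq_forward_op:
  assumes f: "f \<in> admissible \<Omega>" shows "AE q in N. T f q = forward_op k Fr P \<Omega> \<Omega>' f q"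
  using fresnel_cong[OF xw_wave[OF admissible_L2[OF f]] ew_wave[OF f] xw_eq_ew[OF f]]
  by eventually_elim (simp add: extended_forward_op_def forward_op_def)

lemma forward_op_L2: "f \<in> admissible \<Omega> \<Longrightarrow> forward_op k Fr P \<Omega> \<Omega>' f \<in> L2 N"
  using wave_intensity_L2[OF ew_wave[of f]] by (simp add: forward_op_def[abs_def])

lemma forward_op_well_defined: "L2_well_defined_on M N (admissible \<Omega>) (forward_op k Fr P \<Omega> \<Omega>')"
  unfolding L2_well_defined_on_def
proof (intro conjI ballI impI forward_op_L2)
  fix f g :: "real \<times> real \<times> real \<Rightarrow> complex" assume fg: "f \<in> admissible \<Omega>" "g \<in> admissible \<Omega>" and eq: "AE p in M. f p = g p"
  have "AE q in N. T f q = T g q"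
    using T_well_defined eq admissible_L2[OF fg(1)] admissible_L2[OF fg(2)] unfolding L2_well_defined_on_def by blast
  then show "AE q in N. forward_op k Fr P \<Omega> \<Omega>' f q = forward_op k Fr P \<Omega> \<Omega>' g q"
    using T_eq_forward_op[OF fg(1)] T_eq_forward_op[OF fg(2)] by eventually_elim simp
qed

lemma forward_op_continuous: "L2_continuous_on M N (admissible \<Omega>) (forward_op k Fr P \<Omega> \<Omega>')"
  unfolding L2_continuous_on_def
proof (intro ballI allI impI)
  fix f and \<epsilon> :: real assume f: "f \<in> admissible \<Omega>" and \<epsilon>: "\<epsilon> > 0"
  from T_continuous[OF this] obtain \<delta> where \<delta>: "\<delta> > 0"
    "\<And>h. h \<in> L2 M \<Longrightarrow> L2_norm M h < \<delta> \<Longrightarrow> L2_norm N (\<lambda>q. T (\<lambda>p. f p + h p) q - T f q) < \<epsilon>" by blast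
  show "\<exists>\<delta>>0. \<forall>g\<in>admissible \<Omega>. L2_norm M (\<lambda>x. g x - f x) < \<delta> \<longrightarrow>
      L2_norm N (\<lambda>y. forward_op k Fr P \<Omega> \<Omega>' g y - forward_op k Fr P \<Omega> \<Omega>' f y) < \<epsilon>"
  proof (intro exI[of _ \<delta>] conjI ballI impI \<delta>(1))
    fix g assume g: "g \<in> admissible \<Omega>" and n: "L2_norm M (\<lambda>x. g x - f x) < \<delta>"
    have "L2_norm N (\<lambda>q. T (\<lambda>p. f p + (g p - f p)) q - T f q) < \<epsilon>"
      by (rule \<delta>(2)[OF L2_diff[OF admissible_L2[OF g] admissible_L2[OF f]] n])
    moreover have "L2_norm N (\<lambda>q. T g q - T f q) = L2_norm N (\<lambda>y. forward_op k Fr P \<Omega> \<Omega>' g y - forward_op k Fr P \<Omega> \<Omega>' f y)"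
    proof (rule L2_norm_cong_AE)
      show "AE q in N. T g q - T f q = forward_op k Fr P \<Omega> \<Omega>' g q - forward_op k Fr P \<Omega> \<Omega>' f q"
        using T_eq_forward_op[OF g] T_eq_forward_op[OF f] by eventually_elim simp
    qed (intro borel_measurable_diff T_measurable admissible_L2 L2_measurable forward_op_L2 f g)+
    ultimately show "L2_norm N (\<lambda>y. forward_op k Fr P \<Omega> \<Omega>' g y - forward_op k Fr P \<Omega> \<Omega>' f y) < \<epsilon>" by simp
  qed
qed

lemma T_has_derivative: "f \<in> admissible \<Omega> \<Longrightarrow> has_L2_frechet_derivative M N T (D f) f"
  unfolding has_L2_frechet_derivative_def using D_bounded_linear T_frechet by blast

end

theorem theorem1:
  fixes \<Omega> :: "(real \<times> real \<times> real) set" and \<Omega>' :: "(real \<times> real) set"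
    and k Fr :: real and P :: "real \<times> real \<Rightarrow> complex" and S :: "real \<Rightarrow> real"
  assumes "bounded_domain \<Omega>" and "bounded_domain \<Omega>'"
    and "k > 0" and "Fr > 0"
    and "P \<in> borel_measurable borel"
    and "\<exists>C. AE x in lborel. norm (P x) \<le> C"
    and "\<exists>c>0. AE x in lborel. c \<le> norm (P x)"
    and "S C1_differentiable_on UNIV" and "mono S"
    and "\<And>t. t \<ge> 0 \<Longrightarrow> S t = t" and "\<And>t. t < 0 \<Longrightarrow> S t \<ge> - 1 / k"
  shows
    "(\<forall>f\<in>admissible \<Omega>. exit_wave k P \<Omega> f \<in> L2 (detector_measure \<Omega>')) \<and>
     L2_well_defined_on (object_measure \<Omega>) (detector_measure \<Omega>')
       (admissible \<Omega>) (forward_op k Fr P \<Omega> \<Omega>') \<and>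
     L2_continuous_on (object_measure \<Omega>) (detector_measure \<Omega>')
       (admissible \<Omega>) (forward_op k Fr P \<Omega> \<Omega>') \<and>
     (\<forall>f\<in>L2 (object_measure \<Omega>). extended_exit_wave k S P \<Omega> f \<in> L2 (detector_measure \<Omega>')) \<and>
     L2_well_defined_on (object_measure \<Omega>) (detector_measure \<Omega>')
       (L2 (object_measure \<Omega>)) (extended_forward_op k Fr S P \<Omega> \<Omega>') \<and>
     (\<forall>f\<in>admissible \<Omega>. AE q in detector_measure \<Omega>'.
        extended_forward_op k Fr S P \<Omega> \<Omega>' f q = forward_op k Fr P \<Omega> \<Omega>' f q) \<and>
     (\<forall>f\<in>admissible \<Omega>. \<forall>h\<in>L2 (object_measure \<Omega>).
        (\<lambda>q. \<i> * of_real k * exit_wave k P \<Omega> f q * projection \<Omega> h q) \<in> L2 (detector_measure \<Omega>')) \<and>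
     (\<forall>f\<in>admissible \<Omega>.
        has_L2_frechet_derivative (object_measure \<Omega>) (detector_measure \<Omega>')
          (extended_forward_op k Fr S P \<Omega> \<Omega>') (forward_derivative k Fr P \<Omega> \<Omega>' f) f)"
proof -
  obtain C where C: "AE x in lborel. norm (P x) \<le> C" using assms(6) by blast
  have C': "AE x in lborel. norm (P x) \<le> max C 0" using C by eventually_elim simp
  obtain B where B: "\<forall>p\<in>\<Omega>. norm p \<le> B" using assms(1) by (auto simp: bounded_domain_def bounded_iff)
  have B': "\<forall>p\<in>\<Omega>. norm p \<le> max B 0" using B by auto
  have "open \<Omega>" using assms(1) by (simp add: bounded_domain_def)
  then interpret phase_contrast \<Omega>' Fr \<Omega> k P S "max B 0" "max C 0"
    by unfold_locales (use assms C' B' in auto)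
  show ?thesis
    using wave_L2[OF ew_wave] forward_op_well_defined forward_op_continuous wave_L2[OF xw_wave]
      T_well_defined T_eq_forward_op wave_L2[OF dw_wave] T_has_derivative
    by blast
qed

end
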